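(* Let $n\ge 2$, let $W\subseteq [n]$, let $W=W_1\sqcup\cdots\sqcup W_k$ be a partition of $W$, and let $G=F_k^W(K_n)$ be a $k$-fan graph of the complete graph $K_n$ on the set $W$ (with respect to this partition), where for each $i\in[k]$ the branch of the fan on $W_i=\{w_{i,1},\dots,w_{i,r_i}\}$ is $\{K_{a_{i,1}},\dots,K_{a_{i,r_i}}\}$, and put $h_{i,j}=a_{i,j}-j$. Let $p$ be the number of pairs $(i,j)$ with $i\in[k]$, $j\in[r_i]$ and $h_{i,j}\ge 2$. Let $S=\mathbb{K}[x_u : u\in V(G)]$ and let $I_G\subset S$ be the edge ideal of $G$. If $|W|\ge n-1$ and $h_{i,r_i}\ge 2$ for each $i\in[k]$, then $\operatorname{reg}(S/I_G)=p$. Otherwise, $\operatorname{reg}(S/I_G)=p+1$.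
   Context: $\mathbb{K}$ is a field; $[n]=\{1,\dots,n\}$. For a finite simple graph $G$ the edge ideal is $I_G=(x_ux_v : \{u,v\}\in E(G))\subset S=\mathbb{K}[x_u:u\in V(G)]$. For a finitely generated graded $S$-module $M$, $\operatorname{reg}(M)=\max\{j-i : \operatorname{Tor}_i^S(M,\mathbb{K})_j\ne 0\}$ is the Castelnuovo–Mumford regularity. Fan graphs: let $K_n$ be the complete graph on $[n]$. Given $U=\{u_1,\dots,u_r\}\subseteq[n]$ (with a chosen ordering), suppose that for each $i\in[r]$ a new complete graph $K_{a_i}$ on $a_i>i$ vertices is attached to $K_n$ in such a way that $V(K_n)\cap V(K_{a_i})=\{u_1,\dots,u_i\}$ (the new vertices of different attached cliques are pairwise distinct). The resulting graph is said to be obtained by adding a fan to $K_n$ on $U$, and $\{K_{a_1},\dots,K_{a_r}\}$ is the branch of that fan on $U$. If $W\subseteq[n]$ and $W=W_1\sqcup\cdots\sqcup W_k$ is a partition into nonempty subsets, a $k$-fan graph $F_k^W(K_n)$ of $K_n$ on $W$ is a graph obtained from $K_n$ by adding a fan on each $W_i$; thus $V(K_n)\cap V(K_{a_{i,j}})=\{w_{i,1},\dots,w_{i,j}\}$. The complete graph $K_n$ itself is regarded as the degenerate case $k=0$, $W=\emptyset$. *)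

theory Defs
  imports "HOL-Library.Poly_Mapping" "HOL-Library.Disjoint_Sets" "HOL-Algebra.Module" "HOL-Algebra.QuotRing"
begin

section \<open>Polynomial rings and edge ideals\<close>

text \<open>Polynomials with variables indexed by \<^typ>\<open>'v\<close>; a monomial is its finitely supported
  exponent function.\<close>

type_synonym ('v, 'k) mpoly = "('v \<Rightarrow>\<^sub>0 nat) \<Rightarrow>\<^sub>0 'k"

definition poly_ring :: "'v set \<Rightarrow> ('v, 'k::field) mpoly ring" where
  "poly_ring V =
     \<lparr>carrier = {p. \<forall>m \<in> Poly_Mapping.keys p. Poly_Mapping.keys m \<subseteq> V},
      monoid.mult = (*), one = 1, zero = 0, add = (+)\<rparr>"

definition var :: "'v \<Rightarrow> ('v, 'k::field) mpoly" where
  "var v = Poly_Mapping.single (Poly_Mapping.single v 1) 1"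

definition mon_degree :: "('v \<Rightarrow>\<^sub>0 nat) \<Rightarrow> nat" where
  "mon_degree m = (\<Sum>v \<in> Poly_Mapping.keys m. Poly_Mapping.lookup m v)"

text \<open>The graded piece of degree \<open>j\<close> of the standard grading; it is \<open>0\<close> for \<open>j < 0\<close>.\<close>

definition homogeneous :: "'v set \<Rightarrow> int \<Rightarrow> ('v, 'k::field) mpoly set" where
  "homogeneous V j = {p \<in> carrier (poly_ring V).
     \<forall>m \<in> Poly_Mapping.keys p. int (mon_degree m) = j}"

text \<open>A graph is a pair of a vertex set and a set of two-element sets of vertices.\<close>

type_synonym 'v graph = "'v set \<times> 'v set set"

definition edge_ideal :: "'v graph \<Rightarrow> ('v, 'k::field) mpoly set" where
  "edge_ideal G = Idl\<^bsub>poly_ring (fst G)\<^esub> {var u * var v | u v. {u, v} \<in> snd G}"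

text \<open>The module record extends the ring record, so the ring operations of \<open>R/I\<close> are kept as well.\<close>

definition quotient_module :: "('a, 'b) ring_scheme \<Rightarrow> 'a set \<Rightarrow> ('a, 'a set) module" where
  "quotient_module R I =
     \<lparr>carrier = carrier (R Quot I), monoid.mult = monoid.mult (R Quot I), one = one (R Quot I),
      zero = zero (R Quot I), add = add (R Quot I),
      smult = (\<lambda>r X. (I +>\<^bsub>R\<^esub> r) \<otimes>\<^bsub>R Quot I\<^esub> X)\<rparr>"

definition quotient_grading :: "'v set \<Rightarrow> ('v, 'k::field) mpoly set \<Rightarrow> int \<Rightarrow> ('v, 'k) mpoly set set" where
  "quotient_grading V I j = (\<lambda>f. I +>\<^bsub>poly_ring V\<^esub> f) ` homogeneous V j"


section \<open>Graded free resolutions, Tor and regularity\<close>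

text \<open>
  Data of a complex of finitely generated graded free modules over \<open>S = poly_ring V\<close>, augmented to
  a module with elements of type \<^typ>\<open>'m\<close>. The module in homological degree \<open>i\<close> is
  \<open>F\<^sub>i = S(-d\<^sub>0) \<oplus> \<dots> \<oplus> S(-d\<^sub>b\<^sub>-\<^sub>1)\<close> with \<open>b = rank i\<close> and \<open>d\<^sub>l = shift i l\<close>, so its basis
  element with index \<open>l\<close> is homogeneous of degree \<open>shift i l\<close>. The differential from
  \<open>F\<^sub>i\<^sub>+\<^sub>1\<close> to \<open>F\<^sub>i\<close> sends basis element \<open>l'\<close> to the sum over \<open>l\<close> of \<open>diff_coeff i l' l\<close> times basis
  element \<open>l\<close>, and the augmentation sends basis element \<open>l\<close> of \<open>F\<^sub>0\<close> to \<open>gen l\<close>.\<close>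

record (overloaded) ('v, 'k, 'm) free_complex =
  rank :: "nat \<Rightarrow> nat"
  shift :: "nat \<Rightarrow> nat \<Rightarrow> int"
  diff_coeff :: "nat \<Rightarrow> nat \<Rightarrow> nat \<Rightarrow> ('v, 'k) mpoly"
  gen :: "nat \<Rightarrow> 'm"

definition free_part ::
  "'v set \<Rightarrow> ('v, 'k::field, 'm) free_complex \<Rightarrow> nat \<Rightarrow> (nat \<Rightarrow> ('v, 'k) mpoly) set" where
  "free_part V F i =
     {c. (\<forall>l < rank F i. c l \<in> carrier (poly_ring V)) \<and> (\<forall>l \<ge> rank F i. c l = 0)}"

definition differential ::
  "('v, 'k::field, 'm) free_complex \<Rightarrow> nat \<Rightarrow> (nat \<Rightarrow> ('v, 'k) mpoly) \<Rightarrow> nat \<Rightarrow> ('v, 'k) mpoly" where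
  "differential F i c =
     (\<lambda>l. if l < rank F i then \<Sum>l' < rank F (Suc i). c l' * diff_coeff F i l' l else 0)"

definition augmentation ::
  "(('v, 'k::field) mpoly, 'm) module \<Rightarrow> ('v, 'k, 'm) free_complex \<Rightarrow> (nat \<Rightarrow> ('v, 'k) mpoly) \<Rightarrow> 'm" where
  "augmentation M F c = (\<Oplus>\<^bsub>M\<^esub>l \<in> {..<rank F 0}. c l \<odot>\<^bsub>M\<^esub> gen F l)"

text \<open>\<open>F\<close> is a graded free resolution of the \<open>poly_ring V\<close>-module \<open>M\<close> with graded pieces \<open>gr j\<close>:
  all maps are homogeneous of degree \<open>0\<close> and the augmented complex is exact.\<close>

definition graded_free_resolution ::
  "'v set \<Rightarrow> (('v, 'k::field) mpoly, 'm) module \<Rightarrow> (int \<Rightarrow> 'm set) \<Rightarrow>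
   ('v, 'k, 'm) free_complex \<Rightarrow> bool" where
  "graded_free_resolution V M gr F \<longleftrightarrow>
     (\<forall>l < rank F 0. gen F l \<in> gr (shift F 0 l)) \<and>
     (\<forall>i. \<forall>l' < rank F (Suc i). \<forall>l < rank F i.
        diff_coeff F i l' l \<in> homogeneous V (shift F (Suc i) l' - shift F i l)) \<and>
     augmentation M F ` free_part V F 0 = carrier M \<and>
     {c \<in> free_part V F 0. augmentation M F c = \<zero>\<^bsub>M\<^esub>} = differential F 0 ` free_part V F 1 \<and>
     (\<forall>i. {c \<in> free_part V F (Suc i). differential F i c = (\<lambda>_. 0)} =
        differential F (Suc i) ` free_part V F (Suc (Suc i)))"

text \<open>
  The complex \<open>F \<otimes>\<^sub>S \<bbbK>\<close>, where \<open>\<bbbK>\<close> is the quotient of \<open>S\<close> by the ideal of all variables. Tensoring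
  turns each \<open>S(-d)\<close> into a copy of \<open>\<bbbK>\<close> concentrated in degree \<open>d\<close> and each coefficient of a
  differential into its constant term. \<open>tensor_part F i j\<close> is the degree \<open>j\<close> piece of
  \<open>F\<^sub>i \<otimes>\<^sub>S \<bbbK>\<close>.\<close>

definition tensor_part :: "('v, 'k::field, 'm) free_complex \<Rightarrow> nat \<Rightarrow> int \<Rightarrow> (nat \<Rightarrow> 'k) set" where
  "tensor_part F i j = {x. \<forall>l. x l \<noteq> 0 \<longrightarrow> l < rank F i \<and> shift F i l = j}"

definition tensor_differential ::
  "('v, 'k::field, 'm) free_complex \<Rightarrow> nat \<Rightarrow> (nat \<Rightarrow> 'k) \<Rightarrow> nat \<Rightarrow> 'k" where
  "tensor_differential F i x =
     (\<lambda>l. if l < rank F i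
          then \<Sum>l' < rank F (Suc i). x l' * Poly_Mapping.lookup (diff_coeff F i l' l) 0 else 0)"

definition tensor_cycles :: "('v, 'k::field, 'm) free_complex \<Rightarrow> nat \<Rightarrow> int \<Rightarrow> (nat \<Rightarrow> 'k) set" where
  "tensor_cycles F i j =
     {x \<in> tensor_part F i j. \<forall>i'. i = Suc i' \<longrightarrow> tensor_differential F i' x = (\<lambda>_. 0)}"

definition tensor_boundaries :: "('v, 'k::field, 'm) free_complex \<Rightarrow> nat \<Rightarrow> int \<Rightarrow> (nat \<Rightarrow> 'k) set" where
  "tensor_boundaries F i j = tensor_differential F i ` tensor_part F (Suc i) j"

text \<open>\<open>Tor\<^sub>i\<^sup>S(M, \<bbbK>)\<^sub>j \<noteq> 0\<close>, computed from a chosen graded free resolution of \<open>M\<close>.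
  A resolution exists whenever \<open>V\<close> is finite and \<open>M\<close> is a finitely generated graded module, and the
  result does not depend on the choice.\<close>

definition Tor_nonzero ::
  "'v set \<Rightarrow> (('v, 'k::field) mpoly, 'm) module \<Rightarrow> (int \<Rightarrow> 'm set) \<Rightarrow> nat \<Rightarrow> int \<Rightarrow> bool" where
  "Tor_nonzero V M gr i j \<longleftrightarrow>
     (let F = SOME F. graded_free_resolution V M gr F
      in tensor_cycles F i j \<noteq> tensor_boundaries F i j)"

definition regularity ::
  "'v set \<Rightarrow> (('v, 'k::field) mpoly, 'm) module \<Rightarrow> (int \<Rightarrow> 'm set) \<Rightarrow> int" where
  "regularity V M gr = Max {j - int i | i j. Tor_nonzero V M gr i j}"


section \<open>Fan graphs\<close>

definition complete_edges :: "'v set \<Rightarrow> 'v set set" where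
  "complete_edges X = {{u, v} | u v. u \<in> X \<and> v \<in> X \<and> u \<noteq> v}"

text \<open>The cliques on the vertex sets \<open>B 1, \<dots>, B r\<close>, of sizes \<open>a 1, \<dots>, a r\<close>, form the branch of a
  fan attached to the complete graph on \<open>C\<close> along \<open>U = {u 1, \<dots>, u r}\<close>.\<close>

definition is_fan_on ::
  "'v set \<Rightarrow> 'v set \<Rightarrow> nat \<Rightarrow> (nat \<Rightarrow> 'v) \<Rightarrow> (nat \<Rightarrow> nat) \<Rightarrow> (nat \<Rightarrow> 'v set) \<Rightarrow> bool" where
  "is_fan_on C U r u a B \<longleftrightarrow>
     U \<subseteq> C \<and> bij_betw u {1..r} U \<and>
     (\<forall>j \<in> {1..r}. finite (B j) \<and> card (B j) = a j \<and> a j > j \<and> C \<inter> B j = u ` {1..j}) \<and>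
     disjoint_family_on (\<lambda>j. B j - C) {1..r}"

text \<open>\<open>G\<close> is the \<open>k\<close>-fan graph of the complete graph on \<open>C\<close> on the set \<open>W\<close> partitioned into
  \<open>P 1, \<dots>, P k\<close>, where the fan on \<open>P i = {w i 1, \<dots>, w i (r i)}\<close> has the cliques on
  \<open>B i 1, \<dots>, B i (r i)\<close> as its branch. The new vertices of any two attached cliques, also from
  different fans, are distinct.\<close>

definition is_k_fan_graph ::
  "'v set \<Rightarrow> 'v set \<Rightarrow> nat \<Rightarrow> (nat \<Rightarrow> 'v set) \<Rightarrow> (nat \<Rightarrow> nat) \<Rightarrow> (nat \<Rightarrow> nat \<Rightarrow> 'v) \<Rightarrow>
   (nat \<Rightarrow> nat \<Rightarrow> nat) \<Rightarrow> (nat \<Rightarrow> nat \<Rightarrow> 'v set) \<Rightarrow> 'v graph \<Rightarrow> bool" where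
  "is_k_fan_graph C W k P r w a B G \<longleftrightarrow>
     W \<subseteq> C \<and> W = (\<Union>i \<in> {1..k}. P i) \<and> disjoint_family_on P {1..k} \<and>
     (\<forall>i \<in> {1..k}. P i \<noteq> {} \<and> is_fan_on C (P i) (r i) (w i) (a i) (B i)) \<and>
     disjoint_family_on (\<lambda>(i, j). B i j - C) (SIGMA i:{1..k}. {1..r i}) \<and>
     G = (C \<union> (\<Union>i \<in> {1..k}. \<Union>j \<in> {1..r i}. B i j),
          complete_edges C \<union> (\<Union>i \<in> {1..k}. \<Union>j \<in> {1..r i}. complete_edges (B i j)))"

end

theory Submission
  imports Defs
begin

text \<open>
  A fan graph is chordal, and the regularity of \<open>S/I\<^sub>G\<close> for chordal \<open>G\<close> is the largest size of an
  induced matching. \<open>Tor\<close> is computed from the Taylor resolution of the edge ideal. After tensoring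
  with the field, its part in the squarefree multidegree \<open>U\<close> has as basis the sets of edges with
  union \<open>U\<close>. For an induced matching of size \<open>m\<close> with vertex set \<open>U\<close> this part is one-dimensional,
  whence \<open>Tor\<^sub>m\<close> is nonzero in degree \<open>2m\<close>. Conversely, removing an edge \<open>uv\<close> with \<open>u\<close> simplicial leaves
  a chordal graph with no larger induced matchings, and the colon ideal by \<open>uv\<close> is generated by the
  neighbours of \<open>u\<close> and \<open>v\<close> and by the edges of a chordal graph whose induced matchings extend by
  \<open>uv\<close>; the long exact sequence then bounds the regularity by induction.

  In a fan graph at most one edge of an induced matching meets \<open>K\<^sub>n\<close>, and each attached clique with at
  least two new vertices contributes at most one further edge. An additional edge meeting \<open>K\<^sub>n\<close> is
  available exactly when two vertices of \<open>K\<^sub>n\<close> lie outside \<open>W\<close> or the last clique of some fan has only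
  one new vertex.
\<close>

section \<open>Chain complexes of families of sets\<close>

text \<open>\<open>Tor_nonzero\<close> is computed from a resolution picked by \<open>SOME\<close>,
  so nothing can be read off from the Taylor complex before the homology after tensoring is known to
  be independent of the resolution. One combinatorial complex then serves twice. With all supports
  empty and U = {} a strand is the full simplex on its generators, and contracting it gives
  exactness of the Taylor complex multidegree by multidegree; with the true supports it is a
  multigraded piece of \<open>Tor\<close>. The induction cannot stay within graphs, since the colon
  by an edge creates variables, repeated generators and edges divisible by variables. It therefore
  runs over indexed families of sets of size one or two, with no minimality assumed, and only edges
  avoiding the variables count for matchings. Simpliciality of u is what makes deletion safe: if uv
  joined two edges of a matching, one of them would contain u and a further vertex w, and then wv is
  an edge that joins them as well. In the colon step the bound closes because the multidegree loses
  two vertices while the homological degree and the matching size each drop by one.\<close>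

definition pos_sign :: "nat \<Rightarrow> nat set \<Rightarrow> 'k::field" where
  "pos_sign e \<sigma> = (-1) ^ card {x \<in> \<sigma>. x < e}"

lemma pos_sign_square [simp]: "pos_sign e \<sigma> * pos_sign e \<sigma> = 1"
  by (simp add: pos_sign_def flip: power_add mult_2)

lemma pos_sign_square_left [simp]: "pos_sign e \<sigma> * (pos_sign e \<sigma> * x) = x"
  by (simp flip: mult.assoc)

lemma pos_sign_insert:
  assumes "finite \<sigma>" "f \<notin> \<sigma>"
  shows "pos_sign e (insert f \<sigma>) = (if f < e then - pos_sign e \<sigma> else pos_sign e \<sigma>)"
proof (cases "f < e")
  case True
  then have "{x \<in> insert f \<sigma>. x < e} = insert f {x \<in> \<sigma>. x < e}" by auto
  then show ?thesis using assms True by (simp add: pos_sign_def)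
next
  case False
  then have "{x \<in> insert f \<sigma>. x < e} = {x \<in> \<sigma>. x < e}" by auto
  then show ?thesis using False by (simp add: pos_sign_def)
qed

text \<open>Of the two signs only the one belonging to the larger index changes when the other index
  is inserted, so exactly one flips. This is the sign rule that makes the boundary square to
  zero.\<close>

lemma pos_sign_anticommute:
  assumes "finite \<sigma>" "f \<notin> \<sigma>" "e \<notin> \<sigma>" "e \<noteq> f"
  shows "pos_sign f \<sigma> * pos_sign e (insert f \<sigma>) = - (pos_sign e \<sigma> * pos_sign f (insert e \<sigma>))"
  using assms by (auto simp: pos_sign_insert)

text \<open>The simplicial boundary by coefficients: the value at \<tau> collects the values of the
  chain at all cofaces of \<tau>. Degree and support conditions are left to \<open>chains\<close>
  and \<open>strand_diff\<close>.\<close>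

definition boundary :: "nat set \<Rightarrow> (nat set \<Rightarrow> 'k::field) \<Rightarrow> nat set \<Rightarrow> 'k" where
  "boundary E c \<tau> = (\<Sum>e\<in>E - \<tau>. pos_sign e \<tau> * c (insert e \<tau>))"

text \<open>In characteristic 2 the relation S = -S does not give S = 0. The terms below the
  diagonal are therefore cancelled against those above it.\<close>

lemma sum_antisymmetric_off_diagonal:
  fixes t :: "nat \<Rightarrow> nat \<Rightarrow> 'a::ab_group_add"
  assumes "finite D" "\<And>e f. e \<in> D \<Longrightarrow> f \<in> D \<Longrightarrow> e \<noteq> f \<Longrightarrow> t e f = - t f e"
  shows "(\<Sum>e\<in>D. \<Sum>f\<in>D - {e}. t e f) = 0"
proof -
  have "(\<Sum>e\<in>D. \<Sum>f\<in>D - {e}. t e f) =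
      (\<Sum>e\<in>D. (\<Sum>f\<in>{f \<in> D. f < e}. t e f) + (\<Sum>f\<in>{f \<in> D. e < f}. t e f))"
  proof (rule sum.cong)
    fix e assume "e \<in> D"
    have *: "D - {e} = {f \<in> D. f < e} \<union> {f \<in> D. e < f}" by auto
    show "(\<Sum>f\<in>D - {e}. t e f) = (\<Sum>f\<in>{f \<in> D. f < e}. t e f) + (\<Sum>f\<in>{f \<in> D. e < f}. t e f)"
      unfolding * using assms(1) by (intro sum.union_disjoint) auto
  qed simp
  also have "\<dots> = (\<Sum>e\<in>D. \<Sum>f\<in>{f \<in> D. f < e}. t e f) + (\<Sum>f\<in>D. \<Sum>e\<in>{e \<in> D. e < f}. t e f)"
    by (simp add: sum.distrib sum.swap_restrict[OF assms(1) assms(1), of "\<lambda>e f. t e f" "\<lambda>e f. e < f"])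
  also have "(\<Sum>f\<in>D. \<Sum>e\<in>{e \<in> D. e < f}. t e f) = - (\<Sum>e\<in>D. \<Sum>f\<in>{f \<in> D. f < e}. t e f)"
  proof -
    have "(\<Sum>f\<in>D. \<Sum>e\<in>{e \<in> D. e < f}. t e f) = (\<Sum>f\<in>D. \<Sum>e\<in>{e \<in> D. e < f}. - t f e)"
    proof (intro sum.cong refl)
      fix f e assume "f \<in> D" "e \<in> {e \<in> D. e < f}"
      then show "t e f = - t f e" by (intro assms(2)) auto
    qed
    then show ?thesis by (simp add: sum_negf)
  qed
  finally show ?thesis by simp
qed

lemma boundary_boundary:
  assumes "finite E" "finite \<tau>"
  shows "boundary E (boundary E c) \<tau> = 0"
proof -
  have "boundary E (boundary E c) \<tau> =
     (\<Sum>e\<in>E - \<tau>. \<Sum>f\<in>(E - \<tau>) - {e}. pos_sign e \<tau> * pos_sign f (insert e \<tau>) * c (insert f (insert e \<tau>)))"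
    unfolding boundary_def
    by (intro sum.cong) (auto simp: sum_distrib_left mult.assoc intro!: sum.cong)
  also have "\<dots> = 0"
  proof (rule sum_antisymmetric_off_diagonal)
    fix e f assume "e \<in> E - \<tau>" "f \<in> E - \<tau>" "e \<noteq> f"
    then have "pos_sign e \<tau> * pos_sign f (insert e \<tau>) = - (pos_sign f \<tau> * pos_sign e (insert f \<tau>) :: 'a)"
      using assms by (intro pos_sign_anticommute) auto
    then show "pos_sign e \<tau> * pos_sign f (insert e \<tau>) * c (insert f (insert e \<tau>)) =
        - (pos_sign f \<tau> * pos_sign e (insert f \<tau>) * c (insert e (insert f \<tau>)))"
      by (simp add: insert_commute)
  qed (use assms in simp)
  finally show ?thesis .
qed

text \<open>The degree \<open>i\<close> is the number of generators in a face, so the empty face has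
  degree 0 and \<open>i\<close> is the homological degree of \<open>Tor\<close>.\<close>

definition chains :: "nat set \<Rightarrow> (nat \<Rightarrow> 'v set) \<Rightarrow> 'v set \<Rightarrow> nat \<Rightarrow> (nat set \<Rightarrow> 'k::field) set" where
  "chains E s U i = {c. \<forall>\<sigma>. c \<sigma> \<noteq> 0 \<longrightarrow> \<sigma> \<subseteq> E \<and> card \<sigma> = i \<and> \<Union> (s ` \<sigma>) = U}"

text \<open>The differential of the degree \<open>U\<close> part of the Taylor complex of the squarefree monomials with
  supports \<open>s e\<close>, after tensoring with the field: faces with a smaller union are dropped.\<close>

definition strand_diff ::
  "nat set \<Rightarrow> (nat \<Rightarrow> 'v set) \<Rightarrow> 'v set \<Rightarrow> (nat set \<Rightarrow> 'k::field) \<Rightarrow> nat set \<Rightarrow> 'k" where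
  "strand_diff E s U c \<tau> = (if \<tau> \<subseteq> E \<and> \<Union> (s ` \<tau>) = U then boundary E c \<tau> else 0)"

text \<open>The field occurs only in the type of the bound chain, hence the type token
  \<open>K\<close>. For finite \<open>E\<close> and i = 0 every chain is a cycle, so exactness there
  says that every chain is a boundary.\<close>

definition strand_exact ::
  "'k::field itself \<Rightarrow> nat set \<Rightarrow> (nat \<Rightarrow> 'v set) \<Rightarrow> 'v set \<Rightarrow> nat \<Rightarrow> bool" where
  "strand_exact K E s U i \<longleftrightarrow>
     (\<forall>c :: nat set \<Rightarrow> 'k. c \<in> chains E s U i \<and> strand_diff E s U c = (\<lambda>_. 0) \<longrightarrow>
        c \<in> strand_diff E s U ` chains E s U (Suc i))"

lemma strand_exactI:
  assumes "\<And>c :: nat set \<Rightarrow> 'k. c \<in> chains E s U i \<Longrightarrow> strand_diff E s U c = (\<lambda>_. 0) \<Longrightarrow>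
     \<exists>b \<in> chains E s U (Suc i). strand_diff E s U b = c"
  shows "strand_exact TYPE('k::field) E s U i"
  using assms unfolding strand_exact_def by blast

lemma strand_exactE:
  fixes c :: "nat set \<Rightarrow> 'k::field"
  assumes "strand_exact TYPE('k) E s U i" "c \<in> chains E s U i" "strand_diff E s U c = (\<lambda>_. 0)"
  obtains b where "b \<in> chains E s U (Suc i)" "strand_diff E s U b = c"
  using assms unfolding strand_exact_def by blast

lemma strand_exact_cong:
  assumes "\<And>e. e \<in> E \<Longrightarrow> s e = t e"
  shows "strand_exact TYPE('k::field) E s U i \<longleftrightarrow> strand_exact TYPE('k) E t U i"
proof -
  have "s ` \<sigma> = t ` \<sigma>" if "\<sigma> \<subseteq> E" for \<sigma>
    using assms that by (intro image_cong) auto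
  then have *: "\<sigma> \<subseteq> E \<and> P \<and> \<Union> (s ` \<sigma>) = U \<longleftrightarrow> \<sigma> \<subseteq> E \<and> P \<and> \<Union> (t ` \<sigma>) = U" for \<sigma> P
    by (cases "\<sigma> \<subseteq> E") simp_all
  have "chains E s U j = (chains E t U j :: (nat set \<Rightarrow> 'k) set)" for j
    unfolding chains_def * ..
  moreover have "strand_diff E s U = (strand_diff E t U :: (nat set \<Rightarrow> 'k) \<Rightarrow> _)"
    unfolding strand_diff_def fun_eq_iff using *[of _ True] by simp
  ultimately show ?thesis by (simp add: strand_exact_def)
qed

lemma chains_zeroI: "c \<in> chains E s U i \<Longrightarrow> \<not> (\<sigma> \<subseteq> E \<and> card \<sigma> = i \<and> \<Union> (s ` \<sigma>) = U) \<Longrightarrow> c \<sigma> = 0"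
  by (auto simp: chains_def)

lemma boundary_cong:
  "(\<And>e. e \<in> E - \<tau> \<Longrightarrow> c (insert e \<tau>) = c' (insert e \<tau>)) \<Longrightarrow> boundary E c \<tau> = boundary E c' \<tau>"
  by (simp add: boundary_def)

lemma boundary_add: "boundary E (\<lambda>\<sigma>. b \<sigma> + c \<sigma>) \<tau> = boundary E b \<tau> + boundary E c \<tau>"
  by (simp add: boundary_def sum.distrib distrib_left)

lemma boundary_diff: "boundary E (\<lambda>\<sigma>. b \<sigma> - c \<sigma>) \<tau> = boundary E b \<tau> - boundary E c \<tau>"
  by (simp add: boundary_def sum_subtractf right_diff_distrib)

lemma chains_add:
  assumes "b \<in> chains E s U i" "c \<in> chains E s U i"
  shows "(\<lambda>\<sigma>. b \<sigma> + c \<sigma>) \<in> chains E s U i"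
  unfolding chains_def mem_Collect_eq
proof (intro allI impI)
  fix \<sigma> assume "b \<sigma> + c \<sigma> \<noteq> 0"
  then have "b \<sigma> \<noteq> 0 \<or> c \<sigma> \<noteq> 0" by auto
  then show "\<sigma> \<subseteq> E \<and> card \<sigma> = i \<and> \<Union> (s ` \<sigma>) = U"
    using assms by (auto simp: chains_def)
qed

lemma chains_diff:
  assumes "b \<in> chains E s U i" "c \<in> chains E s U i"
  shows "(\<lambda>\<sigma>. b \<sigma> - c \<sigma>) \<in> chains E s U i"
  unfolding chains_def mem_Collect_eq
proof (intro allI impI)
  fix \<sigma> assume "b \<sigma> - c \<sigma> \<noteq> 0"
  then have "b \<sigma> \<noteq> 0 \<or> c \<sigma> \<noteq> 0" by auto
  then show "\<sigma> \<subseteq> E \<and> card \<sigma> = i \<and> \<Union> (s ` \<sigma>) = U"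
    using assms by (auto simp: chains_def)
qed

lemma strand_diff_add:
  "strand_diff E s U (\<lambda>\<sigma>. b \<sigma> + c \<sigma>) \<tau> = strand_diff E s U b \<tau> + strand_diff E s U c \<tau>"
  by (simp add: strand_diff_def boundary_add)

lemma strand_diff_diff:
  "strand_diff E s U (\<lambda>\<sigma>. b \<sigma> - c \<sigma>) \<tau> = strand_diff E s U b \<tau> - strand_diff E s U c \<tau>"
  by (simp add: strand_diff_def boundary_diff)

lemma strand_diff_chains:
  assumes "finite E" "c \<in> chains E s U (Suc i)"
  shows "strand_diff E s U c \<in> chains E s U i"
  unfolding chains_def mem_Collect_eq
proof (intro allI impI)
  fix \<tau> assume "strand_diff E s U c \<tau> \<noteq> 0"
  then have t: "\<tau> \<subseteq> E" "\<Union> (s ` \<tau>) = U" "boundary E c \<tau> \<noteq> 0"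
    by (auto simp: strand_diff_def split: if_splits)
  then obtain e where "e \<in> E - \<tau>" "pos_sign e \<tau> * c (insert e \<tau>) \<noteq> 0"
    unfolding boundary_def by (meson sum.not_neutral_contains_not_neutral)
  then have "card (insert e \<tau>) = Suc i" "e \<notin> \<tau>"
    using assms(2) by (auto simp: chains_def)
  moreover have "finite \<tau>" using t(1) assms(1) finite_subset by blast
  ultimately show "\<tau> \<subseteq> E \<and> card \<tau> = i \<and> \<Union> (s ` \<tau>) = U" using t by auto
qed

text \<open>Dropping faces does no harm: if \<tau> has union U and \<open>insert e \<tau>\<close>
  does not, then \<open>s e\<close> sticks out of U, so c vanishes on all faces containing e and its
  full boundary is zero at \<open>insert e \<tau>\<close> anyway.\<close>

lemma strand_diff_strand_diff:
  assumes "finite E" "c \<in> chains E s U i"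
  shows "strand_diff E s U (strand_diff E s U c) = (\<lambda>_. 0)"
proof
  fix \<tau>
  show "strand_diff E s U (strand_diff E s U c) \<tau> = 0"
  proof (cases "\<tau> \<subseteq> E \<and> \<Union> (s ` \<tau>) = U")
    case True
    have "boundary E (strand_diff E s U c) \<tau> = boundary E (boundary E c) \<tau>"
    proof (rule boundary_cong)
      fix e assume e: "e \<in> E - \<tau>"
      show "strand_diff E s U c (insert e \<tau>) = boundary E c (insert e \<tau>)"
      proof (cases "\<Union> (s ` insert e \<tau>) = U")
        case False
        then have "c (insert f (insert e \<tau>)) = 0" for f
          using True assms(2) by (intro chains_zeroI[OF assms(2)]) auto
        then show ?thesis using False by (simp add: strand_diff_def boundary_def)
      qed (use True e in \<open>auto simp: strand_diff_def\<close>)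
    qed
    also have "\<dots> = 0" using True assms(1) finite_subset by (intro boundary_boundary) auto
    finally show ?thesis by (simp add: strand_diff_def[of E s U "strand_diff E s U c"])
  next
    case False
    then show ?thesis by (auto simp: strand_diff_def[of E s U "strand_diff E s U c"])
  qed
qed

text \<open>The family contains the empty set: adjoining its index is a contracting homotopy.\<close>

lemma strand_exact_empty_generator:
  assumes "finite E" "e \<in> E" "s e = {}"
  shows "strand_exact TYPE('k::field) E s U i"
proof (rule strand_exactI)
  fix c :: "nat set \<Rightarrow> 'k"
  assume c: "c \<in> chains E s U i" and cyc: "strand_diff E s U c = (\<lambda>_. 0)"
  define b where "b \<sigma> = (if e \<in> \<sigma> then pos_sign e (\<sigma> - {e}) * c (\<sigma> - {e}) else 0)" for \<sigma>
  have b_insert: "b (insert e \<sigma>) = pos_sign e \<sigma> * c \<sigma>" if "e \<notin> \<sigma>" for \<sigma>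
    using that by (simp add: b_def)
  have "b \<in> chains E s U (Suc i)"
    unfolding chains_def mem_Collect_eq
  proof (intro allI impI)
    fix \<sigma> assume "b \<sigma> \<noteq> 0"
    then have e: "e \<in> \<sigma>" and nz: "c (\<sigma> - {e}) \<noteq> 0" by (auto simp: b_def split: if_splits)
    then have "\<sigma> - {e} \<subseteq> E" "card (\<sigma> - {e}) = i" "\<Union> (s ` (\<sigma> - {e})) = U"
      using c by (auto simp: chains_def)
    moreover have "finite \<sigma>" using \<open>\<sigma> - {e} \<subseteq> E\<close> assms(1) finite_subset by fastforce
    moreover have "\<sigma> = insert e (\<sigma> - {e})" using e by blast
    moreover have "\<Union> (s ` \<sigma>) = \<Union> (s ` (\<sigma> - {e}))" using assms(3) by auto
    ultimately show "\<sigma> \<subseteq> E \<and> card \<sigma> = Suc i \<and> \<Union> (s ` \<sigma>) = U"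
      using assms(2) e by (metis card.remove insert_subset)
  qed
  moreover have "strand_diff E s U b = c"
  proof
    fix \<tau>
    show "strand_diff E s U b \<tau> = c \<tau>"
    proof (cases "\<tau> \<subseteq> E \<and> \<Union> (s ` \<tau>) = U")
      case True
      then have fin: "finite \<tau>" using assms(1) finite_subset by blast
      have "boundary E b \<tau> = c \<tau>"
      proof (cases "e \<in> \<tau>")
        case False
        have "boundary E b \<tau> = (\<Sum>f\<in>E - \<tau>. if f = e then pos_sign e \<tau> * b (insert e \<tau>) else 0)"
          unfolding boundary_def using False by (intro sum.cong) (auto simp: b_def)
        also have "\<dots> = c \<tau>" using assms False by (simp add: b_insert sum.delta')
        finally show ?thesis .
      next
        case True
        \<comment> \<open>Here every face \<open>insert f \<tau>\<close> contains e, so the boundary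
          of b at \<tau> only involves c at the faces \<open>insert f \<rho>\<close>. The cycle
          condition at \<rho> expresses their sum by the one missing term
          \<open>c \<tau>\<close>.\<close>
        define \<rho> where "\<rho> = \<tau> - {e}"
        have \<tau>: "\<tau> = insert e \<rho>" "e \<notin> \<rho>" "finite \<rho>" using True fin by (auto simp: \<rho>_def)
        have "\<rho> \<subseteq> E" "\<Union> (s ` \<rho>) = U"
          using \<open>\<tau> \<subseteq> E \<and> \<Union> (s ` \<tau>) = U\<close> assms(3) by (auto simp: \<tau>(1))
        then have "boundary E c \<rho> = 0" using cyc by (auto simp: strand_diff_def fun_eq_iff split: if_splits)
        moreover have "boundary E c \<rho> = (\<Sum>f\<in>insert e (E - \<tau>). pos_sign f \<rho> * c (insert f \<rho>))"
          unfolding boundary_def using \<tau> assms(2) by (intro sum.cong) auto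
        moreover have "\<dots> = pos_sign e \<rho> * c \<tau> + (\<Sum>f\<in>E - \<tau>. pos_sign f \<rho> * c (insert f \<rho>))"
          unfolding \<tau>(1) using assms(1) by (intro sum.insert) auto
        ultimately have "pos_sign e \<rho> * c \<tau> + (\<Sum>f\<in>E - \<tau>. pos_sign f \<rho> * c (insert f \<rho>)) = 0" by simp
        then have *: "(\<Sum>f\<in>E - \<tau>. pos_sign f \<rho> * c (insert f \<rho>)) = - (pos_sign e \<rho> * c \<tau>)"
          by (simp add: add_eq_0_iff)
        have "boundary E b \<tau> = (\<Sum>f\<in>E - \<tau>. - pos_sign e \<rho> * (pos_sign f \<rho> * c (insert f \<rho>)))"
          unfolding boundary_def
        proof (rule sum.cong)
          fix f assume f: "f \<in> E - \<tau>"
          have "insert f \<tau> = insert e (insert f \<rho>)" unfolding \<tau>(1) by auto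
          moreover have "e \<notin> insert f \<rho>" using f \<tau> by auto
          ultimately have "b (insert f \<tau>) = pos_sign e (insert f \<rho>) * c (insert f \<rho>)"
            using b_insert by metis
          moreover have "pos_sign f \<tau> * pos_sign e (insert f \<rho>) = - (pos_sign e \<rho> * pos_sign f \<rho> :: 'k)"
            using f \<tau> by (auto simp: pos_sign_insert)
          ultimately show "pos_sign f \<tau> * b (insert f \<tau>) = - pos_sign e \<rho> * (pos_sign f \<rho> * c (insert f \<rho>))"
            by (metis (no_types, lifting) mult.assoc mult_minus_left)
        qed simp
        also have "\<dots> = - pos_sign e \<rho> * (- (pos_sign e \<rho> * c \<tau>))"
          unfolding sum_distrib_left[symmetric] * ..
        also have "\<dots> = c \<tau>" by simp
        finally show ?thesis .
      qed
      then show ?thesis using True by (simp add: strand_diff_def)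
    next
      case False
      then show ?thesis using c by (auto simp: strand_diff_def chains_zeroI)
    qed
  qed
  ultimately show "\<exists>b\<in>chains E s U (Suc i). strand_diff E s U b = c" by blast
qed

text \<open>A generator whose support is not contained in U occurs in no face with union U, so the
  strands with and without it coincide.\<close>

lemma strand_exact_insert_irrelevant:
  assumes "finite E" "e \<notin> E" "\<not> s e \<subseteq> U" "strand_exact TYPE('k::field) E s U i"
  shows "strand_exact TYPE('k) (insert e E) s U i"
proof (rule strand_exactI)
  fix c :: "nat set \<Rightarrow> 'k"
  have ch: "chains (insert e E) s U j = (chains E s U j :: (nat set \<Rightarrow> 'k) set)" for j
  proof -
    have "(\<sigma> \<subseteq> insert e E \<and> card \<sigma> = j \<and> \<Union> (s ` \<sigma>) = U) = (\<sigma> \<subseteq> E \<and> card \<sigma> = j \<and> \<Union> (s ` \<sigma>) = U)" for \<sigma>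
      using assms(3) by blast
    then show ?thesis by (simp add: chains_def)
  qed
  have sd: "strand_diff (insert e E) s U b = strand_diff E s U b" if "b \<in> chains E s U j" for j and b :: "nat set \<Rightarrow> 'k"
  proof
    fix \<tau>
    have z: "b (insert e \<tau>) = 0" using that assms(2) by (intro chains_zeroI[OF that]) auto
    have "boundary (insert e E) b \<tau> = boundary E b \<tau>"
      unfolding boundary_def using z assms(1) by (intro sum.mono_neutral_right) auto
    moreover have "(\<tau> \<subseteq> insert e E \<and> \<Union> (s ` \<tau>) = U) = (\<tau> \<subseteq> E \<and> \<Union> (s ` \<tau>) = U)"
      using assms(3) by blast
    ultimately show "strand_diff (insert e E) s U b \<tau> = strand_diff E s U b \<tau>"
      by (simp add: strand_diff_def)
  qed
  assume "c \<in> chains (insert e E) s U i" "strand_diff (insert e E) s U c = (\<lambda>_. 0)"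
  then have "c \<in> chains E s U i" "strand_diff E s U c = (\<lambda>_. 0)" by (auto simp: ch sd)
  with assms(4) obtain b where "b \<in> chains E s U (Suc i)" "strand_diff E s U b = c" by (rule strand_exactE)
  then show "\<exists>b\<in>chains (insert e E) s U (Suc i). strand_diff (insert e E) s U b = c"
    by (auto simp: ch sd)
qed

text \<open>The connecting step of the long exact sequence for adjoining a generator: the chains that
  use \<open>e\<close> form the complex of the colon family \<open>s x - s e\<close>.\<close>

lemma strand_exact_insert:
  assumes "finite E" "e \<notin> E" "s e \<subseteq> U" "strand_exact TYPE('k::field) E s U i"
    and colon: "\<And>i'. i = Suc i' \<Longrightarrow> strand_exact TYPE('k) E (\<lambda>x. s x - s e) (U - s e) i'"
  shows "strand_exact TYPE('k) (insert e E) s U i"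
proof (rule strand_exactI)
  fix c :: "nat set \<Rightarrow> 'k"
  let ?E = "insert e E"
  assume c: "c \<in> chains ?E s U i" and cyc: "strand_diff ?E s U c = (\<lambda>_. 0)"
  have finE: "finite ?E" using assms(1) by simp
  have union: "\<Union> ((\<lambda>x. s x - s e) ` \<tau>) = U - s e \<longleftrightarrow> \<Union> (s ` insert e \<tau>) = U" for \<tau>
    using assms(3) by auto
  \<comment> \<open>The part of the cycle on faces containing e is bounded using the colon family.
    Subtracting that boundary leaves a cycle of the old family.\<close>
  have "\<exists>b \<in> chains ?E s U (Suc i). \<forall>\<tau>. \<tau> \<subseteq> E \<longrightarrow> strand_diff ?E s U b (insert e \<tau>) = c (insert e \<tau>)"
  proof (cases i)
    case 0
    have "c (insert e \<tau>) = 0" if "\<tau> \<subseteq> E" for \<tau>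
      using that assms(1) finite_subset 0 by (intro chains_zeroI[OF c]) fastforce
    then show ?thesis
      by (intro bexI[of _ "\<lambda>_. 0"]) (auto simp: chains_def strand_diff_def boundary_def)
  next
    case (Suc i')
    \<comment> \<open>The coefficient of e in c, one degree lower. Since \<open>s x - s e\<close>
      records what x adds to \<open>s e\<close>, a union equal to \<open>U - s e\<close> there means
      union U once e is adjoined.\<close>
    define c1 where "c1 \<tau> = (if \<tau> \<subseteq> E then pos_sign e \<tau> * c (insert e \<tau>) else 0)" for \<tau>
    have "c1 \<in> chains E (\<lambda>x. s x - s e) (U - s e) i'"
      unfolding chains_def mem_Collect_eq
    proof (intro allI impI)
      fix \<tau> assume "c1 \<tau> \<noteq> 0"
      then have t: "\<tau> \<subseteq> E" "c (insert e \<tau>) \<noteq> 0" by (auto simp: c1_def split: if_splits)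
      then have "card (insert e \<tau>) = Suc i'" "\<Union> (s ` insert e \<tau>) = U"
        using c Suc by (auto simp: chains_def)
      moreover have "finite \<tau>" "e \<notin> \<tau>" using t assms finite_subset by blast+
      ultimately show "\<tau> \<subseteq> E \<and> card \<tau> = i' \<and> \<Union> ((\<lambda>x. s x - s e) ` \<tau>) = U - s e"
        using t union by auto
    qed
    moreover have "strand_diff E (\<lambda>x. s x - s e) (U - s e) c1 = (\<lambda>_. 0)"
    proof
      fix \<tau>
      show "strand_diff E (\<lambda>x. s x - s e) (U - s e) c1 \<tau> = 0"
      proof (cases "\<tau> \<subseteq> E \<and> \<Union> (s ` insert e \<tau>) = U")
        case True
        then have t: "finite \<tau>" "e \<notin> \<tau>" using assms finite_subset by blast+
        have "boundary E c1 \<tau> = (\<Sum>f\<in>?E - insert e \<tau>. - pos_sign e \<tau> * (pos_sign f (insert e \<tau>) * c (insert f (insert e \<tau>))))"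
          unfolding boundary_def
        proof (rule sum.cong)
          show "E - \<tau> = ?E - insert e \<tau>" using assms(2) by auto
          fix f assume f: "f \<in> ?E - insert e \<tau>"
          then have "c1 (insert f \<tau>) = pos_sign e (insert f \<tau>) * c (insert f (insert e \<tau>))"
            using True by (auto simp: c1_def insert_commute)
          moreover have "pos_sign f \<tau> * pos_sign e (insert f \<tau>) = - (pos_sign e \<tau> * pos_sign f (insert e \<tau>) :: 'k)"
            using f t by (intro pos_sign_anticommute) auto
          ultimately show "pos_sign f \<tau> * c1 (insert f \<tau>) = - pos_sign e \<tau> * (pos_sign f (insert e \<tau>) * c (insert f (insert e \<tau>)))"
            by (metis (no_types, lifting) mult.assoc mult_minus_left)
        qed
        also have "\<dots> = - pos_sign e \<tau> * boundary ?E c (insert e \<tau>)"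
          by (simp add: boundary_def sum_distrib_left)
        also have "boundary ?E c (insert e \<tau>) = strand_diff ?E s U c (insert e \<tau>)"
          using True by (auto simp: strand_diff_def)
        finally show ?thesis using cyc by (simp add: strand_diff_def)
      qed (simp only: strand_diff_def union, auto)
    qed
    ultimately obtain b1 where b1: "b1 \<in> chains E (\<lambda>x. s x - s e) (U - s e) (Suc i')"
      "strand_diff E (\<lambda>x. s x - s e) (U - s e) b1 = c1"
      using colon[OF Suc] strand_exactE by blast
    \<comment> \<open>Adjoining e anticommutes with the boundary, hence the minus sign.\<close>
    define b where "b \<sigma> = (if e \<in> \<sigma> then - pos_sign e (\<sigma> - {e}) * b1 (\<sigma> - {e}) else 0)" for \<sigma>
    have b_insert: "b (insert e \<sigma>) = - pos_sign e \<sigma> * b1 \<sigma>" if "e \<notin> \<sigma>" for \<sigma>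
      using that by (simp add: b_def)
    have "b \<in> chains ?E s U (Suc i)"
      unfolding chains_def mem_Collect_eq
    proof (intro allI impI)
      fix \<sigma> assume "b \<sigma> \<noteq> 0"
      then have e: "e \<in> \<sigma>" and nz: "b1 (\<sigma> - {e}) \<noteq> 0" by (auto simp: b_def split: if_splits)
      then have *: "\<sigma> - {e} \<subseteq> E" "card (\<sigma> - {e}) = i" "\<Union> (s ` insert e (\<sigma> - {e})) = U"
        using b1(1) Suc unfolding chains_def union by auto
      moreover have "finite \<sigma>" using \<open>\<sigma> - {e} \<subseteq> E\<close> assms(1) finite_subset by fastforce
      moreover have "insert e (\<sigma> - {e}) = \<sigma>" using e by blast
      ultimately show "\<sigma> \<subseteq> ?E \<and> card \<sigma> = Suc i \<and> \<Union> (s ` \<sigma>) = U"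
        using e by (metis card.remove insert_mono)
    qed
    moreover have "strand_diff ?E s U b (insert e \<tau>) = c (insert e \<tau>)" if "\<tau> \<subseteq> E" for \<tau>
    proof (cases "\<Union> (s ` insert e \<tau>) = U")
      case True
      have t: "finite \<tau>" "e \<notin> \<tau>" using that assms finite_subset by blast+
      have "boundary ?E b (insert e \<tau>) = (\<Sum>f\<in>E - \<tau>. pos_sign e \<tau> * (pos_sign f \<tau> * b1 (insert f \<tau>)))"
        unfolding boundary_def
      proof (rule sum.cong)
        show "?E - insert e \<tau> = E - \<tau>" using assms(2) by auto
        fix f assume f: "f \<in> E - \<tau>"
        then have ef: "e \<noteq> f" "f \<notin> \<tau>" using assms(2) by auto
        then have "b (insert f (insert e \<tau>)) = - pos_sign e (insert f \<tau>) * b1 (insert f \<tau>)"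
          using t b_insert[of "insert f \<tau>"] by (simp add: insert_commute)
        moreover have "pos_sign f (insert e \<tau>) * (- pos_sign e (insert f \<tau>)) = (pos_sign e \<tau> * pos_sign f \<tau> :: 'k)"
          using ef t by (auto simp: pos_sign_insert)
        ultimately show "pos_sign f (insert e \<tau>) * b (insert f (insert e \<tau>)) = pos_sign e \<tau> * (pos_sign f \<tau> * b1 (insert f \<tau>))"
          by (metis (no_types, lifting) mult.assoc)
      qed
      also have "\<dots> = pos_sign e \<tau> * boundary E b1 \<tau>"
        by (simp add: boundary_def sum_distrib_left)
      also have "boundary E b1 \<tau> = c1 \<tau>"
        using fun_cong[OF b1(2), of \<tau>] True that union by (simp add: strand_diff_def)
      also have "pos_sign e \<tau> * c1 \<tau> = c (insert e \<tau>)" using that by (simp add: c1_def)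
      finally show ?thesis using True that by (auto simp: strand_diff_def)
    next
      case False
      then show ?thesis using c by (simp only: strand_diff_def) (auto simp: chains_zeroI[OF c])
    qed
    ultimately show ?thesis by blast
  qed
  then obtain b where b: "b \<in> chains ?E s U (Suc i)"
    "\<And>\<tau>. \<tau> \<subseteq> E \<Longrightarrow> strand_diff ?E s U b (insert e \<tau>) = c (insert e \<tau>)" by blast
  \<comment> \<open>This difference vanishes on all faces containing e, so it is a chain of
    \<open>E\<close>, and it is a cycle there as well.\<close>
  define c' where "c' \<sigma> = c \<sigma> - strand_diff ?E s U b \<sigma>" for \<sigma>
  have sdb: "strand_diff ?E s U b \<in> chains ?E s U i" using strand_diff_chains[OF finE b(1)] .
  have c'_ch: "c' \<in> chains ?E s U i" unfolding c'_def using c sdb by (rule chains_diff)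
  have c'_e: "c' \<sigma> = 0" if "e \<in> \<sigma>" for \<sigma>
  proof (cases "\<sigma> \<subseteq> ?E")
    case True
    then have "\<sigma> - {e} \<subseteq> E" "insert e (\<sigma> - {e}) = \<sigma>" using that by auto
    then show ?thesis using b(2)[of "\<sigma> - {e}"] by (simp add: c'_def)
  qed (use chains_zeroI[OF c'_ch] in auto)
  have c'_chE: "c' \<in> chains E s U i"
    unfolding chains_def mem_Collect_eq
  proof (intro allI impI)
    fix \<sigma> assume "c' \<sigma> \<noteq> 0"
    then have "e \<notin> \<sigma>" "\<sigma> \<subseteq> ?E \<and> card \<sigma> = i \<and> \<Union> (s ` \<sigma>) = U"
      using c'_e c'_ch by (auto simp: chains_def)
    then show "\<sigma> \<subseteq> E \<and> card \<sigma> = i \<and> \<Union> (s ` \<sigma>) = U" by blast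
  qed
  have bdE: "boundary ?E d \<tau> = boundary E d \<tau>" if "d \<in> chains E s U j" for d :: "nat set \<Rightarrow> 'k" and j \<tau>
  proof -
    have "d (insert e \<tau>) = 0" using assms(2) by (intro chains_zeroI[OF that]) auto
    then show ?thesis unfolding boundary_def using assms(1) by (intro sum.mono_neutral_right) auto
  qed
  have c'_cyc: "strand_diff ?E s U c' = (\<lambda>_. 0)"
  proof
    fix \<tau>
    have "strand_diff ?E s U c' \<tau> = strand_diff ?E s U c \<tau> - strand_diff ?E s U (strand_diff ?E s U b) \<tau>"
      unfolding c'_def by (rule strand_diff_diff)
    then show "strand_diff ?E s U c' \<tau> = 0"
      using cyc strand_diff_strand_diff[OF finE b(1)] by simp
  qed
  have "strand_diff E s U c' = (\<lambda>_. 0)"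
  proof
    fix \<tau> show "strand_diff E s U c' \<tau> = 0"
      using fun_cong[OF c'_cyc, of \<tau>] by (auto simp: strand_diff_def bdE[OF c'_chE] split: if_splits)
  qed
  then obtain b0 where b0: "b0 \<in> chains E s U (Suc i)" "strand_diff E s U b0 = c'"
    using assms(4) c'_chE strand_exactE by blast
  have "strand_diff ?E s U b0 \<tau> = c' \<tau>" for \<tau>
  proof (cases "\<tau> \<subseteq> E")
    case True
    then have "\<tau> \<subseteq> ?E" by blast
    with True have "strand_diff ?E s U b0 \<tau> = strand_diff E s U b0 \<tau>"
      by (simp add: strand_diff_def bdE[OF b0(1)])
    then show ?thesis using b0(2) by simp
  next
    case False
    have "b0 (insert f \<tau>) = 0" for f using False by (intro chains_zeroI[OF b0(1)]) auto
    then have "strand_diff ?E s U b0 \<tau> = 0" by (simp add: strand_diff_def boundary_def)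
    moreover have "c' \<tau> = 0" using chains_zeroI[OF c'_chE] False by auto
    ultimately show ?thesis by simp
  qed
  then have "strand_diff ?E s U (\<lambda>\<sigma>. b0 \<sigma> + b \<sigma>) = c"
    by (simp add: fun_eq_iff strand_diff_add c'_def)
  moreover have b0E: "b0 \<in> chains ?E s U (Suc i)"
    using b0(1) by (auto simp: chains_def)
  then have "(\<lambda>\<sigma>. b0 \<sigma> + b \<sigma>) \<in> chains ?E s U (Suc i)"
    using b(1) by (rule chains_add)
  ultimately show "\<exists>b\<in>chains ?E s U (Suc i). strand_diff ?E s U b = c" by blast
qed

text \<open>No face has a union containing x, so the strand has no nonzero chains.\<close>

lemma strand_exact_uncovered:
  assumes "x \<in> U" "\<And>e. e \<in> E \<Longrightarrow> x \<notin> s e"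
  shows "strand_exact TYPE('k::field) E s U i"
proof (rule strand_exactI)
  fix c :: "nat set \<Rightarrow> 'k" assume c: "c \<in> chains E s U i"
  have "c = (\<lambda>_. 0)"
    using assms by (intro ext chains_zeroI[OF c]) blast
  then show "\<exists>b\<in>chains E s U (Suc i). strand_diff E s U b = c"
    by (intro bexI[of _ "\<lambda>_. 0"]) (auto simp: chains_def strand_diff_def boundary_def)
qed

section \<open>Vanishing for chordal graphs\<close>

text \<open>Taking \<open>h = f\<close> shows that the edges of \<open>M\<close> are pairwise disjoint.\<close>

definition induced_matching :: "'v set set \<Rightarrow> 'v set set \<Rightarrow> bool" where
  "induced_matching H M \<longleftrightarrow> M \<subseteq> H \<and>
     (\<forall>f\<in>M. \<forall>g\<in>M. f \<noteq> g \<longrightarrow> (\<forall>h\<in>H. h \<inter> f = {} \<or> h \<inter> g = {}))"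

text \<open>Listing the vertices by increasing \<open>rk\<close> is a perfect elimination ordering.\<close>

definition elimination_rank :: "'v set set \<Rightarrow> ('v \<Rightarrow> nat) \<Rightarrow> bool" where
  "elimination_rank H rk \<longleftrightarrow> inj_on rk (\<Union>H) \<and>
     (\<forall>u v w. {u, v} \<in> H \<and> {u, w} \<in> H \<and> v \<noteq> w \<and> rk u < rk v \<and> rk u < rk w \<longrightarrow> {v, w} \<in> H)"

text \<open>The colon ideals in the induction have variables among their generators; these are the
  singletons of the family.\<close>

definition loops :: "nat set \<Rightarrow> (nat \<Rightarrow> 'v set) \<Rightarrow> 'v set" where
  "loops E s = {x. \<exists>e\<in>E. s e = {x}}"

text \<open>An edge through a loop is a multiple of that variable, hence redundant as a generator;
  the remaining edges form the graph whose matchings bound the regularity.\<close>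

definition proper_edges :: "nat set \<Rightarrow> (nat \<Rightarrow> 'v set) \<Rightarrow> 'v set set" where
  "proper_edges E s = {f \<in> s ` E. card f = 2 \<and> f \<inter> loops E s = {}}"

lemma card_2_other:
  assumes "card A = 2" "u \<in> A"
  obtains v where "A = {u, v}" "u \<noteq> v"
proof -
  obtain x y where "A = {x, y}" "x \<noteq> y" using assms(1) card_2_iff by metis
  then show thesis using that[of x] that[of y] assms(2) by (cases "u = x") auto
qed

lemma card_2_pair:
  assumes "card A = 2" "u \<in> A" "v \<in> A" "u \<noteq> v"
  shows "A = {u, v}"
  using card_2_other[OF assms(1,2)] assms(3,4) by blast

text \<open>The colon family by \<open>s g\<close> contains \<open>s f - s g = {}\<close>: the colon
  ideal is the unit ideal, so adjoining g preserves exactness.\<close>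

lemma strand_exact_remove_redundant:
  assumes "finite E" "f \<in> E" "g \<in> E" "f \<noteq> g" "s f \<subseteq> s g"
    "strand_exact TYPE('k::field) (E - {g}) s U i"
  shows "strand_exact TYPE('k) E s U i"
proof -
  have E: "E = insert g (E - {g})" using assms by auto
  show ?thesis
  proof (cases "s g \<subseteq> U")
    case True
    show ?thesis
      by (subst E, rule strand_exact_insert)
        (use assms True in \<open>auto intro!: strand_exact_empty_generator[where e = f]\<close>)
  next
    case False
    show ?thesis
      by (subst E, rule strand_exact_insert_irrelevant) (use assms False in auto)
  qed
qed

text \<open>For U = {} the empty face would survive in degree 0, as the class of 1.\<close>

lemma strand_exact_no_generators:
  assumes "U \<noteq> {}"
  shows "strand_exact TYPE('k::field) {} s U i"
proof -
  obtain x where "x \<in> U" using assms by auto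
  then show ?thesis by (rule strand_exact_uncovered) simp
qed

lemma induced_matching_subset_size:
  "induced_matching H M \<Longrightarrow> H \<subseteq> s ` E \<Longrightarrow> finite E \<Longrightarrow> finite M"
  unfolding induced_matching_def by (meson finite_imageI finite_subset)

text \<open>Algebraically, \<open>Tor\<close> in homological degree i vanishes in every squarefree
  multidegree of size above i + m, so the regularity is at most m. The induction is on the number of
  generators; m varies because the colon step lowers it, while one rank function serves all smaller
  graphs.\<close>

theorem strand_exact_chordal:
  fixes s :: "nat \<Rightarrow> 'v set"
  assumes "finite E" "\<And>e. e \<in> E \<Longrightarrow> card (s e) \<in> {1, 2}"
    and "elimination_rank (proper_edges E s) rk"
    and "\<And>M. induced_matching (proper_edges E s) M \<Longrightarrow> card M \<le> m"
    and "card U > i + m"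
  shows "strand_exact TYPE('k::field) E s U i"
  using assms
proof (induction "card E" arbitrary: E s m U i rule: less_induct)
  case less
  let ?H = "proper_edges E s"
  note fin = less.prems(1) and two = less.prems(2) and rk = less.prems(3)
    and im = less.prems(4) and U = less.prems(5)
  have smaller: "card (E - {g}) < card E" if "g \<in> E" for g
    using that fin by (metis card_Diff1_less)
  \<comment> \<open>Either some generator is a multiple of another, or some generator is a variable
    contained in no other one, or the family is an antichain of edges, that is, a simple graph
    listed without repetition.\<close>
  consider (redundant) f g where "f \<in> E" "g \<in> E" "f \<noteq> g" "s f \<subseteq> s g"
    | (loop) e x where "e \<in> E" "s e = {x}" "\<And>f. f \<in> E \<Longrightarrow> f \<noteq> e \<Longrightarrow> x \<notin> s f"
    | (graph) "\<And>f g. f \<in> E \<Longrightarrow> g \<in> E \<Longrightarrow> s f \<subseteq> s g \<Longrightarrow> f = g" "\<And>e. e \<in> E \<Longrightarrow> card (s e) = 2"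
  proof (cases "\<exists>f\<in>E. \<exists>g\<in>E. f \<noteq> g \<and> s f \<subseteq> s g")
    case False
    note nored = this
    show ?thesis
    proof (cases "\<exists>e\<in>E. card (s e) = 1")
      case True
      then obtain e x where ex: "e \<in> E" "s e = {x}" by (auto simp: card_1_singleton_iff)
      then have "x \<notin> s f" if "f \<in> E" "f \<noteq> e" for f using nored that by fastforce
      then show ?thesis using loop ex by blast
    next
      case False
      then show ?thesis using graph nored two by blast
    qed
  qed (use redundant in blast)
  then show ?case
  proof cases
    case redundant
    have "f \<in> E - {g}" using redundant by auto
    \<comment> \<open>If \<open>s g\<close> is a proper edge, its subset \<open>s f\<close> cannot
      be a singleton, so \<open>s f = s g\<close> and f still represents the edge.\<close>
    have H: "proper_edges (E - {g}) s = ?H"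
    proof -
      have L: "loops (E - {g}) s = loops E s"
      proof -
        have "s f = {x}" if "s g = {x}" for x
          using two[OF redundant(1)] redundant(4) that by (auto simp: subset_singleton_iff)
        then show ?thesis unfolding loops_def using redundant by auto (metis insertE insert_Diff)+
      qed
      have "s g \<in> s ` (E - {g})" if "card (s g) = 2" "s g \<inter> loops E s = {}"
      proof -
        have "card (s f) \<noteq> 1"
        proof
          assume "card (s f) = 1"
          then obtain x where "s f = {x}" by (auto simp: card_1_singleton_iff)
          then have "x \<in> loops E s" "x \<in> s g" using redundant by (auto simp: loops_def)
          then show False using that by auto
        qed
        then have "card (s f) = card (s g)" using two[OF redundant(1)] that by auto
        then have "s f = s g" using redundant(4) that card_subset_eq[of "s g" "s f"]
          by (metis card.infinite zero_neq_numeral)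
        then show ?thesis using \<open>f \<in> E - {g}\<close> by (metis imageI)
      qed
      then show ?thesis unfolding proper_edges_def L by auto
    qed
    have "strand_exact TYPE('k) (E - {g}) s U i"
      by (rule less.hyps[OF smaller[OF redundant(2)], OF _ _ rk[folded H] im[folded H] U]) (use fin two in auto)
    then show ?thesis by (rule strand_exact_remove_redundant[OF fin redundant])
  next
    case loop
    have E: "E = insert e (E - {e})" using loop by auto
    have H: "proper_edges (E - {e}) s = ?H"
    proof -
      have "loops E s = insert x (loops (E - {e}) s)"
        unfolding loops_def using loop by auto
      moreover have "x \<notin> f" if "f \<in> s ` (E - {e})" for f using that loop by auto
      moreover have "card (s e) \<noteq> 2" using loop by simp
      ultimately show ?thesis unfolding proper_edges_def by auto
    qed
    have IH: "strand_exact TYPE('k) (E - {e}) s U' i'" if "card U' > i' + m" for U' i'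
      by (rule less.hyps[OF smaller[OF loop(1)], OF _ _ rk[folded H] im[folded H] that]) (use fin two in auto)
    show ?thesis
    proof (cases "x \<in> U")
      case True
      have "strand_exact TYPE('k) (E - {e}) s U i" using U by (rule IH)
      \<comment> \<open>The variable x occurs in no other generator, so the colon family equals the
        old one; the size of U and i each drop by one and m stays.\<close>
      moreover have "strand_exact TYPE('k) (E - {e}) (\<lambda>y. s y - s e) (U - s e) i'" if "i = Suc i'" for i'
      proof -
        have same: "s y - s e = s y" if "y \<in> E - {e}" for y using that loop by auto
        have "card (U - s e) > i' + m"
          using U that True loop(2) by (simp add: card_Diff_singleton)
        then have "strand_exact TYPE('k) (E - {e}) s (U - s e) i'" by (rule IH)
        then show ?thesis using strand_exact_cong[of "E - {e}" "\<lambda>y. s y - s e" s] same by blast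
      qed
      ultimately show ?thesis
        by (subst E, intro strand_exact_insert) (use fin loop True in auto)
    next
      case False
      then show ?thesis using IH[OF U] fin loop by (subst E, intro strand_exact_insert_irrelevant) auto
    qed
  next
    case graph
    have inj: "inj_on s E" using graph(1) by (auto intro: inj_onI)
    have noloops: "loops E s = {}" using graph(2) by (fastforce simp: loops_def)
    have H: "?H = s ` E" using graph(2) noloops by (auto simp: proper_edges_def)
    show ?thesis
    proof (cases "E = {}")
      case True
      have "U \<noteq> {}" using U by auto
      then show ?thesis unfolding True by (rule strand_exact_no_generators)
    next
      case False
      have finV: "finite (\<Union>?H)"
        using fin graph(2) H by (metis (no_types, lifting) card.infinite finite_UN zero_neq_numeral)
      have "\<Union>?H \<noteq> {}"
        using False graph(2) H by (metis (no_types, lifting) SUP_bot_conv(2) card.empty ex_in_conv zero_neq_numeral)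
      \<comment> \<open>The vertex of lowest rank is simplicial: its neighbours all come later in
        the ordering and are therefore pairwise adjacent.\<close>
      then obtain u where u: "u \<in> \<Union>?H" "\<And>v. v \<in> \<Union>?H \<Longrightarrow> rk u \<le> rk v"
        using finV by (metis (no_types, lifting) arg_min_least arg_min_if_finite(1))
      then obtain e where e: "e \<in> E" "u \<in> s e" using H by auto
      then obtain v where v: "s e = {u, v}" "u \<noteq> v"
        using card_2_other[OF graph(2)[OF e(1)] e(2)] by blast
      have rkinj: "inj_on rk (\<Union>?H)" and clique: "\<And>a b c. {a, b} \<in> ?H \<Longrightarrow> {a, c} \<in> ?H \<Longrightarrow> b \<noteq> c \<Longrightarrow>
          rk a < rk b \<Longrightarrow> rk a < rk c \<Longrightarrow> {b, c} \<in> ?H"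
        using rk unfolding elimination_rank_def by blast+
      have u_less: "rk u < rk w" if "w \<in> \<Union>?H" "w \<noteq> u" for w
        using u(2)[OF that(1)] rkinj u(1) that by (metis inj_onD le_neq_implies_less)
      have edgeH: "s f \<in> ?H" if "f \<in> E" for f using that H by auto
      have nbr: "{w, v} \<in> ?H" if "{u, w} \<in> ?H" "w \<noteq> v" "w \<noteq> u" for w
      proof (rule clique)
        show "{u, v} \<in> ?H" using edgeH[OF e(1)] v by simp
        then show "rk u < rk w" "rk u < rk v" using u_less[of w] u_less[of v] that v by blast+
      qed (use that in auto)
      have E: "E = insert e (E - {e})" using e by auto

      \<comment> \<open>Deletion keeps the same m, because a matching that is induced without e
        stays induced when e is put back.\<close>
      have 1: "strand_exact TYPE('k) (E - {e}) s U i"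
      proof (rule less.hyps[OF smaller[OF e(1)]])
        have H1: "proper_edges (E - {e}) s = ?H - {s e}"
        proof -
          have "loops (E - {e}) s = {}" using noloops by (auto simp: loops_def)
          moreover have "s ` (E - {e}) = s ` E - {s e}" using inj e(1) by (auto simp: inj_on_def)
          ultimately show ?thesis unfolding H using graph(2) by (auto simp: proper_edges_def)
        qed
        show "elimination_rank (proper_edges (E - {e}) s) rk"
          unfolding elimination_rank_def H1
        proof (intro conjI allI impI)
          show "inj_on rk (\<Union> (?H - {s e}))" using rkinj by (rule inj_on_subset) auto
          fix a b c assume *: "{a, b} \<in> ?H - {s e} \<and> {a, c} \<in> ?H - {s e} \<and> b \<noteq> c \<and> rk a < rk b \<and> rk a < rk c"
          then have "{b, c} \<in> ?H" using clique by auto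
          \<comment> \<open>The edge demanded by the elimination property is never e: its ends rank
            above a, while e contains the vertex u of lowest rank.\<close>
          moreover have "a \<in> \<Union>?H" using * by auto
          then have "b \<noteq> u" "c \<noteq> u" using * u(2) by force+
          then have "{b, c} \<noteq> s e" using v by auto
          ultimately show "{b, c} \<in> ?H - {s e}" by auto
        qed
        fix M assume M: "induced_matching (proper_edges (E - {e}) s) M"
        have "induced_matching ?H M"
          unfolding induced_matching_def
        proof (intro conjI ballI impI)
          show "M \<subseteq> ?H" using M unfolding induced_matching_def H1 by auto
          fix f g h assume fgh: "f \<in> M" "g \<in> M" "f \<noteq> g" "h \<in> ?H"
          have *: "h' \<inter> f' = {} \<or> h' \<inter> g' = {}" if "f' \<in> M" "g' \<in> M" "f' \<noteq> g'" "h' \<in> ?H" "h' \<noteq> s e" for f' g' h'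
            using M that unfolding induced_matching_def H1 by blast
          show "h \<inter> f = {} \<or> h \<inter> g = {}"
          proof (cases "h = s e")
            case False
            then show ?thesis using * fgh by blast
          next
            case True
            \<comment> \<open>Two edges of M joined by e would meet it in u and in v respectively.
              With \<open>f' = {u, w}\<close>, simpliciality of u gives the edge
              \<open>{w, v}\<close>, which differs from e and meets both; M excludes this.\<close>
            have key: False if fg: "f' \<in> M" "g' \<in> M" "f' \<noteq> g'" "u \<in> f'" "v \<in> g'" for f' g'
            proof -
              have f': "f' \<in> ?H" "f' \<noteq> s e" "g' \<in> ?H" "g' \<noteq> s e"
                using M fg unfolding induced_matching_def H1 by auto
              then have "card f' = 2" using graph(2) H by auto
              then obtain w where w: "f' = {u, w}" "w \<noteq> u" using card_2_other fg(4) by metis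
              have "v \<noteq> w" using f' w v by auto
              then have "{w, v} \<in> ?H" using nbr f' w by auto
              moreover have "{w, v} \<noteq> s e" using v w by auto
              ultimately have "{w, v} \<inter> f' = {} \<or> {w, v} \<inter> g' = {}" using * fg by blast
              then show False using w fg by auto
            qed
            have common: False if "x \<in> f" "x \<in> g" for x
            proof -
              have "f \<in> ?H" "f \<noteq> s e" using M fgh unfolding induced_matching_def H1 by auto
              then show False using *[OF fgh(1-3)] that by blast
            qed
            show ?thesis
            proof (rule ccontr)
              assume "\<not> ?thesis"
              then obtain x y where "x \<in> s e" "x \<in> f" "y \<in> s e" "y \<in> g" using True by auto
              then show False using v common key[of f g] key[of g f] fgh by auto
            qed
          qed
        qed
        then show "card M \<le> m" using im by blast
      qed (use fin two U in auto)

      \<comment> \<open>This makes the natural number subtraction in \<open>m - 1\<close> below a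
        true one.\<close>
      have m: "m \<ge> 1"
      proof -
        have "induced_matching ?H {s e}" using edgeH[OF e(1)] by (auto simp: induced_matching_def)
        then show ?thesis using im by fastforce
      qed
      let ?t = "\<lambda>y. s y - s e"
      \<comment> \<open>The colon step: U loses two vertices while i and m each drop by one, so the
        size bound carries over.\<close>
      have 2: "strand_exact TYPE('k) (E - {e}) ?t (U - s e) i'" if i': "i = Suc i'" and sub: "s e \<subseteq> U" for i'
      proof (rule less.hyps[OF smaller[OF e(1)], where m = "m - 1"])
        show "card (?t f) \<in> {1, 2}" if "f \<in> E - {e}" for f
        proof -
          have f: "card (s f) = 2" "finite (s f)" using graph(2)[of f] that by (auto intro: card_ge_0_finite)
          \<comment> \<open>The antichain condition excludes an empty difference, so the colon
            family again consists of singletons and pairs.\<close>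
          have "\<not> s f \<subseteq> s e" using graph(1)[of f e] that e by auto
          then have "card (?t f) \<noteq> 0" using f by auto
          moreover have "card (?t f) \<le> 2" using f by (metis Diff_subset card_mono)
          ultimately show ?thesis by auto
        qed
        let ?X = "loops (E - {e}) ?t"
        let ?K = "proper_edges (E - {e}) ?t"
        \<comment> \<open>A pair survives the colon only if it is disjoint from e, and the new loops
          are the neighbours of e. So \<open>?K\<close> is the graph induced on the vertices outside
          e and its neighbourhood.\<close>
        have K: "?K = {f \<in> ?H. f \<inter> s e = {} \<and> f \<inter> ?X = {}}"
        proof
          show "{f \<in> ?H. f \<inter> s e = {} \<and> f \<inter> ?X = {}} \<subseteq> ?K"
          proof
            fix f assume f: "f \<in> {f \<in> ?H. f \<inter> s e = {} \<and> f \<inter> ?X = {}}"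
            then obtain y where y: "y \<in> E" "f = s y" using H by auto
            moreover have "y \<noteq> e" using f y v by auto
            moreover have "s y - s e = s y" using f y by auto
            ultimately show "f \<in> ?K" using f graph(2) unfolding proper_edges_def by (auto intro!: image_eqI[of _ _ y])
          qed
          show "?K \<subseteq> {f \<in> ?H. f \<inter> s e = {} \<and> f \<inter> ?X = {}}"
          proof
            fix f assume f: "f \<in> ?K"
            then obtain y where y: "y \<in> E" "y \<noteq> e" "f = s y - s e" "card (s y - s e) = 2"
              unfolding proper_edges_def by auto
            have "finite (s y)" "card (s y) = 2" using graph(2)[OF y(1)] by (auto intro: card_ge_0_finite)
            then have "s y - s e = s y" using y(4) by (intro card_subset_eq) auto
            then show "f \<in> {f \<in> ?H. f \<inter> s e = {} \<and> f \<inter> ?X = {}}"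
              using f y H unfolding proper_edges_def by auto
          qed
        qed
        have near: "x \<in> ?X" if xz: "{x, z} \<in> ?H" "z \<in> s e" "x \<notin> s e" for x z
        proof -
          obtain y where y: "y \<in> E" "s y = {x, z}" using xz H by auto
          then have "y \<in> E - {e}" "s y - s e = {x}" using that by auto
          then show ?thesis unfolding loops_def by blast
        qed
        show "elimination_rank ?K rk"
          unfolding elimination_rank_def
        proof (intro conjI allI impI)
          show "inj_on rk (\<Union>?K)" using rkinj by (rule inj_on_subset) (auto simp: K)
          fix a b c assume "{a, b} \<in> ?K \<and> {a, c} \<in> ?K \<and> b \<noteq> c \<and> rk a < rk b \<and> rk a < rk c"
          then show "{b, c} \<in> ?K" using clique[of a b c] unfolding K by auto
        qed
        fix M assume M: "induced_matching ?K M"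
        have disj: "f \<inter> s e = {}" "f \<inter> ?X = {}" "f \<in> ?H" if "f \<in> M" for f
          using M that unfolding induced_matching_def K by auto
        \<comment> \<open>An edge from e to an edge of M would end in a neighbour of e, which is a
          loop, and the edges of \<open>?K\<close> avoid loops.\<close>
        have far: "h \<inter> f = {}" if hf: "h \<in> ?H" "f \<in> M" "h \<inter> s e \<noteq> {}" for h f
        proof (rule ccontr)
          assume "h \<inter> f \<noteq> {}"
          then obtain x z where xz: "x \<in> h" "x \<in> f" "z \<in> h" "z \<in> s e" using hf(3) by blast
          then have "x \<noteq> z" "x \<notin> s e" using disj[OF hf(2)] by auto
          moreover obtain y where "y \<in> E" "h = s y" using hf(1) H by auto
          ultimately have "h = {x, z}" using card_2_pair[OF graph(2), of y x z] xz by auto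
          then show False using near[of x z] hf xz disj \<open>x \<notin> s e\<close> by blast
        qed
        have "induced_matching ?H (insert (s e) M)"
          unfolding induced_matching_def
        proof (intro conjI ballI impI)
          show "insert (s e) M \<subseteq> ?H" using edgeH[OF e(1)] disj by auto
          fix f g h assume fgh: "f \<in> insert (s e) M" "g \<in> insert (s e) M" "f \<noteq> g" "h \<in> ?H"
          show "h \<inter> f = {} \<or> h \<inter> g = {}"
          proof (cases "f = s e \<or> g = s e")
            case True
            then show ?thesis using far fgh by blast
          next
            case False
            then have fg: "f \<in> M" "g \<in> M" using fgh by auto
            show ?thesis
            proof (rule ccontr)
              assume "\<not> ?thesis"
              then obtain x z where xz: "x \<in> h" "x \<in> f" "z \<in> h" "z \<in> g" by auto
              have K': "h' \<inter> f = {} \<or> h' \<inter> g = {}" if "h' \<in> ?K" for h'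
                using M fg fgh(3) that unfolding induced_matching_def by blast
              have "f \<in> ?K" using M fg unfolding induced_matching_def by auto
              then have "x \<noteq> z" using K'[of f] xz by auto
              moreover obtain y where "y \<in> E" "h = s y" using fgh H by auto
              ultimately have "h = {x, z}" using card_2_pair[OF graph(2), of y x z] xz by auto
              \<comment> \<open>Both ends of h lie on edges of M, so they avoid e and the loops;
                hence h belongs to the graph in which M is induced.\<close>
              then have "h \<in> ?K" using fgh(4) xz disj[OF fg(1)] disj[OF fg(2)] unfolding K by auto
              then show False using K'[of h] xz by auto
            qed
          qed
        qed
        then have "card (insert (s e) M) \<le> m" using im by blast
        moreover have "finite M" using M fin by (intro induced_matching_subset_size[of ?K M ?t "E - {e}"])
            (auto simp: proper_edges_def)
        moreover have "s e \<notin> M" using disj[of "s e"] v by auto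
        ultimately show "card M \<le> m - 1" by simp
      next
        have "finite U" using U by (metis card.infinite not_less_zero)
        then have "card (U - s e) = card U - 2" using sub v by (simp add: card_Diff_subset)
        then show "card (U - s e) > i' + (m - 1)" using U i' m by simp
      qed (use fin in auto)
      show ?thesis
      proof (cases "s e \<subseteq> U")
        case True
        then show ?thesis by (subst E, intro strand_exact_insert) (use fin 1 2 in auto)
      next
        case False
        then show ?thesis by (subst E, intro strand_exact_insert_irrelevant) (use fin 1 in auto)
      qed
    qed
  qed
qed

section \<open>Graded polynomials\<close>

lemma in_poly_ring_iff: "p \<in> carrier (poly_ring V) \<longleftrightarrow> (\<forall>m\<in>Poly_Mapping.keys p. Poly_Mapping.keys m \<subseteq> V)"
  by (simp add: poly_ring_def)

lemma poly_ring_simps [simp]: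
  "x \<otimes>\<^bsub>poly_ring V\<^esub> y = x * y" "x \<oplus>\<^bsub>poly_ring V\<^esub> y = x + y"
  "\<one>\<^bsub>poly_ring V\<^esub> = 1" "\<zero>\<^bsub>poly_ring V\<^esub> = 0"
  by (simp_all add: poly_ring_def)

lemma keys_uminus_ab_group [simp]: "Poly_Mapping.keys (- p) = Poly_Mapping.keys (p :: 'a \<Rightarrow>\<^sub>0 'b::ab_group_add)"
  by (auto simp: in_keys_iff)

lemma keys_add_nat: "Poly_Mapping.keys (m + n) = Poly_Mapping.keys m \<union> Poly_Mapping.keys (n :: 'v \<Rightarrow>\<^sub>0 nat)"
  by (auto simp: in_keys_iff lookup_add)

lemma keys_multE:
  assumes "m \<in> Poly_Mapping.keys (p * q)"
  obtains a b where "a \<in> Poly_Mapping.keys p" "b \<in> Poly_Mapping.keys q" "m = a + b"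
  using keys_mult[of p q] assms by blast

lemma poly_ring_zero [simp]: "0 \<in> carrier (poly_ring V)"
  by (simp add: in_poly_ring_iff)

lemma poly_ring_one [simp]: "1 \<in> carrier (poly_ring V)"
  by (simp add: in_poly_ring_iff flip: single_one)

lemma poly_ring_add [intro]:
  "p \<in> carrier (poly_ring V) \<Longrightarrow> q \<in> carrier (poly_ring V) \<Longrightarrow> p + q \<in> carrier (poly_ring V)"
  using keys_add[of p q] by (auto simp: in_poly_ring_iff)

lemma poly_ring_uminus [intro]: "p \<in> carrier (poly_ring V) \<Longrightarrow> - p \<in> carrier (poly_ring V)"
  by (simp add: in_poly_ring_iff)

lemma poly_ring_mult [intro]:
  "p \<in> carrier (poly_ring V) \<Longrightarrow> q \<in> carrier (poly_ring V) \<Longrightarrow> p * q \<in> carrier (poly_ring V)"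
  unfolding in_poly_ring_iff by (metis keys_multE keys_add_nat le_sup_iff)

lemma poly_ring_sum [intro]:
  "(\<And>x. x \<in> A \<Longrightarrow> f x \<in> carrier (poly_ring V)) \<Longrightarrow> sum f A \<in> carrier (poly_ring V)"
  by (induction A rule: infinite_finite_induct) auto

lemma cring_poly_ring: "cring (poly_ring V :: ('v, 'k::field) mpoly ring)"
proof (rule cringI)
  show "abelian_group (poly_ring V :: ('v, 'k) mpoly ring)"
  proof (rule abelian_groupI)
    fix x :: "('v, 'k) mpoly" assume "x \<in> carrier (poly_ring V)"
    then show "\<exists>y\<in>carrier (poly_ring V). y \<oplus>\<^bsub>poly_ring V\<^esub> x = \<zero>\<^bsub>poly_ring V\<^esub>"
      by (intro bexI[of _ "- x"]) auto
  qed (auto simp: algebra_simps)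
  show "comm_monoid (poly_ring V :: ('v, 'k) mpoly ring)"
    by (rule comm_monoidI) (auto simp: algebra_simps)
qed (auto simp: algebra_simps)

section \<open>Degrees of monomials and homogeneous components\<close>

lemma mon_degree_superset:
  assumes "finite S" "Poly_Mapping.keys m \<subseteq> S"
  shows "mon_degree m = sum (Poly_Mapping.lookup m) S"
  unfolding mon_degree_def using assms
  by (intro sum.mono_neutral_left) (auto simp: in_keys_iff)

lemma mon_degree_zero [simp]: "mon_degree 0 = 0"
  by (simp add: mon_degree_def)

lemma mon_degree_add: "mon_degree (m + n) = mon_degree m + mon_degree n"
proof -
  let ?S = "Poly_Mapping.keys m \<union> Poly_Mapping.keys n"
  have "mon_degree k = sum (Poly_Mapping.lookup k) ?S" if "k \<in> {m, n, m + n}" for k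
    using that by (intro mon_degree_superset) (auto simp: keys_add_nat)
  then show ?thesis by (simp add: lookup_add sum.distrib)
qed

lemma homogeneous_poly_ring: "p \<in> homogeneous V D \<Longrightarrow> p \<in> carrier (poly_ring V)"
  by (simp add: homogeneous_def)

lemma homogeneous_zero [simp]: "0 \<in> homogeneous V D"
  by (simp add: homogeneous_def)

lemma homogeneous_one [simp]: "1 \<in> homogeneous V 0"
  by (auto simp: homogeneous_def simp flip: single_one simp: poly_ring_one[folded single_one])

lemma homogeneous_add:
  "p \<in> homogeneous V D \<Longrightarrow> q \<in> homogeneous V D \<Longrightarrow> p + q \<in> homogeneous V D"
  using keys_add[of p q] by (auto simp: homogeneous_def)

lemma homogeneous_uminus: "p \<in> homogeneous V D \<Longrightarrow> - p \<in> homogeneous V D"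
  by (auto simp: homogeneous_def)

lemma homogeneous_diff:
  "p \<in> homogeneous V D \<Longrightarrow> q \<in> homogeneous V D \<Longrightarrow> p - q \<in> homogeneous V D"
  using homogeneous_add[of p V D "- q"] homogeneous_uminus by auto

lemma homogeneous_mult:
  assumes "p \<in> homogeneous V D" "q \<in> homogeneous V D'"
  shows "p * q \<in> homogeneous V (D + D')"
proof -
  have "int (mon_degree m) = D + D'" if "m \<in> Poly_Mapping.keys (p * q)" for m
    using that assms by (auto elim!: keys_multE simp: homogeneous_def mon_degree_add)
  then show ?thesis using assms by (auto simp: homogeneous_def)
qed

lemma homogeneous_sum:
  "(\<And>x. x \<in> A \<Longrightarrow> f x \<in> homogeneous V D) \<Longrightarrow> sum f A \<in> homogeneous V D"
  by (induction A rule: infinite_finite_induct) (auto intro: homogeneous_add)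

text \<open>The homogeneous component of degree D. Exactness of a resolution is stated for arbitrary
  vectors; taking components turns a preimage into a homogeneous one.\<close>

definition hcomp :: "int \<Rightarrow> ('v, 'k::field) mpoly \<Rightarrow> ('v, 'k) mpoly" where
  "hcomp D = Poly_Mapping.mapp (\<lambda>m c. c when int (mon_degree m) = D)"

lemma lookup_hcomp: "Poly_Mapping.lookup (hcomp D p) m = (Poly_Mapping.lookup p m when int (mon_degree m) = D)"
  by (simp add: hcomp_def lookup_mapp when_def in_keys_iff)

lemma hcomp_homogeneous: "p \<in> carrier (poly_ring V) \<Longrightarrow> hcomp D p \<in> homogeneous V D"
  by (auto simp: homogeneous_def in_poly_ring_iff in_keys_iff lookup_hcomp split: if_splits)

lemma hcomp_same: "p \<in> homogeneous V D \<Longrightarrow> hcomp D p = p"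
  by (rule poly_mapping_eqI) (auto simp: lookup_hcomp homogeneous_def in_keys_iff when_def)

lemma hcomp_other: "p \<in> homogeneous V D' \<Longrightarrow> D \<noteq> D' \<Longrightarrow> hcomp D p = 0"
  by (rule poly_mapping_eqI) (auto simp: lookup_hcomp homogeneous_def in_keys_iff when_def)

lemma hcomp_add: "hcomp D (p + q) = hcomp D p + hcomp D q"
  by (rule poly_mapping_eqI) (auto simp: lookup_hcomp lookup_add when_def)

lemma hcomp_zero [simp]: "hcomp D 0 = 0"
  by (rule poly_mapping_eqI) (simp add: lookup_hcomp)

lemma hcomp_diff: "hcomp D (p - q) = hcomp D p - hcomp D q"
  by (rule poly_mapping_eqI) (auto simp: lookup_hcomp lookup_minus when_def)

lemma hcomp_sum: "hcomp D (sum f A) = (\<Sum>x\<in>A. hcomp D (f x))"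
  by (induction A rule: infinite_finite_induct) (auto simp: hcomp_add)

lemma sum_hcomp:
  "(\<Sum>d\<in>(\<lambda>m. int (mon_degree m)) ` Poly_Mapping.keys p. hcomp d p) = p"
proof (rule poly_mapping_eqI)
  fix m
  show "Poly_Mapping.lookup (\<Sum>d\<in>(\<lambda>m. int (mon_degree m)) ` Poly_Mapping.keys p. hcomp d p) m = Poly_Mapping.lookup p m"
    by (auto simp: lookup_sum lookup_hcomp when_def sum.delta in_keys_iff)
qed

lemma hcomp_mult:
  assumes "p \<in> carrier (poly_ring V)" "q \<in> homogeneous V e"
  shows "hcomp D (p * q) = hcomp (D - e) p * q"
proof -
  let ?S = "(\<lambda>m. int (mon_degree m)) ` Poly_Mapping.keys p"
  have "p * q = (\<Sum>d\<in>?S. hcomp d p * q)"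
    by (subst (1) sum_hcomp[of p, symmetric]) (simp add: sum_distrib_right)
  then have "hcomp D (p * q) = (\<Sum>d\<in>?S. hcomp D (hcomp d p * q))"
    by (simp add: hcomp_sum)
  also have "\<dots> = (\<Sum>d\<in>?S. if d = D - e then hcomp (D - e) p * q else 0)"
  proof (rule sum.cong)
    fix d
    have "hcomp d p * q \<in> homogeneous V (d + e)"
      using assms by (intro homogeneous_mult hcomp_homogeneous)
    then show "hcomp D (hcomp d p * q) = (if d = D - e then hcomp (D - e) p * q else 0)"
      using hcomp_same hcomp_other by fastforce
  qed simp
  also have "\<dots> = hcomp (D - e) p * q"
  proof (cases "D - e \<in> ?S")
    case False
    then have "hcomp (D - e) p = 0"
      by (intro poly_mapping_eqI) (force simp: lookup_hcomp when_def in_keys_iff)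
    then show ?thesis by simp
  qed (simp add: sum.delta)
  finally show ?thesis .
qed

text \<open>Exponents are natural numbers, so a product with a factor free of constant term has none
  itself. This makes the constant term a ring map to the field, the one along which resolutions are
  tensored.\<close>

lemma constant_term_mult:
  "Poly_Mapping.lookup (p * q) 0 = Poly_Mapping.lookup p 0 * Poly_Mapping.lookup (q :: ('v, 'k::field) mpoly) 0"
proof -
  have split: "\<exists>r'. r = Poly_Mapping.single 0 (Poly_Mapping.lookup r 0) + r' \<and> 0 \<notin> Poly_Mapping.keys r'" for r :: "('v, 'k) mpoly"
    by (rule exI[of _ "r - Poly_Mapping.single 0 (Poly_Mapping.lookup r 0)"]) (simp add: in_keys_iff lookup_minus)
  have vanish: "Poly_Mapping.lookup (r * r') 0 = 0" if "0 \<notin> Poly_Mapping.keys r" for r r' :: "('v, 'k) mpoly"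
  proof (rule ccontr)
    assume "Poly_Mapping.lookup (r * r') 0 \<noteq> 0"
    then have "0 \<in> Poly_Mapping.keys (r * r')" by (simp add: in_keys_iff)
    then obtain a b where ab: "a \<in> Poly_Mapping.keys r" "0 = a + b" by (rule keys_multE)
    then have "Poly_Mapping.keys a = {}" by (metis keys_add_nat keys_zero sup_eq_bot_iff)
    then have "a = 0" by (intro poly_mapping_eqI) (auto simp: in_keys_iff)
    then show False using ab that by simp
  qed
  obtain p' q' where p': "p = Poly_Mapping.single 0 (Poly_Mapping.lookup p 0) + p'" "0 \<notin> Poly_Mapping.keys p'"
    and q': "q = Poly_Mapping.single 0 (Poly_Mapping.lookup q 0) + q'" "0 \<notin> Poly_Mapping.keys q'"
    using split by metis
  let ?s = "Poly_Mapping.single 0 (Poly_Mapping.lookup p 0)" and ?t = "Poly_Mapping.single 0 (Poly_Mapping.lookup q 0)"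
  have "p * q = ?s * ?t + q' * ?s + p' * q"
  proof -
    have "p * q = ?s * q + p' * q" by (subst p'(1)) (simp add: distrib_right)
    also have "?s * q = ?s * ?t + q' * ?s" by (subst q'(1)) (simp add: distrib_left mult.commute)
    finally show ?thesis .
  qed
  then show ?thesis using vanish[OF p'(2)] vanish[OF q'(2)] by (simp add: lookup_add mult_single)
qed

section \<open>Independence of the resolution\<close>

text \<open>A linear map out of a free module is stored by the images \<open>\<phi> l\<close> of the
  basis elements; \<open>comb n a \<phi>\<close> is its value at the vector a.\<close>

definition comb :: "nat \<Rightarrow> (nat \<Rightarrow> 'a::comm_ring_1) \<Rightarrow> (nat \<Rightarrow> nat \<Rightarrow> 'a) \<Rightarrow> nat \<Rightarrow> 'a" where
  "comb n a \<phi> = (\<lambda>m. \<Sum>l<n. a l * \<phi> l m)"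

lemma comb_comb: "comb n (comb m a \<phi>) \<psi> = comb m a (\<lambda>l. comb n (\<phi> l) \<psi>)"
  unfolding comb_def
  by (rule ext) (simp add: sum_distrib_left sum_distrib_right mult.assoc sum.swap[of _ "{..<n}"])

lemma comb_cong:
  "(\<And>l. l < n \<Longrightarrow> a l = b l) \<Longrightarrow> (\<And>l. l < n \<Longrightarrow> \<phi> l = \<psi> l) \<Longrightarrow> comb n a \<phi> = comb n b \<psi>"
  by (simp add: comb_def)

lemma comb_diff_left: "comb n (\<lambda>l. a l - b l) \<phi> = (\<lambda>m. comb n a \<phi> m - comb n b \<phi> m)"
  by (simp add: comb_def left_diff_distrib sum_subtractf)

lemma comb_diff_right: "comb n a (\<lambda>l m. \<phi> l m - \<psi> l m) = (\<lambda>m. comb n a \<phi> m - comb n a \<psi> m)"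
  by (simp add: comb_def right_diff_distrib sum_subtractf)

definition unit_vec :: "nat \<Rightarrow> nat \<Rightarrow> 'a::comm_ring_1" where
  "unit_vec l m = (if l = m then 1 else 0)"

lemma comb_unit_left: "l < n \<Longrightarrow> comb n (unit_vec l) \<phi> = \<phi> l"
  by (rule ext) (simp add: comb_def unit_vec_def if_distrib[of "\<lambda>x. x * _"] sum.delta cong: if_cong)

lemma comb_unit_right: "(\<And>l. l \<ge> n \<Longrightarrow> a l = 0) \<Longrightarrow> comb n a unit_vec = a"
proof (rule ext)
  fix m assume *: "\<And>l. l \<ge> n \<Longrightarrow> a l = 0"
  have "comb n a unit_vec m = (\<Sum>l<n. if l = m then a l else 0)"
    unfolding comb_def by (intro sum.cong) (auto simp: unit_vec_def)
  then show "comb n a unit_vec m = a m" using * by (simp add: sum.delta)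
qed

text \<open>The image of a basis element under the differential. Values of \<open>diff_coeff\<close>
  beyond the rank are unconstrained, hence the cut-off.\<close>

definition diff_row :: "('v, 'k::field, 'm) free_complex \<Rightarrow> nat \<Rightarrow> nat \<Rightarrow> nat \<Rightarrow> ('v, 'k) mpoly" where
  "diff_row F i l = (\<lambda>m. if m < rank F i then diff_coeff F i l m else 0)"

lemma differential_comb: "differential F i c = comb (rank F (Suc i)) c (diff_row F i)"
  by (auto simp: differential_def comb_def diff_row_def)

text \<open>The degree D part of a shifted free module: the coefficient at a basis element of degree
  d has degree \<open>D - d\<close>.\<close>

definition homogeneous_vecs :: "'v set \<Rightarrow> ('v, 'k::field, 'm) free_complex \<Rightarrow> nat \<Rightarrow> int \<Rightarrow> (nat \<Rightarrow> ('v, 'k) mpoly) set" where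
  "homogeneous_vecs V F i D =
     {c. (\<forall>l < rank F i. c l \<in> homogeneous V (D - shift F i l)) \<and> (\<forall>l \<ge> rank F i. c l = 0)}"

lemma homogeneous_vecs_free_part: "c \<in> homogeneous_vecs V F i D \<Longrightarrow> c \<in> free_part V F i"
  by (auto simp: homogeneous_vecs_def free_part_def homogeneous_poly_ring)

lemma homogeneous_vecs_entry: "c \<in> homogeneous_vecs V F i D \<Longrightarrow> c l \<in> homogeneous V (D - shift F i l)"
  by (cases "l < rank F i") (auto simp: homogeneous_vecs_def)

lemma homogeneous_vecs_poly_ring: "c \<in> homogeneous_vecs V F i D \<Longrightarrow> c l \<in> carrier (poly_ring V)"
  using homogeneous_vecs_entry homogeneous_poly_ring by blast

lemma homogeneous_vecs_outside: "c \<in> homogeneous_vecs V F i D \<Longrightarrow> l \<ge> rank F i \<Longrightarrow> c l = 0"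
  by (auto simp: homogeneous_vecs_def)

lemma homogeneous_vecs_diff:
  "b \<in> homogeneous_vecs V F i D \<Longrightarrow> c \<in> homogeneous_vecs V F i D \<Longrightarrow> (\<lambda>l. b l - c l) \<in> homogeneous_vecs V F i D"
  by (auto simp: homogeneous_vecs_def homogeneous_diff)

lemma unit_vec_homogeneous_vecs: "l < rank F i \<Longrightarrow> unit_vec l \<in> homogeneous_vecs V F i (shift F i l)"
  by (auto simp: homogeneous_vecs_def unit_vec_def)

lemma comb_homogeneous_vecs:
  assumes "a \<in> homogeneous_vecs V F i D"
    and "\<And>l. l < rank F i \<Longrightarrow> \<phi> l \<in> homogeneous_vecs V F' i' (shift F i l)"
  shows "comb (rank F i) a \<phi> \<in> homogeneous_vecs V F' i' D"
  unfolding homogeneous_vecs_def mem_Collect_eq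
proof (intro conjI allI impI)
  fix m assume "m \<ge> rank F' i'"
  then show "comb (rank F i) a \<phi> m = 0"
    using homogeneous_vecs_outside[OF assms(2)] by (simp add: comb_def)
next
  fix m
  have "a l * \<phi> l m \<in> homogeneous V (D - shift F' i' m)" if "l < rank F i" for l
    using homogeneous_mult[OF homogeneous_vecs_entry[OF assms(1), of l] homogeneous_vecs_entry[OF assms(2)[OF that], of m]]
    by simp
  then show "comb (rank F i) a \<phi> m \<in> homogeneous V (D - shift F' i' m)"
    unfolding comb_def by (intro homogeneous_sum) auto
qed

text \<open>The augmentation lifted from S/I to S, which turns equations in the quotient into
  membership in I.\<close>

definition cover :: "('v, 'k::field, 'm) free_complex \<Rightarrow> (nat \<Rightarrow> ('v, 'k) mpoly) \<Rightarrow> (nat \<Rightarrow> ('v, 'k) mpoly) \<Rightarrow> ('v, 'k) mpoly" where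
  "cover F g c = (\<Sum>l<rank F 0. c l * g l)"

lemma cover_comb: "cover F g (comb n a \<phi>) = (\<Sum>l<n. a l * cover F g (\<phi> l))"
  unfolding comb_def cover_def
  by (simp add: sum_distrib_left sum_distrib_right mult.assoc sum.swap[of _ "{..<n}"])

lemma cover_diff: "cover F g (\<lambda>l. b l - c l) = cover F g b - cover F g c"
  by (simp add: cover_def left_diff_distrib sum_subtractf)

lemma cover_unit_vec: "l < rank F 0 \<Longrightarrow> cover F g (unit_vec l) = g l"
  by (simp add: cover_def unit_vec_def if_distrib[of "\<lambda>x. x * _"] sum.delta cong: if_cong)

text \<open>Resolutions of \<open>S/I\<close> in terms of representatives \<open>g l\<close> of the generators \<open>gen F l\<close>.\<close>

definition resolves :: "'v set \<Rightarrow> ('v, 'k::field) mpoly set \<Rightarrow> ('v, 'k, 'm) free_complex \<Rightarrow> (nat \<Rightarrow> ('v, 'k) mpoly) \<Rightarrow> bool" where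
  "resolves V I F g \<longleftrightarrow>
     (\<forall>l < rank F 0. g l \<in> homogeneous V (shift F 0 l)) \<and>
     (\<forall>i. \<forall>l' < rank F (Suc i). \<forall>l < rank F i.
        diff_coeff F i l' l \<in> homogeneous V (shift F (Suc i) l' - shift F i l)) \<and>
     (\<forall>p \<in> carrier (poly_ring V). \<exists>c \<in> free_part V F 0. cover F g c - p \<in> I) \<and>
     {c \<in> free_part V F 0. cover F g c \<in> I} = differential F 0 ` free_part V F 1 \<and>
     (\<forall>i. {c \<in> free_part V F (Suc i). differential F i c = (\<lambda>_. 0)} =
        differential F (Suc i) ` free_part V F (Suc (Suc i)))"

lemma resolves_gen: "resolves V I F g \<Longrightarrow> l < rank F 0 \<Longrightarrow> g l \<in> homogeneous V (shift F 0 l)"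
  by (simp add: resolves_def)

lemma resolves_coeff:
  "resolves V I F g \<Longrightarrow> l' < rank F (Suc i) \<Longrightarrow> l < rank F i \<Longrightarrow>
     diff_coeff F i l' l \<in> homogeneous V (shift F (Suc i) l' - shift F i l)"
  by (simp add: resolves_def)

lemma resolves_cover:
  assumes "resolves V I F g" "p \<in> carrier (poly_ring V)"
  obtains c where "c \<in> free_part V F 0" "cover F g c - p \<in> I"
  using assms by (auto simp: resolves_def)

text \<open>The counterpart of \<open>comb\<close> after tensoring: a map acts on field vectors
  through the constant terms of its matrix.\<close>

definition tcomb :: "nat \<Rightarrow> (nat \<Rightarrow> 'k::field) \<Rightarrow> (nat \<Rightarrow> nat \<Rightarrow> ('v, 'k) mpoly) \<Rightarrow> nat \<Rightarrow> 'k" where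
  "tcomb n x \<phi> = (\<lambda>m. \<Sum>l<n. x l * Poly_Mapping.lookup (\<phi> l m) 0)"

lemma tensor_differential_tcomb: "tensor_differential F i x = tcomb (rank F (Suc i)) x (diff_row F i)"
  by (auto simp: tensor_differential_def tcomb_def diff_row_def)

lemma tcomb_tcomb: "tcomb n (tcomb m x \<phi>) \<psi> = tcomb m x (\<lambda>l. comb n (\<phi> l) \<psi>)"
  unfolding tcomb_def comb_def
  by (rule ext) (simp add: sum_distrib_left sum_distrib_right mult.assoc lookup_sum constant_term_mult sum.swap[of _ "{..<n}"])

lemma tcomb_cong: "(\<And>l. l < n \<Longrightarrow> \<phi> l = \<psi> l) \<Longrightarrow> tcomb n x \<phi> = tcomb n x \<psi>"
  by (simp add: tcomb_def)

lemma tcomb_zero [simp]: "tcomb n (\<lambda>_. 0) \<phi> = (\<lambda>_. 0)"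
  by (simp add: tcomb_def)

lemma tcomb_diff_left: "tcomb n (\<lambda>l. x l - y l) \<phi> = (\<lambda>m. tcomb n x \<phi> m - tcomb n y \<phi> m)"
  by (simp add: tcomb_def left_diff_distrib sum_subtractf)

lemma tcomb_diff_right: "tcomb n x (\<lambda>l m. \<phi> l m - \<psi> l m) = (\<lambda>m. tcomb n x \<phi> m - tcomb n x \<psi> m)"
  by (simp add: tcomb_def right_diff_distrib sum_subtractf lookup_minus)

lemma tcomb_unit_vec: "x \<in> tensor_part F i j \<Longrightarrow> tcomb (rank F i) x unit_vec = x"
proof (rule ext)
  fix m assume *: "x \<in> tensor_part F i j"
  have "tcomb (rank F i) x unit_vec m = (\<Sum>l<rank F i. if l = m then x l else 0)"
    unfolding tcomb_def by (intro sum.cong) (auto simp: unit_vec_def)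
  then show "tcomb (rank F i) x unit_vec m = x m" using * by (cases "m < rank F i") (auto simp: sum.delta tensor_part_def)
qed

text \<open>In a degree-preserving map an entry has a nonzero constant term only between basis
  elements of equal degree.\<close>

lemma tcomb_tensor_part:
  fixes \<phi> :: "nat \<Rightarrow> nat \<Rightarrow> ('v, 'k::field) mpoly" and F :: "('v, 'k, 'm) free_complex"
  assumes "x \<in> tensor_part F i j"
    and "\<And>l. l < rank F i \<Longrightarrow> \<phi> l \<in> homogeneous_vecs V F' i' (shift F i l)"
  shows "tcomb (rank F i) x \<phi> \<in> tensor_part F' i' j"
  unfolding tensor_part_def mem_Collect_eq
proof (intro allI impI)
  fix m assume "tcomb (rank F i) x \<phi> m \<noteq> 0"
  then obtain l where "l < rank F i" "x l * Poly_Mapping.lookup (\<phi> l m) 0 \<noteq> 0"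
    unfolding tcomb_def by (meson lessThan_iff sum.not_neutral_contains_not_neutral)
  then have l: "l < rank F i" "x l \<noteq> 0" "0 \<in> Poly_Mapping.keys (\<phi> l m)" by (auto simp: in_keys_iff)
  note \<phi> = assms(2)[OF l(1)]
  have "m < rank F' i'" using homogeneous_vecs_outside[OF \<phi>, of m] l(3) by (cases "m < rank F' i'") auto
  moreover have "int (mon_degree (0 :: 'v \<Rightarrow>\<^sub>0 nat)) = shift F i l - shift F' i' m"
    using homogeneous_vecs_entry[OF \<phi>, of m] l(3) unfolding homogeneous_def mem_Collect_eq by metis
  moreover have "shift F i l = j" using assms(1) l by (auto simp: tensor_part_def)
  ultimately show "m < rank F' i' \<and> shift F' i' m = j" by simp
qed

lemma tensor_part_diff:
  "x \<in> tensor_part F i j \<Longrightarrow> y \<in> tensor_part F i j \<Longrightarrow> (\<lambda>l. x l - y l) \<in> tensor_part F i j"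
  unfolding tensor_part_def mem_Collect_eq by (metis diff_self)

section \<open>Comparison of two resolutions of the same quotient\<close>

locale homogeneous_ideal =
  fixes V :: "'v set" and I :: "('v, 'k::field) mpoly set"
  assumes I_poly_ring: "I \<subseteq> carrier (poly_ring V)"
    and I_zero: "0 \<in> I"
    and I_add: "\<And>p q. p \<in> I \<Longrightarrow> q \<in> I \<Longrightarrow> p + q \<in> I"
    and I_mult: "\<And>p q. p \<in> carrier (poly_ring V) \<Longrightarrow> q \<in> I \<Longrightarrow> p * q \<in> I"
    and I_hcomp: "\<And>p D. p \<in> I \<Longrightarrow> hcomp D p \<in> I"
begin

lemma I_uminus: "p \<in> I \<Longrightarrow> - p \<in> I"
  using I_mult[OF poly_ring_uminus[OF poly_ring_one], of p] by simp

lemma I_sum: "(\<And>x. x \<in> A \<Longrightarrow> f x \<in> I) \<Longrightarrow> sum f A \<in> I"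
  by (induction A rule: infinite_finite_induct) (auto intro: I_add I_zero)

text \<open>The kernel of the outgoing map, where the map out of degree 0 is the augmentation to
  S/I. The lifting arguments can then treat all degrees alike.\<close>

definition is_cycle :: "('v, 'k, 'm) free_complex \<Rightarrow> (nat \<Rightarrow> ('v, 'k) mpoly) \<Rightarrow> nat \<Rightarrow> (nat \<Rightarrow> ('v, 'k) mpoly) \<Rightarrow> bool" where
  "is_cycle F g i c = (case i of 0 \<Rightarrow> cover F g c \<in> I | Suc j \<Rightarrow> differential F j c = (\<lambda>_. 0))"

lemma is_cycle_exact:
  assumes "resolves V I F g"
  shows "{c \<in> free_part V F i. is_cycle F g i c} = differential F i ` free_part V F (Suc i)"
  using assms unfolding resolves_def is_cycle_def by (cases i) auto

lemma diff_row_homogeneous_vecs: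
  "resolves V I F g \<Longrightarrow> l < rank F (Suc i) \<Longrightarrow> diff_row F i l \<in> homogeneous_vecs V F i (shift F (Suc i) l)"
  by (auto simp: resolves_def homogeneous_vecs_def diff_row_def)

lemma is_cycle_diff_row:
  assumes "resolves V I F g" "l < rank F (Suc i)"
  shows "is_cycle F g i (diff_row F i l)"
proof -
  have "diff_row F i l = differential F i (unit_vec l)"
    using assms(2) by (simp add: differential_comb comb_unit_left)
  also have "unit_vec l \<in> free_part V F (Suc i)"
    using unit_vec_homogeneous_vecs[OF assms(2)] by (rule homogeneous_vecs_free_part)
  then have "differential F i (unit_vec l) \<in> differential F i ` free_part V F (Suc i)" by (rule imageI)
  finally have "diff_row F i l \<in> {c \<in> free_part V F i. is_cycle F g i c}"
    unfolding is_cycle_exact[OF assms(1)] .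
  then show ?thesis by simp
qed

text \<open>Exactness yields some preimage. Its components in the degrees prescribed by D form a
  preimage again, because the differential is homogeneous and b already has degree D.\<close>

lemma lift_cycle:
  assumes "resolves V I F g" "b \<in> homogeneous_vecs V F i D" "is_cycle F g i b"
  shows "\<exists>y \<in> homogeneous_vecs V F (Suc i) D. differential F i y = b"
proof -
  have "b \<in> {c \<in> free_part V F i. is_cycle F g i c}"
    using assms(3) homogeneous_vecs_free_part[OF assms(2)] by simp
  then obtain y0 where y0: "y0 \<in> free_part V F (Suc i)" "differential F i y0 = b"
    unfolding is_cycle_exact[OF assms(1)] by auto
  define y where "y l = hcomp (D - shift F (Suc i) l) (y0 l)" for l
  have y0_poly: "y0 l \<in> carrier (poly_ring V)" for l
    using y0(1) by (cases "l < rank F (Suc i)") (auto simp: free_part_def)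
  have "y \<in> homogeneous_vecs V F (Suc i) D"
    using y0 y0_poly unfolding homogeneous_vecs_def y_def free_part_def by (auto intro: hcomp_homogeneous)
  moreover have "differential F i y m = b m" for m
  proof (cases "m < rank F i")
    case True
    have "y l * diff_coeff F i l m = hcomp (D - shift F i m) (y0 l * diff_coeff F i l m)" if "l < rank F (Suc i)" for l
    proof -
      have "diff_coeff F i l m \<in> homogeneous V (shift F (Suc i) l - shift F i m)"
        using assms(1) that True by (rule resolves_coeff)
      from hcomp_mult[OF y0_poly this] show ?thesis by (simp add: y_def)
    qed
    then have "differential F i y m = hcomp (D - shift F i m) (differential F i y0 m)"
      using True by (simp add: differential_def hcomp_sum)
    also have "\<dots> = b m"
      unfolding y0(2) using homogeneous_vecs_entry[OF assms(2)] by (rule hcomp_same)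
    finally show ?thesis .
  next
    case False
    then show ?thesis using homogeneous_vecs_outside[OF assms(2), of m] by (simp add: differential_def)
  qed
  ultimately show ?thesis by blast
qed

lemma lift_generator:
  assumes "resolves V I F g" "t \<in> homogeneous V D"
  shows "\<exists>y \<in> homogeneous_vecs V F 0 D. cover F g y - t \<in> I"
proof -
  obtain y0 where y0: "y0 \<in> free_part V F 0" "cover F g y0 - t \<in> I"
    using resolves_cover[OF assms(1) homogeneous_poly_ring[OF assms(2)]] .
  define y where "y l = hcomp (D - shift F 0 l) (y0 l)" for l
  have y0_poly: "y0 l \<in> carrier (poly_ring V)" for l
    using y0(1) by (cases "l < rank F 0") (auto simp: free_part_def)
  have "y \<in> homogeneous_vecs V F 0 D"
    using y0 y0_poly unfolding homogeneous_vecs_def y_def free_part_def by (auto intro: hcomp_homogeneous)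
  moreover have "y l * g l = hcomp D (y0 l * g l)" if "l < rank F 0" for l
  proof -
    have "g l \<in> homogeneous V (shift F 0 l)" using assms(1) that by (rule resolves_gen)
    from hcomp_mult[OF y0_poly this] show ?thesis by (simp add: y_def)
  qed
  then have "cover F g y - t = hcomp D (cover F g y0 - t)"
    by (simp add: cover_def hcomp_sum hcomp_diff hcomp_same[OF assms(2)])
  then have "cover F g y - t \<in> I" using I_hcomp[OF y0(2)] by simp
  ultimately show ?thesis by blast
qed

text \<open>The comparison theorem over the identity of S/I: images of basis elements may be chosen
  freely, and exactness of \<open>F'\<close> supplies them degree by degree.\<close>

lemma chain_map_exists:
  assumes F: "resolves V I F g" and F': "resolves V I F' g'"
  obtains \<phi> where
    "\<And>i l. l < rank F i \<Longrightarrow> \<phi> i l \<in> homogeneous_vecs V F' i (shift F i l)"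
    "\<And>l. l < rank F 0 \<Longrightarrow> cover F' g' (\<phi> 0 l) - g l \<in> I"
    "\<And>i l. l < rank F (Suc i) \<Longrightarrow> differential F' i (\<phi> (Suc i) l) = comb (rank F i) (diff_row F i l) (\<phi> i)"
proof -
  \<comment> \<open>The last conjunct is what keeps the recursion going: the differential of each
    basis element in the next degree is sent to a cycle of \<open>F'\<close>, which can then be
    lifted.\<close>
  define P where "P i \<phi> \<longleftrightarrow> (\<forall>l<rank F i. \<phi> l \<in> homogeneous_vecs V F' i (shift F i l)) \<and>
     (i = 0 \<longrightarrow> (\<forall>l<rank F 0. cover F' g' (\<phi> l) - g l \<in> I)) \<and>
     (\<forall>l<rank F (Suc i). is_cycle F' g' i (comb (rank F i) (diff_row F i l) \<phi>))" for i \<phi>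
  define Q where "Q i \<phi> \<phi>' \<longleftrightarrow>
     (\<forall>l<rank F (Suc i). differential F' i (\<phi>' l) = comb (rank F i) (diff_row F i l) \<phi>)" for i \<phi> \<phi>'
  have "\<exists>\<phi>. \<forall>i. P i (\<phi> i) \<and> Q i (\<phi> i) (\<phi> (Suc i))"
  proof (rule dependent_nat_choice)
    have "\<forall>l. \<exists>y. l < rank F 0 \<longrightarrow> y \<in> homogeneous_vecs V F' 0 (shift F 0 l) \<and> cover F' g' y - g l \<in> I"
      using lift_generator[OF F' resolves_gen[OF F]] by metis
    then obtain \<phi> where \<phi>: "\<And>l. l < rank F 0 \<Longrightarrow> \<phi> l \<in> homogeneous_vecs V F' 0 (shift F 0 l)"
      "\<And>l. l < rank F 0 \<Longrightarrow> cover F' g' (\<phi> l) - g l \<in> I" by metis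
    have "is_cycle F' g' 0 (comb (rank F 0) (diff_row F 0 l) \<phi>)" if "l < rank F (Suc 0)" for l
    proof -
      let ?d = "diff_row F 0 l"
      \<comment> \<open>The image of a relation is a combination of the errors
        \<open>cover F' g' (\<phi> m) - g m\<close>, which lie in I, plus the relation itself
        evaluated in F.\<close>
      have "cover F' g' (comb (rank F 0) ?d \<phi>) =
          (\<Sum>m<rank F 0. ?d m * (cover F' g' (\<phi> m) - g m)) + cover F g ?d"
        by (simp add: cover_comb cover_def[of F] right_diff_distrib sum_subtractf)
      moreover have "(\<Sum>m<rank F 0. ?d m * (cover F' g' (\<phi> m) - g m)) \<in> I"
        using \<phi>(2) homogeneous_vecs_poly_ring[OF diff_row_homogeneous_vecs[OF F that]]
        by (intro I_sum I_mult) auto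
      moreover have "cover F g ?d \<in> I" using is_cycle_diff_row[OF F that] by (simp add: is_cycle_def)
      ultimately show ?thesis by (simp add: is_cycle_def I_add)
    qed
    then show "\<exists>\<phi>. P 0 \<phi>" using \<phi> unfolding P_def by blast
  next
    fix \<phi> i assume P: "P i \<phi>"
    have "\<exists>y. l < rank F (Suc i) \<longrightarrow> y \<in> homogeneous_vecs V F' (Suc i) (shift F (Suc i) l) \<and>
        differential F' i y = comb (rank F i) (diff_row F i l) \<phi>" for l
    proof (cases "l < rank F (Suc i)")
      case True
      have "comb (rank F i) (diff_row F i l) \<phi> \<in> homogeneous_vecs V F' i (shift F (Suc i) l)"
        using P unfolding P_def by (intro comb_homogeneous_vecs diff_row_homogeneous_vecs[OF F True]) auto
      then show ?thesis using lift_cycle[OF F'] P True unfolding P_def by blast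
    qed simp
    then obtain \<phi>' where \<phi>': "\<And>l. l < rank F (Suc i) \<Longrightarrow> \<phi>' l \<in> homogeneous_vecs V F' (Suc i) (shift F (Suc i) l)"
      "\<And>l. l < rank F (Suc i) \<Longrightarrow> differential F' i (\<phi>' l) = comb (rank F i) (diff_row F i l) \<phi>" by metis
    have "is_cycle F' g' (Suc i) (comb (rank F (Suc i)) (diff_row F (Suc i) l) \<phi>')" if "l < rank F (Suc (Suc i))" for l
    proof -
      have "differential F' i (comb (rank F (Suc i)) (diff_row F (Suc i) l) \<phi>') =
          comb (rank F (Suc i)) (diff_row F (Suc i) l) (\<lambda>m. comb (rank F i) (diff_row F i m) \<phi>)"
        unfolding differential_comb comb_comb using \<phi>'(2) by (intro comb_cong) (auto simp: differential_comb)
      also have "\<dots> = comb (rank F i) (differential F i (diff_row F (Suc i) l)) \<phi>"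
        by (simp add: differential_comb comb_comb)
      also have "differential F i (diff_row F (Suc i) l) = (\<lambda>_. 0)"
        using is_cycle_diff_row[OF F that] by (simp add: is_cycle_def)
      finally show ?thesis by (simp add: is_cycle_def comb_def)
    qed
    then have "P (Suc i) \<phi>'" "Q i \<phi> \<phi>'" using \<phi>' unfolding P_def Q_def by auto
    then show "\<exists>\<phi>'. P (Suc i) \<phi>' \<and> Q i \<phi> \<phi>'" by blast
  qed
  then obtain \<phi> where "\<And>i. P i (\<phi> i)" "\<And>i. Q i (\<phi> i) (\<phi> (Suc i))" by blast
  then show thesis using that[of \<phi>] unfolding P_def Q_def by blast
qed

text \<open>A chain endomorphism that is zero on S/I is homotopic to zero: in each degree, \<chi>
  minus the composite of the differential with the homotopy built so far is a cycle and can be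
  lifted.\<close>

lemma null_homotopy_exists:
  assumes F: "resolves V I F g"
    and \<chi>: "\<And>i l. l < rank F i \<Longrightarrow> \<chi> i l \<in> homogeneous_vecs V F i (shift F i l)"
      "\<And>l. l < rank F 0 \<Longrightarrow> cover F g (\<chi> 0 l) \<in> I"
      "\<And>i l. l < rank F (Suc i) \<Longrightarrow> differential F i (\<chi> (Suc i) l) = comb (rank F i) (diff_row F i l) (\<chi> i)"
  obtains s where
    "\<And>i l. l < rank F i \<Longrightarrow> s i l \<in> homogeneous_vecs V F (Suc i) (shift F i l)"
    "\<And>l. l < rank F 0 \<Longrightarrow> differential F 0 (s 0 l) = \<chi> 0 l"
    "\<And>i l. l < rank F (Suc i) \<Longrightarrow>
       differential F (Suc i) (s (Suc i) l) = (\<lambda>m. \<chi> (Suc i) l m - comb (rank F i) (diff_row F i l) (s i) m)"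
proof -
  define r where "r i l s = (\<lambda>m. \<chi> (Suc i) l m - comb (rank F i) (diff_row F i l) s m)" for i l s
  define P where "P i s \<longleftrightarrow> (\<forall>l<rank F i. s l \<in> homogeneous_vecs V F (Suc i) (shift F i l)) \<and>
     (i = 0 \<longrightarrow> (\<forall>l<rank F 0. differential F 0 (s l) = \<chi> 0 l)) \<and>
     (\<forall>l<rank F (Suc i). is_cycle F g (Suc i) (r i l s))" for i s
  define Q where "Q i s s' \<longleftrightarrow> (\<forall>l<rank F (Suc i). differential F (Suc i) (s' l) = r i l s)" for i s s'
  have "\<exists>s. \<forall>i. P i (s i) \<and> Q i (s i) (s (Suc i))"
  proof (rule dependent_nat_choice)
    have "\<forall>l. \<exists>y. l < rank F 0 \<longrightarrow> y \<in> homogeneous_vecs V F (Suc 0) (shift F 0 l) \<and> differential F 0 y = \<chi> 0 l"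
      using lift_cycle[OF F \<chi>(1)] \<chi>(2) unfolding is_cycle_def by fastforce
    then obtain s where s: "\<And>l. l < rank F 0 \<Longrightarrow> s l \<in> homogeneous_vecs V F (Suc 0) (shift F 0 l)"
      "\<And>l. l < rank F 0 \<Longrightarrow> differential F 0 (s l) = \<chi> 0 l" by metis
    have "is_cycle F g (Suc 0) (r 0 l s)" if "l < rank F (Suc 0)" for l
    proof -
      have "differential F 0 (comb (rank F 0) (diff_row F 0 l) s) = comb (rank F 0) (diff_row F 0 l) (\<chi> 0)"
        unfolding differential_comb comb_comb using s(2) by (intro comb_cong) (auto simp: differential_comb)
      then have "differential F 0 (r 0 l s) = (\<lambda>_. 0)"
        using \<chi>(3)[OF that] by (simp add: r_def differential_comb comb_diff_left)
      then show ?thesis by (simp add: is_cycle_def)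
    qed
    then show "\<exists>s. P 0 s" using s unfolding P_def by blast
  next
    fix s i assume P: "P i s"
    have "\<exists>y. l < rank F (Suc i) \<longrightarrow> y \<in> homogeneous_vecs V F (Suc (Suc i)) (shift F (Suc i) l) \<and>
        differential F (Suc i) y = r i l s" for l
    proof (cases "l < rank F (Suc i)")
      case True
      have "r i l s \<in> homogeneous_vecs V F (Suc i) (shift F (Suc i) l)"
        unfolding r_def using P unfolding P_def
        by (intro homogeneous_vecs_diff \<chi>(1) True comb_homogeneous_vecs diff_row_homogeneous_vecs[OF F True]) auto
      then show ?thesis using lift_cycle[OF F] P True unfolding P_def by blast
    qed simp
    then obtain s' where s': "\<And>l. l < rank F (Suc i) \<Longrightarrow> s' l \<in> homogeneous_vecs V F (Suc (Suc i)) (shift F (Suc i) l)"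
      "\<And>l. l < rank F (Suc i) \<Longrightarrow> differential F (Suc i) (s' l) = r i l s" by metis
    have "is_cycle F g (Suc (Suc i)) (r (Suc i) l s')" if "l < rank F (Suc (Suc i))" for l
    proof -
      let ?d = "diff_row F (Suc i) l"
      have "differential F (Suc i) (comb (rank F (Suc i)) ?d s') = comb (rank F (Suc i)) ?d (\<lambda>m. r i m s)"
        unfolding differential_comb comb_comb using s'(2) by (intro comb_cong) (auto simp: differential_comb)
      also have "\<dots> = (\<lambda>k. comb (rank F (Suc i)) ?d (\<chi> (Suc i)) k - comb (rank F i) (differential F i ?d) s k)"
        by (simp add: r_def comb_diff_right differential_comb comb_comb)
      also have "differential F i ?d = (\<lambda>_. 0)"
        using is_cycle_diff_row[OF F that] by (simp add: is_cycle_def)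
      finally have "differential F (Suc i) (r (Suc i) l s') = (\<lambda>_. 0)"
        using \<chi>(3)[OF that] by (simp add: r_def[of "Suc i"] differential_comb comb_diff_left) (simp add: comb_def)
      then show ?thesis by (simp add: is_cycle_def)
    qed
    then have "P (Suc i) s'" "Q i s s'" using s' unfolding P_def Q_def by auto
    then show "\<exists>s'. P (Suc i) s' \<and> Q i s s'" by blast
  qed
  then obtain s where "\<And>i. P i (s i)" "\<And>i. Q i (s i) (s (Suc i))" by blast
  then show thesis using that[of s] unfolding P_def Q_def r_def by blast
qed

text \<open>The differential squares to zero over S, and taking constant terms respects composition
  of maps.\<close>

lemma tensor_boundaries_subset_cycles:
  assumes F: "resolves V I F g"
  shows "tensor_boundaries F i j \<subseteq> tensor_cycles F i j"
proof
  fix y assume "y \<in> tensor_boundaries F i j"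
  then obtain x where x: "x \<in> tensor_part F (Suc i) j" "y = tcomb (rank F (Suc i)) x (diff_row F i)"
    by (auto simp: tensor_boundaries_def tensor_differential_tcomb)
  have "y \<in> tensor_part F i j"
    unfolding x(2) using x(1) diff_row_homogeneous_vecs[OF F] by (rule tcomb_tensor_part)
  moreover have "tensor_differential F i' y = (\<lambda>_. 0)" if "i = Suc i'" for i'
  proof -
    have "tensor_differential F i' y = tcomb (rank F (Suc i)) x (\<lambda>_ _. 0 :: ('v, 'k) mpoly)"
      unfolding x(2) tensor_differential_tcomb that tcomb_tcomb
    proof (intro tcomb_cong)
      fix l assume "l < rank F (Suc (Suc i'))"
      from is_cycle_diff_row[OF F this]
      show "comb (rank F (Suc i')) (diff_row F (Suc i') l) (diff_row F i') = (\<lambda>_. 0)"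
        by (simp add: is_cycle_def differential_comb)
    qed
    then show ?thesis by (simp add: tcomb_def)
  qed
  ultimately show "y \<in> tensor_cycles F i j" by (simp add: tensor_cycles_def)
qed

text \<open>Comparison maps \<phi> and \<psi> go both ways, and the composite from F through
  \<open>F'\<close> back to F differs from the identity by a null-homotopic map \<chi>; so vanishing
  for \<open>F'\<close> passes to F.\<close>

theorem tensor_homology_transfer:
  assumes F: "resolves V I F g" and F': "resolves V I F' g'"
    and exact: "tensor_cycles F' i j = tensor_boundaries F' i j"
  shows "tensor_cycles F i j = tensor_boundaries F i j"
proof
  obtain \<phi> where \<phi>: "\<And>i l. l < rank F i \<Longrightarrow> \<phi> i l \<in> homogeneous_vecs V F' i (shift F i l)"
    "\<And>l. l < rank F 0 \<Longrightarrow> cover F' g' (\<phi> 0 l) - g l \<in> I"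
    "\<And>i l. l < rank F (Suc i) \<Longrightarrow> differential F' i (\<phi> (Suc i) l) = comb (rank F i) (diff_row F i l) (\<phi> i)"
    using chain_map_exists[OF F F'] by metis
  obtain \<psi> where \<psi>: "\<And>i l. l < rank F' i \<Longrightarrow> \<psi> i l \<in> homogeneous_vecs V F i (shift F' i l)"
    "\<And>l. l < rank F' 0 \<Longrightarrow> cover F g (\<psi> 0 l) - g' l \<in> I"
    "\<And>i l. l < rank F' (Suc i) \<Longrightarrow> differential F i (\<psi> (Suc i) l) = comb (rank F' i) (diff_row F' i l) (\<psi> i)"
    using chain_map_exists[OF F' F] by metis
  define \<chi> where "\<chi> i l = (\<lambda>m. comb (rank F' i) (\<phi> i l) (\<psi> i) m - unit_vec l m)" for i l
  have \<chi>1: "\<chi> i l \<in> homogeneous_vecs V F i (shift F i l)" if "l < rank F i" for i l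
    unfolding \<chi>_def using that \<phi>(1) \<psi>(1)
    by (intro homogeneous_vecs_diff unit_vec_homogeneous_vecs comb_homogeneous_vecs) auto
  have \<chi>2: "cover F g (\<chi> 0 l) \<in> I" if "l < rank F 0" for l
  proof -
    have "cover F g (\<chi> 0 l) = (\<Sum>k<rank F' 0. \<phi> 0 l k * (cover F g (\<psi> 0 k) - g' k)) + (cover F' g' (\<phi> 0 l) - g l)"
      unfolding \<chi>_def cover_diff cover_unit_vec[OF that]
      by (simp add: cover_comb cover_def[of F' g' "\<phi> 0 l"] right_diff_distrib sum_subtractf)
    also have "\<dots> \<in> I"
      using that \<phi>(2) \<psi>(2) homogeneous_vecs_poly_ring[OF \<phi>(1)] by (intro I_add I_sum I_mult) auto
    finally show ?thesis .
  qed
  have \<chi>3: "differential F i (\<chi> (Suc i) l) = comb (rank F i) (diff_row F i l) (\<chi> i)" if "l < rank F (Suc i)" for i l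
  proof -
    have "differential F i (comb (rank F' (Suc i)) (\<phi> (Suc i) l) (\<psi> (Suc i))) =
        comb (rank F' (Suc i)) (\<phi> (Suc i) l) (\<lambda>k. comb (rank F' i) (diff_row F' i k) (\<psi> i))"
      unfolding differential_comb comb_comb using \<psi>(3) by (intro comb_cong) (auto simp: differential_comb)
    also have "\<dots> = comb (rank F' i) (differential F' i (\<phi> (Suc i) l)) (\<psi> i)"
      by (simp add: differential_comb comb_comb)
    also have "\<dots> = comb (rank F i) (diff_row F i l) (\<lambda>k. comb (rank F' i) (\<phi> i k) (\<psi> i))"
      by (simp add: \<phi>(3)[OF that] comb_comb)
    finally show ?thesis
      using homogeneous_vecs_outside[OF diff_row_homogeneous_vecs[OF F that]] that
      by (simp add: \<chi>_def[abs_def] differential_comb comb_diff_left comb_diff_right comb_unit_left comb_unit_right)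
  qed
  obtain s where s: "\<And>i l. l < rank F i \<Longrightarrow> s i l \<in> homogeneous_vecs V F (Suc i) (shift F i l)"
    "\<And>l. l < rank F 0 \<Longrightarrow> differential F 0 (s 0 l) = \<chi> 0 l"
    "\<And>i l. l < rank F (Suc i) \<Longrightarrow>
       differential F (Suc i) (s (Suc i) l) = (\<lambda>m. \<chi> (Suc i) l m - comb (rank F i) (diff_row F i l) (s i) m)"
    by (rule null_homotopy_exists[OF F, of \<chi>, OF \<chi>1 \<chi>2 \<chi>3]) (assumption+, rule that, blast+)
  show "tensor_cycles F i j \<subseteq> tensor_boundaries F i j"
  proof
    fix x assume "x \<in> tensor_cycles F i j"
    then have x: "x \<in> tensor_part F i j" and
      x0: "\<And>i'. i = Suc i' \<Longrightarrow> tcomb (rank F i) x (diff_row F i') = (\<lambda>_. 0)"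
      by (auto simp: tensor_cycles_def tensor_differential_tcomb)
    define y where "y = tcomb (rank F i) x (\<phi> i)"
    have "y \<in> tensor_part F' i j" unfolding y_def using x \<phi>(1) by (rule tcomb_tensor_part)
    moreover have "tensor_differential F' i' y = (\<lambda>_. 0)" if "i = Suc i'" for i'
    proof -
      have "tensor_differential F' i' y = tcomb (rank F i) x (\<lambda>l. comb (rank F i') (diff_row F i' l) (\<phi> i'))"
        unfolding y_def tensor_differential_tcomb that tcomb_tcomb
        using \<phi>(3) by (intro tcomb_cong) (auto simp: differential_comb)
      also have "\<dots> = tcomb (rank F i') (tcomb (rank F i) x (diff_row F i')) (\<phi> i')"
        by (simp add: tcomb_tcomb)
      finally show ?thesis by (simp add: x0[OF that])
    qed
    ultimately have "y \<in> tensor_boundaries F' i j" using exact by (auto simp: tensor_cycles_def)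
    then obtain z where z: "z \<in> tensor_part F' (Suc i) j" "y = tcomb (rank F' (Suc i)) z (diff_row F' i)"
      by (auto simp: tensor_boundaries_def tensor_differential_tcomb)
    \<comment> \<open>If the image of x in \<open>F'\<close> bounds z, then x bounds w - v: the
      boundary of w is x plus the value of \<chi> at x, and v accounts for the latter because x is a
      cycle.\<close>
    define w where "w = tcomb (rank F' (Suc i)) z (\<psi> (Suc i))"
    define v where "v = tcomb (rank F i) x (s i)"
    have w: "w \<in> tensor_part F (Suc i) j" unfolding w_def using z(1) \<psi>(1) by (rule tcomb_tensor_part)
    have v: "v \<in> tensor_part F (Suc i) j" unfolding v_def using x s(1) by (rule tcomb_tensor_part)
    have "tensor_differential F i w = tcomb (rank F' (Suc i)) z (\<lambda>l. comb (rank F' i) (diff_row F' i l) (\<psi> i))"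
      unfolding w_def tensor_differential_tcomb tcomb_tcomb
      using \<psi>(3) by (intro tcomb_cong) (auto simp: differential_comb)
    also have "\<dots> = tcomb (rank F' i) y (\<psi> i)" by (simp add: z(2) tcomb_tcomb)
    also have "\<dots> = tcomb (rank F i) x (\<lambda>l. comb (rank F' i) (\<phi> i l) (\<psi> i))" by (simp add: y_def tcomb_tcomb)
    also have "\<dots> = (\<lambda>m. tcomb (rank F i) x (\<chi> i) m + x m)"
      by (simp add: \<chi>_def[abs_def] tcomb_diff_right tcomb_unit_vec[OF x])
    finally have dw: "tensor_differential F i w = (\<lambda>m. tcomb (rank F i) x (\<chi> i) m + x m)" .
    have dv: "tensor_differential F i v = tcomb (rank F i) x (\<chi> i)"
    proof (cases i)
      case 0
      show ?thesis unfolding v_def tensor_differential_tcomb tcomb_tcomb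
        using s(2) 0 by (intro tcomb_cong) (auto simp: differential_comb)
    next
      case (Suc i')
      have "tensor_differential F i v =
          tcomb (rank F i) x (\<lambda>l m. \<chi> i l m - comb (rank F i') (diff_row F i' l) (s i') m)"
        unfolding v_def tensor_differential_tcomb tcomb_tcomb
        using s(3) Suc by (intro tcomb_cong) (auto simp: differential_comb)
      also have "\<dots> = (\<lambda>m. tcomb (rank F i) x (\<chi> i) m - tcomb (rank F i') (tcomb (rank F i) x (diff_row F i')) (s i') m)"
        by (simp add: tcomb_diff_right tcomb_tcomb)
      finally show ?thesis by (simp add: x0[OF Suc])
    qed
    have "tensor_differential F i (\<lambda>l. w l - v l) = x"
      unfolding tensor_differential_tcomb tcomb_diff_left
      by (simp add: dw dv flip: tensor_differential_tcomb)
    then show "x \<in> tensor_boundaries F i j"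
      unfolding tensor_boundaries_def using tensor_part_diff[OF w v] by blast
  qed
qed (rule tensor_boundaries_subset_cycles[OF F])

end

section \<open>Squarefree monomial ideals and their quotients\<close>

definition sqfree :: "'v set \<Rightarrow> 'v \<Rightarrow>\<^sub>0 nat" where
  "sqfree A = (\<Sum>v\<in>A. Poly_Mapping.single v 1)"

lemma lookup_sqfree: "finite A \<Longrightarrow> Poly_Mapping.lookup (sqfree A) v = (if v \<in> A then 1 else 0)"
  by (simp add: sqfree_def lookup_sum lookup_single when_def sum.delta)

lemma keys_sqfree [simp]: "finite A \<Longrightarrow> Poly_Mapping.keys (sqfree A) = A"
  by (auto simp: in_keys_iff lookup_sqfree split: if_splits)

lemma mon_degree_sqfree: "finite A \<Longrightarrow> mon_degree (sqfree A) = card A"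
  by (simp add: mon_degree_def lookup_sqfree)

lemma sqfree_empty [simp]: "sqfree {} = 0"
  by (simp add: sqfree_def)

lemma sqfree_eq_zero_iff: "finite A \<Longrightarrow> sqfree A = 0 \<longleftrightarrow> A = {}"
  by (metis keys_sqfree keys_zero sqfree_empty)

lemma sqfree_diff_add:
  assumes "A \<subseteq> B" "finite B"
  shows "sqfree (B - A) + sqfree A = sqfree B"
  unfolding sqfree_def using assms by (metis sum.subset_diff)

lemma diff_sqfree_add:
  assumes "finite A" "A \<subseteq> Poly_Mapping.keys m"
  shows "m - sqfree A + sqfree A = m"
proof (rule poly_mapping_eqI)
  fix v
  have "v \<in> A \<Longrightarrow> Poly_Mapping.lookup m v \<noteq> 0" using assms(2) by (auto simp: in_keys_iff)
  then show "Poly_Mapping.lookup (m - sqfree A + sqfree A) v = Poly_Mapping.lookup m v"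
    using assms(1) by (auto simp: lookup_add lookup_minus lookup_sqfree)
qed

lemma keys_diff_subset: "Poly_Mapping.keys (m - n) \<subseteq> Poly_Mapping.keys (m :: 'v \<Rightarrow>\<^sub>0 nat)"
  by (auto simp: in_keys_iff lookup_minus)

lemma sum_single_keys: "(\<Sum>m\<in>Poly_Mapping.keys p. Poly_Mapping.single m (Poly_Mapping.lookup p m)) = p"
  by (rule poly_mapping_eqI) (auto simp: lookup_sum lookup_single when_def sum.delta in_keys_iff)

text \<open>Membership is tested monomial by monomial: the inclusion of f in the keys of m says that
  the squarefree monomial with support f divides m. Closure under homogeneous components is then
  immediate.\<close>

definition monomial_ideal :: "'v set \<Rightarrow> 'v set set \<Rightarrow> ('v, 'k::field) mpoly set" where
  "monomial_ideal V H = {p \<in> carrier (poly_ring V). \<forall>m\<in>Poly_Mapping.keys p. \<exists>f\<in>H. f \<subseteq> Poly_Mapping.keys m}"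

lemma monomial_ideal_mult:
  assumes "p \<in> carrier (poly_ring V)" "q \<in> monomial_ideal V H"
  shows "p * q \<in> monomial_ideal V H"
proof -
  have "\<exists>f\<in>H. f \<subseteq> Poly_Mapping.keys m" if m: "m \<in> Poly_Mapping.keys (p * q)" for m
  proof -
    obtain a b where "b \<in> Poly_Mapping.keys q" "m = a + b" using m by (rule keys_multE)
    moreover obtain f where "f \<in> H" "f \<subseteq> Poly_Mapping.keys b"
      using assms(2) calculation(1) by (auto simp: monomial_ideal_def)
    ultimately show ?thesis by (auto simp: keys_add_nat)
  qed
  then show ?thesis using assms by (auto simp: monomial_ideal_def)
qed

lemma monomial_ideal_add:
  "p \<in> monomial_ideal V H \<Longrightarrow> q \<in> monomial_ideal V H \<Longrightarrow> p + q \<in> monomial_ideal V H"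
  using keys_add[of p q] by (auto simp: monomial_ideal_def)

lemma homogeneous_ideal_monomial_ideal: "homogeneous_ideal V (monomial_ideal V H :: ('v, 'k::field) mpoly set)"
proof
  fix p :: "('v, 'k) mpoly" and D
  assume p: "p \<in> monomial_ideal V H"
  then have "hcomp D p \<in> carrier (poly_ring V)"
    by (intro homogeneous_poly_ring[OF hcomp_homogeneous]) (simp add: monomial_ideal_def)
  moreover have "Poly_Mapping.keys (hcomp D p) \<subseteq> Poly_Mapping.keys p"
    by (auto simp: in_keys_iff lookup_hcomp)
  ultimately show "hcomp D p \<in> monomial_ideal V H" using p by (auto simp: monomial_ideal_def)
qed (auto simp: monomial_ideal_mult monomial_ideal_add, auto simp: monomial_ideal_def)

lemma ideal_poly_ringI:
  assumes "homogeneous_ideal V (I :: ('v, 'k::field) mpoly set)"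
  shows "ideal I (poly_ring V)"
proof -
  interpret homogeneous_ideal V I by fact
  interpret R: cring "poly_ring V :: ('v, 'k) mpoly ring" by (rule cring_poly_ring)
  have "\<ominus>\<^bsub>poly_ring V\<^esub> p = - p" if "p \<in> carrier (poly_ring V)" for p :: "('v, 'k) mpoly"
    using that by (intro R.minus_equality) auto
  then show ?thesis
  proof (intro idealI R.ring_axioms)
    show "subgroup I (add_monoid (poly_ring V))"
    proof
      fix p assume p: "p \<in> I"
      then have "inv\<^bsub>add_monoid (poly_ring V)\<^esub> p = - p"
        using \<open>\<And>p. p \<in> carrier (poly_ring V) \<Longrightarrow> \<ominus>\<^bsub>poly_ring V\<^esub> p = - p\<close> I_poly_ring by (auto simp: a_inv_def)
      then show "inv\<^bsub>add_monoid (poly_ring V)\<^esub> p \<in> I" using I_uminus[OF p] by simp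
    qed (use I_poly_ring in \<open>auto simp: I_zero I_add\<close>)
  next
    fix a x :: "('v, 'k) mpoly" assume "a \<in> I" "x \<in> carrier (poly_ring V)"
    then show "x \<otimes>\<^bsub>poly_ring V\<^esub> a \<in> I" "a \<otimes>\<^bsub>poly_ring V\<^esub> x \<in> I"
      using I_mult[of x a] by (simp_all add: mult.commute[of a x])
  qed
qed

text \<open>One inclusion is minimality of the generated ideal. For the other, each term of p is a
  multiple of some \<open>var u * var v\<close>, and p is the sum of its terms.\<close>

lemma edge_ideal_eq_monomial_ideal:
  assumes "\<And>f. f \<in> H \<Longrightarrow> f \<subseteq> V \<and> card f = 2"
  shows "(edge_ideal (V, H) :: ('v, 'k::field) mpoly set) = monomial_ideal V H"
proof
  let ?S = "{var u * var v | u v. {u, v} \<in> H} :: ('v, 'k) mpoly set"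
  interpret R: cring "poly_ring V :: ('v, 'k) mpoly ring" by (rule cring_poly_ring)
  have gen: "var u * var v = (Poly_Mapping.single (sqfree {u, v}) 1 :: ('v, 'k) mpoly)" if "{u, v} \<in> H" for u v
  proof -
    have "u \<noteq> v" using assms[OF that] by auto
    then show ?thesis by (simp add: var_def mult_single sqfree_def)
  qed
  have S: "?S \<subseteq> monomial_ideal V H"
  proof
    fix x assume "x \<in> ?S"
    then obtain u v where uv: "{u, v} \<in> H" "x = var u * var v" by blast
    then show "x \<in> monomial_ideal V H"
      using assms[OF uv(1)] by (auto simp: gen monomial_ideal_def in_poly_ring_iff)
  qed
  then show "edge_ideal (V, H) \<subseteq> (monomial_ideal V H :: ('v, 'k) mpoly set)"
    unfolding edge_ideal_def fst_conv snd_conv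
    by (intro R.genideal_minimal ideal_poly_ringI homogeneous_ideal_monomial_ideal)
  have "?S \<subseteq> carrier (poly_ring V)" using S by (auto simp: monomial_ideal_def)
  then have J: "ideal (edge_ideal (V, H)) (poly_ring V :: ('v, 'k) mpoly ring)" "?S \<subseteq> edge_ideal (V, H)"
    unfolding edge_ideal_def fst_conv snd_conv by (rule R.genideal_ideal, rule R.genideal_self)
  interpret J: ideal "edge_ideal (V, H)" "poly_ring V :: ('v, 'k) mpoly ring" by (rule J(1))
  show "monomial_ideal V H \<subseteq> (edge_ideal (V, H) :: ('v, 'k) mpoly set)"
  proof
    fix p :: "('v, 'k) mpoly" assume p: "p \<in> monomial_ideal V H"
    have "Poly_Mapping.single m (Poly_Mapping.lookup p m) \<in> edge_ideal (V, H)" if m: "m \<in> Poly_Mapping.keys p" for m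
    proof -
      obtain f where f: "f \<in> H" "f \<subseteq> Poly_Mapping.keys m" using p m by (auto simp: monomial_ideal_def)
      then obtain u v where uv: "f = {u, v}" using assms by (meson card_2_iff)
      let ?q = "Poly_Mapping.single (m - sqfree f) (Poly_Mapping.lookup p m)"
      have "Poly_Mapping.keys m \<subseteq> V" using p m by (auto simp: monomial_ideal_def in_poly_ring_iff)
      then have "?q \<in> carrier (poly_ring V)"
        using keys_diff_subset[of m "sqfree f"] by (auto simp: in_poly_ring_iff)
      moreover have "(var u * var v :: ('v, 'k) mpoly) \<in> edge_ideal (V, H)"
      proof (rule subsetD[OF J(2)])
        show "var u * var v \<in> ?S" using f(1) uv by (intro CollectI exI[of _ u] exI[of _ v]) simp
      qed
      ultimately have "?q * (var u * var v) \<in> edge_ideal (V, H)"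
        using J.I_l_closed[of "var u * var v" ?q] by simp
      moreover have "?q * (var u * var v) = Poly_Mapping.single m (Poly_Mapping.lookup p m)"
        using f uv gen diff_sqfree_add[of f m] by (simp add: mult_single)
      ultimately show ?thesis by simp
    qed
    note single = this
    have "(\<Sum>m\<in>A. Poly_Mapping.single m (Poly_Mapping.lookup p m)) \<in> edge_ideal (V, H)"
      if "finite A" "A \<subseteq> Poly_Mapping.keys p" for A
      using that
    proof (induction A rule: finite_induct)
      case empty
      then show ?case using J.zero_closed by simp
    next
      case (insert m A)
      then show ?case using J.a_closed[OF single[of m]] by simp
    qed
    from this[OF finite_keys order_refl] show "p \<in> edge_ideal (V, H)" by (simp only: sum_single_keys)
  qed
qed

section \<open>The quotient module in terms of representatives\<close>

context homogeneous_ideal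
begin

abbreviation coset :: "('v, 'k) mpoly \<Rightarrow> ('v, 'k) mpoly set" where
  "coset p \<equiv> I +>\<^bsub>poly_ring V\<^esub> p"

abbreviation quot :: "(('v, 'k) mpoly, ('v, 'k) mpoly set) module" where
  "quot \<equiv> quotient_module (poly_ring V) I"

lemma is_homogeneous_ideal: "homogeneous_ideal V I" ..

lemma coset_eq_iff:
  assumes "p \<in> carrier (poly_ring V)" "q \<in> carrier (poly_ring V)"
  shows "coset p = coset q \<longleftrightarrow> p - q \<in> I"
proof -
  interpret R: cring "poly_ring V :: ('v, 'k) mpoly ring" by (rule cring_poly_ring)
  have "\<ominus>\<^bsub>poly_ring V\<^esub> q = - q"
    using assms(2) by (intro R.minus_equality) auto
  then have "p \<ominus>\<^bsub>poly_ring V\<^esub> q = p - q" by (simp add: a_minus_def)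
  then show ?thesis
    using R.quotient_eq_iff_same_a_r_cos[OF ideal_poly_ringI[OF is_homogeneous_ideal] assms] by simp
qed

lemma coset_zero: "coset 0 = I"
proof -
  interpret R: cring "poly_ring V :: ('v, 'k) mpoly ring" by (rule cring_poly_ring)
  show ?thesis using R.a_coset_add_zero[OF I_poly_ring] by simp
qed

lemma carrier_quot: "carrier quot = coset ` carrier (poly_ring V)"
  by (auto simp: quotient_module_def FactRing_def A_RCOSETS_def')

lemma zero_quot: "\<zero>\<^bsub>quot\<^esub> = coset 0"
  by (simp add: quotient_module_def FactRing_def coset_zero)

lemma add_quot:
  assumes "p \<in> carrier (poly_ring V)" "q \<in> carrier (poly_ring V)"
  shows "coset p \<oplus>\<^bsub>quot\<^esub> coset q = coset (p + q)"
proof -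
  interpret J: ideal I "poly_ring V" by (rule ideal_poly_ringI[OF is_homogeneous_ideal])
  show ?thesis using J.a_rcos_sum[OF assms] by (simp add: quotient_module_def FactRing_def)
qed

lemma smult_quot:
  assumes "p \<in> carrier (poly_ring V)" "q \<in> carrier (poly_ring V)"
  shows "p \<odot>\<^bsub>quot\<^esub> coset q = coset (p * q)"
proof -
  interpret J: ideal I "poly_ring V" by (rule ideal_poly_ringI[OF is_homogeneous_ideal])
  show ?thesis using J.rcoset_mult_add[OF assms] by (simp add: quotient_module_def FactRing_def)
qed

text \<open>The augmentation is a \<open>finsum\<close>; evaluating it rests on these laws for the
  addition of cosets.\<close>

lemma abelian_monoid_quot: "abelian_monoid quot"
proof (rule abelian_monoidI)
  fix X Y Z assume X: "X \<in> carrier quot"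
  then obtain p where p: "p \<in> carrier (poly_ring V)" "X = coset p" by (auto simp: carrier_quot)
  then show "\<zero>\<^bsub>quot\<^esub> \<oplus>\<^bsub>quot\<^esub> X = X" by (simp add: zero_quot add_quot)
  assume Y: "Y \<in> carrier quot"
  then obtain q where q: "q \<in> carrier (poly_ring V)" "Y = coset q" by (auto simp: carrier_quot)
  then show "X \<oplus>\<^bsub>quot\<^esub> Y \<in> carrier quot" using p by (auto simp: add_quot carrier_quot)
  show "X \<oplus>\<^bsub>quot\<^esub> Y = Y \<oplus>\<^bsub>quot\<^esub> X" using p q by (simp add: add_quot add.commute)
  assume Z: "Z \<in> carrier quot"
  then obtain r where r: "r \<in> carrier (poly_ring V)" "Z = coset r" by (auto simp: carrier_quot)
  then show "X \<oplus>\<^bsub>quot\<^esub> Y \<oplus>\<^bsub>quot\<^esub> Z = X \<oplus>\<^bsub>quot\<^esub> (Y \<oplus>\<^bsub>quot\<^esub> Z)"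
    using p q by (simp add: add_quot poly_ring_add add.assoc)
qed (auto simp: zero_quot carrier_quot)

lemma finsum_quot:
  fixes n :: nat
  assumes "\<And>l. l < n \<Longrightarrow> f l \<in> carrier (poly_ring V)" "\<And>l. l < n \<Longrightarrow> X l = coset (f l)"
  shows "finsum quot X {..<n} = coset (\<Sum>l<n. f l)"
  using assms
proof (induction n)
  case 0
  interpret abelian_monoid quot by (rule abelian_monoid_quot)
  show ?case by (simp add: zero_quot)
next
  case (Suc n)
  interpret abelian_monoid quot by (rule abelian_monoid_quot)
  have "finsum quot X {..<Suc n} = X n \<oplus>\<^bsub>quot\<^esub> finsum quot X {..<n}"
    unfolding lessThan_Suc using Suc.prems by (intro finsum_insert) (auto simp: carrier_quot)
  also have "\<dots> = coset (f n + (\<Sum>l<n. f l))"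
    using Suc.prems(1) Suc.prems(2)[of n] Suc.IH[OF Suc.prems] by (subst add_quot[symmetric]) auto
  finally show ?case by (simp add: add.commute)
qed

lemma augmentation_quot:
  assumes "\<And>l. l < rank F 0 \<Longrightarrow> g l \<in> carrier (poly_ring V)" "\<And>l. l < rank F 0 \<Longrightarrow> gen F l = coset (g l)"
    and "c \<in> free_part V F 0"
  shows "augmentation quot F c = coset (cover F g c)"
  unfolding augmentation_def cover_def
  using assms by (intro finsum_quot) (auto simp: smult_quot free_part_def)

text \<open>The two notions differ only at the augmentation, whose image and kernel are translated
  into congruences modulo I.\<close>

lemma graded_free_resolution_iff_resolves:
  fixes F :: "('v, 'k, ('v, 'k) mpoly set) free_complex"
  assumes g: "\<And>l. l < rank F 0 \<Longrightarrow> g l \<in> homogeneous V (shift F 0 l)" "\<And>l. l < rank F 0 \<Longrightarrow> gen F l = coset (g l)"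
  shows "graded_free_resolution V quot (quotient_grading V I) F \<longleftrightarrow> resolves V I F g"
proof -
  have gp: "l < rank F 0 \<Longrightarrow> g l \<in> carrier (poly_ring V)" for l using g(1) homogeneous_poly_ring by blast
  have aug: "augmentation quot F c = coset (cover F g c)" if "c \<in> free_part V F 0" for c
    using augmentation_quot[OF gp g(2) that] by blast
  have cov: "cover F g c \<in> carrier (poly_ring V)" if "c \<in> free_part V F 0" for c
    using that gp unfolding cover_def free_part_def by auto
  have "augmentation quot F ` free_part V F 0 = carrier quot \<longleftrightarrow>
      (\<forall>p \<in> carrier (poly_ring V). \<exists>c \<in> free_part V F 0. cover F g c - p \<in> I)"
  proof
    assume L: "augmentation quot F ` free_part V F 0 = carrier quot"
    show "\<forall>p \<in> carrier (poly_ring V). \<exists>c \<in> free_part V F 0. cover F g c - p \<in> I"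
    proof
      fix p :: "('v, 'k) mpoly" assume p: "p \<in> carrier (poly_ring V)"
      then have "coset p \<in> augmentation quot F ` free_part V F 0" using L by (simp add: carrier_quot)
      then obtain c where "c \<in> free_part V F 0" "coset p = coset (cover F g c)" using aug by auto
      then show "\<exists>c \<in> free_part V F 0. cover F g c - p \<in> I"
        using coset_eq_iff[OF cov p] by metis
    qed
  next
    assume R: "\<forall>p \<in> carrier (poly_ring V). \<exists>c \<in> free_part V F 0. cover F g c - p \<in> I"
    show "augmentation quot F ` free_part V F 0 = carrier quot"
    proof (intro equalityI subsetI)
      fix X assume "X \<in> augmentation quot F ` free_part V F 0"
      then show "X \<in> carrier quot" using aug cov by (auto simp: carrier_quot)
    next
      fix X assume "X \<in> carrier quot"
      then obtain p where p: "p \<in> carrier (poly_ring V)" "X = coset p" by (auto simp: carrier_quot)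
      then obtain c where c: "c \<in> free_part V F 0" "cover F g c - p \<in> I" using R by blast
      then have "coset (cover F g c) = coset p" using coset_eq_iff[OF cov p(1)] by simp
      then have "X = augmentation quot F c" using aug[OF c(1)] p by simp
      then show "X \<in> augmentation quot F ` free_part V F 0" using c(1) by simp
    qed
  qed
  moreover have "{c \<in> free_part V F 0. augmentation quot F c = \<zero>\<^bsub>quot\<^esub>} = {c \<in> free_part V F 0. cover F g c \<in> I}"
    using aug coset_eq_iff[OF cov poly_ring_zero] by (auto simp: zero_quot)
  moreover have "\<forall>l<rank F 0. gen F l \<in> quotient_grading V I (shift F 0 l)"
    using g by (simp add: quotient_grading_def)
  ultimately show ?thesis
    unfolding graded_free_resolution_def resolves_def using g(1) by simp
qed

lemma graded_free_resolution_resolves: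
  fixes F :: "('v, 'k, ('v, 'k) mpoly set) free_complex"
  assumes "graded_free_resolution V quot (quotient_grading V I) F"
  obtains g where "resolves V I F g"
proof -
  have "\<forall>l. \<exists>p. l < rank F 0 \<longrightarrow> p \<in> homogeneous V (shift F 0 l) \<and> gen F l = coset p"
    using assms by (auto simp: graded_free_resolution_def quotient_grading_def)
  then obtain g where "\<And>l. l < rank F 0 \<Longrightarrow> g l \<in> homogeneous V (shift F 0 l)"
    "\<And>l. l < rank F 0 \<Longrightarrow> gen F l = coset (g l)" by metis
  then show thesis using graded_free_resolution_iff_resolves assms that by blast
qed

text \<open>F itself witnesses that \<open>SOME\<close> picks a genuine resolution. Transfer between
  the picked one and F in both directions then allows \<open>Tor\<close> to be read off from
  F.\<close>

lemma Tor_nonzero_iff: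
  fixes F :: "('v, 'k, ('v, 'k) mpoly set) free_complex"
  assumes "resolves V I F g" "\<And>l. l < rank F 0 \<Longrightarrow> gen F l = coset (g l)"
  shows "Tor_nonzero V quot (quotient_grading V I) i j \<longleftrightarrow> tensor_cycles F i j \<noteq> tensor_boundaries F i j"
proof -
  have "graded_free_resolution V quot (quotient_grading V I) F"
    using graded_free_resolution_iff_resolves[OF resolves_gen[OF assms(1)] assms(2)] assms(1) by blast
  then have "graded_free_resolution V quot (quotient_grading V I) (SOME F. graded_free_resolution V quot (quotient_grading V I) F)"
    by (rule someI)
  then obtain g' where "resolves V I (SOME F. graded_free_resolution V quot (quotient_grading V I) F) g'"
    by (rule graded_free_resolution_resolves)
  then show ?thesis
    unfolding Tor_nonzero_def Let_def
    using tensor_homology_transfer assms(1) by metis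
qed

end

section \<open>The Taylor resolution\<close>

lemma lookup_single_zero_mult:
  "Poly_Mapping.lookup (Poly_Mapping.single 0 a * p) m = a * Poly_Mapping.lookup (p :: ('v, 'k::field) mpoly) m"
proof -
  have "Poly_Mapping.single 0 a * p = Poly_Mapping.map ((*) a) p" by (simp add: mult_map_scale_conv_mult)
  then show ?thesis by (simp add: map.rep_eq when_def)
qed

lemma lookup_mult_single_one:
  "Poly_Mapping.lookup (p * Poly_Mapping.single t 1) (m + t) = Poly_Mapping.lookup (p :: ('v, 'k::field) mpoly) m"
proof -
  have "p * Poly_Mapping.single t 1 = (\<Sum>k\<in>Poly_Mapping.keys p. Poly_Mapping.single (k + t) (Poly_Mapping.lookup p k))"
    by (subst (1) sum_single_keys[of p, symmetric]) (simp add: sum_distrib_right mult_single)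
  then show ?thesis by (auto simp: lookup_sum lookup_single when_def sum.delta in_keys_iff)
qed

lemma mult_single_one_cancel:
  assumes "p * Poly_Mapping.single t 1 = q * Poly_Mapping.single t (1 :: 'k::field)"
  shows "p = (q :: ('v, 'k) mpoly)"
  by (rule poly_mapping_eqI) (metis assms lookup_mult_single_one)

locale taylor =
  fixes V :: "'v set" and N :: nat and s :: "nat \<Rightarrow> 'v set"
  assumes finite_s: "e < N \<Longrightarrow> finite (s e)" and s_V: "e < N \<Longrightarrow> s e \<subseteq> V"
begin

abbreviation supp :: "nat set \<Rightarrow> 'v set" where
  "supp \<sigma> \<equiv> \<Union> (s ` \<sigma>)"

text \<open>With empty supports and U = {} no face is dropped, so the strand is the chain complex of
  the full simplex.\<close>

abbreviation no_gens :: "nat \<Rightarrow> 'v set" where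
  "no_gens \<equiv> \<lambda>_. {}"

definition faces :: "nat \<Rightarrow> nat set set" where
  "faces i = {\<sigma>. \<sigma> \<subseteq> {..<N} \<and> card \<sigma> = i}"

text \<open>A \<open>free_complex\<close> numbers its basis elements, so the faces of each size are
  enumerated in some fixed way; \<open>index\<close> is the inverse.\<close>

definition face :: "nat \<Rightarrow> nat \<Rightarrow> nat set" where
  "face i = (SOME f. bij_betw f {..<card (faces i)} (faces i))"

definition index :: "nat \<Rightarrow> nat set \<Rightarrow> nat" where
  "index i = inv_into {..<card (faces i)} (face i)"

text \<open>A face stands for the least common multiple of its generators, whose support is their
  union. The entry to a facet is, up to sign, the quotient of the two least common multiples;
  \<open>the_elem\<close> names the generator left out.\<close>

definition taylor :: "('v, 'k::field, ('v, 'k) mpoly set) free_complex" where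
  "taylor = \<lparr>rank = \<lambda>i. card (faces i), shift = \<lambda>i l. int (card (supp (face i l))),
     diff_coeff = \<lambda>i l' l. if face i l \<subset> face (Suc i) l'
        then Poly_Mapping.single (sqfree (supp (face (Suc i) l') - supp (face i l)))
               (pos_sign (the_elem (face (Suc i) l' - face i l)) (face i l))
        else 0,
     gen = \<lambda>_. monomial_ideal V (s ` {..<N}) +>\<^bsub>poly_ring V\<^esub> 1\<rparr>"

lemma finite_faces: "finite (faces i)"
  by (rule finite_subset[of _ "Pow {..<N}"]) (auto simp: faces_def)

lemma bij_face: "bij_betw (face i) {..<card (faces i)} (faces i)"
proof -
  have "\<exists>f. bij_betw f {..<card (faces i)} (faces i)"
    using ex_bij_betw_nat_finite[OF finite_faces] by (simp add: lessThan_atLeast0)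
  then show ?thesis unfolding face_def by (rule someI_ex)
qed

lemma face_in [simp]: "l < card (faces i) \<Longrightarrow> face i l \<in> faces i"
  using bij_face by (auto simp: bij_betw_def)

lemma index_less [simp]: "\<sigma> \<in> faces i \<Longrightarrow> index i \<sigma> < card (faces i)"
  unfolding index_def using bij_face[of i] inv_into_into[of \<sigma> "face i" "{..<card (faces i)}"]
  by (auto simp: bij_betw_def)

lemma face_index [simp]: "\<sigma> \<in> faces i \<Longrightarrow> face i (index i \<sigma>) = \<sigma>"
  unfolding index_def using bij_betw_inv_into_right[OF bij_face] by simp

lemma index_face [simp]: "l < card (faces i) \<Longrightarrow> index i (face i l) = l"
  unfolding index_def using bij_betw_inv_into_left[OF bij_face] by simp

lemma sum_faces: "(\<Sum>l<card (faces i). f l) = (\<Sum>\<sigma>\<in>faces i. f (index i \<sigma>))"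
proof -
  have "(\<Sum>l<card (faces i). f l) = (\<Sum>l<card (faces i). f (index i (face i l)))"
    by (intro sum.cong) auto
  also have "\<dots> = (\<Sum>\<sigma>\<in>faces i. f (index i \<sigma>))"
    using sum.reindex_bij_betw[OF bij_face, of "\<lambda>\<sigma>. f (index i \<sigma>)" i] .
  finally show ?thesis .
qed

lemma faces_finite: "\<sigma> \<in> faces i \<Longrightarrow> finite \<sigma>"
  by (auto simp: faces_def finite_subset)

lemma finite_supp: "\<sigma> \<subseteq> {..<N} \<Longrightarrow> finite (supp \<sigma>)"
  using finite_s finite_subset[of \<sigma> "{..<N}"] by auto

lemma supp_V: "\<sigma> \<subseteq> {..<N} \<Longrightarrow> supp \<sigma> \<subseteq> V"
  using s_V by (meson UN_least lessThan_iff subsetD)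

lemma insert_face: "\<tau> \<in> faces i \<Longrightarrow> e \<in> {..<N} - \<tau> \<Longrightarrow> insert e \<tau> \<in> faces (Suc i)"
  using faces_finite[of \<tau> i] by (auto simp: faces_def)

lemma cofaces:
  assumes "\<tau> \<in> faces i"
  shows "{\<sigma> \<in> faces (Suc i). \<tau> \<subset> \<sigma>} = (\<lambda>e. insert e \<tau>) ` ({..<N} - \<tau>)"
proof
  show "(\<lambda>e. insert e \<tau>) ` ({..<N} - \<tau>) \<subseteq> {\<sigma> \<in> faces (Suc i). \<tau> \<subset> \<sigma>}"
  proof
    fix \<sigma> assume "\<sigma> \<in> (\<lambda>e. insert e \<tau>) ` ({..<N} - \<tau>)"
    then obtain e where e: "e \<in> {..<N} - \<tau>" "\<sigma> = insert e \<tau>" by auto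
    then show "\<sigma> \<in> {\<sigma> \<in> faces (Suc i). \<tau> \<subset> \<sigma>}" using insert_face[OF assms e(1)] by auto
  qed
  show "{\<sigma> \<in> faces (Suc i). \<tau> \<subset> \<sigma>} \<subseteq> (\<lambda>e. insert e \<tau>) ` ({..<N} - \<tau>)"
  proof
    fix \<sigma> assume "\<sigma> \<in> {\<sigma> \<in> faces (Suc i). \<tau> \<subset> \<sigma>}"
    then have \<sigma>: "\<sigma> \<subseteq> {..<N}" "card \<sigma> = Suc i" "\<tau> \<subset> \<sigma>" "finite \<sigma>" using faces_finite[of \<sigma> "Suc i"] by (auto simp: faces_def)
    from \<sigma>(3) obtain e where e: "e \<in> \<sigma>" "e \<notin> \<tau>" by (auto simp: psubset_eq)
    have "card (insert e \<tau>) = card \<sigma>" using assms e \<sigma> faces_finite[OF assms] by (simp add: faces_def)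
    then have "insert e \<tau> = \<sigma>" using e \<sigma> by (intro card_subset_eq) auto
    then show "\<sigma> \<in> (\<lambda>e. insert e \<tau>) ` ({..<N} - \<tau>)" using e \<sigma> by auto
  qed
qed

lemma sum_cofaces:
  assumes "\<tau> \<in> faces i"
  shows "(\<Sum>l<card (faces (Suc i)). if \<tau> \<subset> face (Suc i) l then f l else 0) =
     (\<Sum>e\<in>{..<N} - \<tau>. f (index (Suc i) (insert e \<tau>)))"
proof -
  have "(\<Sum>l<card (faces (Suc i)). if \<tau> \<subset> face (Suc i) l then f l else 0) =
      (\<Sum>\<sigma>\<in>faces (Suc i). if \<tau> \<subset> \<sigma> then f (index (Suc i) \<sigma>) else 0)"
    unfolding sum_faces by (intro sum.cong) auto
  also have "\<dots> = (\<Sum>\<sigma>\<in>{\<sigma> \<in> faces (Suc i). \<tau> \<subset> \<sigma>}. f (index (Suc i) \<sigma>))"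
    using finite_faces by (simp add: sum.inter_filter)
  also have "\<dots> = (\<Sum>e\<in>{..<N} - \<tau>. f (index (Suc i) (insert e \<tau>)))"
    unfolding cofaces[OF assms] by (subst sum.reindex) (auto simp: inj_on_def)
  finally show ?thesis .
qed

lemma rank_taylor [simp]: "rank taylor i = card (faces i)"
  by (simp add: taylor_def)

lemma diff_coeff_taylor:
  assumes "\<tau> \<in> faces i" "e \<in> {..<N} - \<tau>"
  shows "diff_coeff taylor i (index (Suc i) (insert e \<tau>)) (index i \<tau>) =
     Poly_Mapping.single (sqfree (supp (insert e \<tau>) - supp \<tau>)) (pos_sign e \<tau>)"
proof -
  have "insert e \<tau> - \<tau> = {e}" "\<tau> \<subset> insert e \<tau>" using assms(2) by auto
  then show ?thesis using assms insert_face[OF assms] by (simp add: taylor_def)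
qed

lemma diff_coeff_taylor_zero:
  "\<not> face i l \<subset> face (Suc i) l' \<Longrightarrow> diff_coeff taylor i l' l = 0"
  by (simp add: taylor_def)

lemma differential_taylor:
  assumes "\<tau> \<in> faces i"
  shows "differential taylor i c (index i \<tau>) =
     (\<Sum>e\<in>{..<N} - \<tau>. c (index (Suc i) (insert e \<tau>)) *
        Poly_Mapping.single (sqfree (supp (insert e \<tau>) - supp \<tau>)) (pos_sign e \<tau>))"
proof -
  have "differential taylor i c (index i \<tau>) =
      (\<Sum>l<card (faces (Suc i)). if \<tau> \<subset> face (Suc i) l then c l * diff_coeff taylor i l (index i \<tau>) else 0)"
    using assms by (auto simp: differential_def diff_coeff_taylor_zero intro!: sum.cong)
  then show ?thesis by (simp add: sum_cofaces[OF assms] diff_coeff_taylor[OF assms])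
qed

text \<open>An entry has a constant term exactly when its monomial is 1, that is, when the adjoined
  generator does not enlarge the union.\<close>

lemma tensor_differential_taylor:
  assumes "\<tau> \<in> faces i"
  shows "tensor_differential taylor i x (index i \<tau>) =
     (\<Sum>e\<in>{..<N} - \<tau>. if supp (insert e \<tau>) = supp \<tau> then pos_sign e \<tau> * x (index (Suc i) (insert e \<tau>)) else 0)"
proof -
  let ?d = "\<lambda>l. Poly_Mapping.lookup (diff_coeff taylor i l (index i \<tau>)) 0"
  have "tensor_differential taylor i x (index i \<tau>) =
      (\<Sum>l<card (faces (Suc i)). if \<tau> \<subset> face (Suc i) l then x l * ?d l else 0)"
    using assms by (auto simp: tensor_differential_def diff_coeff_taylor_zero intro!: sum.cong)
  also have "\<dots> = (\<Sum>e\<in>{..<N} - \<tau>. x (index (Suc i) (insert e \<tau>)) * ?d (index (Suc i) (insert e \<tau>)))"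
    by (rule sum_cofaces[OF assms])
  also have "\<dots> = (\<Sum>e\<in>{..<N} - \<tau>. if supp (insert e \<tau>) = supp \<tau> then pos_sign e \<tau> * x (index (Suc i) (insert e \<tau>)) else 0)"
  proof (rule sum.cong)
    fix e assume e: "e \<in> {..<N} - \<tau>"
    then have "finite (s e)" "supp (insert e \<tau>) - supp \<tau> \<subseteq> s e" using finite_s by auto
    then have "finite (supp (insert e \<tau>) - supp \<tau>)" by (rule finite_subset[rotated])
    then have "sqfree (supp (insert e \<tau>) - supp \<tau>) = 0 \<longleftrightarrow> supp (insert e \<tau>) = supp \<tau>"
      by (auto simp: sqfree_eq_zero_iff)
    then show "x (index (Suc i) (insert e \<tau>)) * ?d (index (Suc i) (insert e \<tau>)) =
        (if supp (insert e \<tau>) = supp \<tau> then pos_sign e \<tau> * x (index (Suc i) (insert e \<tau>)) else 0)"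
      unfolding diff_coeff_taylor[OF assms e] lookup_single when_def by (simp add: mult.commute)
  qed simp
  finally show ?thesis .
qed

text \<open>The coefficient of the multidegree \<open>m\<close> in a vector, as a chain of the full simplex on the
  generators dividing \<open>m\<close>.\<close>

definition part_chain :: "nat \<Rightarrow> (nat \<Rightarrow> ('v, 'k::field) mpoly) \<Rightarrow> ('v \<Rightarrow>\<^sub>0 nat) \<Rightarrow> nat set \<Rightarrow> 'k" where
  "part_chain i c m \<sigma> =
     (if \<sigma> \<in> faces i then Poly_Mapping.lookup (c (index i \<sigma>) * Poly_Mapping.single (sqfree (supp \<sigma>)) 1) m else 0)"

definition dividing :: "('v \<Rightarrow>\<^sub>0 nat) \<Rightarrow> nat set" where
  "dividing m = {e. e < N \<and> s e \<subseteq> Poly_Mapping.keys m}"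

lemma finite_dividing: "finite (dividing m)"
  by (rule finite_subset[of _ "{..<N}"]) (auto simp: dividing_def)

lemma part_chain_nonzero:
  assumes "part_chain i c m \<sigma> \<noteq> 0"
  shows "\<sigma> \<subseteq> dividing m" "card \<sigma> = i" "\<sigma> \<in> faces i"
    "m \<in> Poly_Mapping.keys (c (index i \<sigma>) * Poly_Mapping.single (sqfree (supp \<sigma>)) 1)"
proof -
  show \<sigma>: "\<sigma> \<in> faces i" using assms by (auto simp: part_chain_def split: if_splits)
  show m: "m \<in> Poly_Mapping.keys (c (index i \<sigma>) * Poly_Mapping.single (sqfree (supp \<sigma>)) 1)"
    using assms by (auto simp: part_chain_def in_keys_iff split: if_splits)
  then obtain a where "m = a + sqfree (supp \<sigma>)" by (rule keys_multE) auto
  moreover have "finite (supp \<sigma>)" using \<sigma> by (intro finite_supp) (auto simp: faces_def)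
  ultimately have "supp \<sigma> \<subseteq> Poly_Mapping.keys m" by (simp add: keys_add_nat)
  then show "\<sigma> \<subseteq> dividing m" using \<sigma> by (auto simp: dividing_def faces_def)
  show "card \<sigma> = i" using \<sigma> by (simp add: faces_def)
qed

lemma part_chain_chains: "part_chain i c m \<in> chains (dividing m) no_gens {} i"
  unfolding chains_def mem_Collect_eq
proof (intro allI impI)
  fix \<sigma> assume nz: "part_chain i c m \<sigma> \<noteq> 0"
  show "\<sigma> \<subseteq> dividing m \<and> card \<sigma> = i \<and> \<Union> ((\<lambda>_. {}) ` \<sigma>) = {}"
    using part_chain_nonzero(1,2)[OF nz] by simp
qed

text \<open>Multiplying the coordinate at each face by the monomial of its support turns the entries
  of the differential into mere signs, so in each multidegree it is the simplicial boundary.\<close>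

lemma part_chain_differential:
  assumes "\<tau> \<in> faces i"
  shows "part_chain i (differential taylor i c) m \<tau> = boundary {..<N} (part_chain (Suc i) c m) \<tau>"
proof -
  have "differential taylor i c (index i \<tau>) * Poly_Mapping.single (sqfree (supp \<tau>)) 1 =
      (\<Sum>e\<in>{..<N} - \<tau>. Poly_Mapping.single 0 (pos_sign e \<tau>) *
         (c (index (Suc i) (insert e \<tau>)) * Poly_Mapping.single (sqfree (supp (insert e \<tau>))) 1))"
    unfolding differential_taylor[OF assms] sum_distrib_right
  proof (rule sum.cong)
    fix e assume e: "e \<in> {..<N} - \<tau>"
    have "insert e \<tau> \<subseteq> {..<N}" using assms e by (auto simp: faces_def)
    then have "sqfree (supp (insert e \<tau>) - supp \<tau>) + sqfree (supp \<tau>) = sqfree (supp (insert e \<tau>))"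
      by (intro sqfree_diff_add finite_supp) auto
    then have "Poly_Mapping.single (sqfree (supp (insert e \<tau>) - supp \<tau>)) (pos_sign e \<tau>) * Poly_Mapping.single (sqfree (supp \<tau>)) 1 =
        (Poly_Mapping.single 0 (pos_sign e \<tau>) * Poly_Mapping.single (sqfree (supp (insert e \<tau>))) 1 :: ('v, 'a) mpoly)"
      by (simp add: mult_single)
    then show "c (index (Suc i) (insert e \<tau>)) * Poly_Mapping.single (sqfree (supp (insert e \<tau>) - supp \<tau>)) (pos_sign e \<tau>) *
          Poly_Mapping.single (sqfree (supp \<tau>)) 1 =
        Poly_Mapping.single 0 (pos_sign e \<tau>) *
          (c (index (Suc i) (insert e \<tau>)) * Poly_Mapping.single (sqfree (supp (insert e \<tau>))) 1)"
      by (metis (no_types, lifting) mult.assoc mult.left_commute)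
  qed simp
  then show ?thesis
    using assms insert_face[OF assms]
    by (simp add: part_chain_def boundary_def lookup_sum lookup_single_zero_mult)
qed

text \<open>Multiplication by a monomial is injective, so the multigraded parts determine a
  vector.\<close>

lemma part_chain_eqI:
  assumes "c \<in> free_part V taylor i" "d \<in> free_part V taylor i"
    and "\<And>m \<sigma>. \<sigma> \<in> faces i \<Longrightarrow> part_chain i c m \<sigma> = part_chain i d m \<sigma>"
  shows "c = d"
proof
  fix l
  show "c l = d l"
  proof (cases "l < card (faces i)")
    case True
    have "c l * Poly_Mapping.single (sqfree (supp (face i l))) 1 = d l * Poly_Mapping.single (sqfree (supp (face i l))) 1"
      using assms(3)[OF face_in[OF True]] True by (intro poly_mapping_eqI) (simp add: part_chain_def)
    then show ?thesis by (rule mult_single_one_cancel)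
  next
    case False
    then show ?thesis using assms(1,2) by (simp add: free_part_def)
  qed
qed

lemma boundary_dividing:
  assumes "c \<in> chains (dividing m) no_gens {} i"
  shows "boundary {..<N} c \<tau> = boundary (dividing m) c \<tau>"
proof -
  have "c (insert e \<tau>) = 0" if "e \<notin> dividing m" for e
    using that by (intro chains_zeroI[OF assms]) auto
  then show ?thesis
    unfolding boundary_def by (intro sum.mono_neutral_right) (auto simp: dividing_def)
qed

lemma boundary_outside_dividing:
  assumes "c \<in> chains (dividing m) no_gens {} i" "\<not> \<tau> \<subseteq> dividing m"
  shows "boundary E c \<tau> = 0"
proof -
  have "c (insert e \<tau>) = 0" for e
    using assms(2) by (intro chains_zeroI[OF assms(1)]) auto
  then show ?thesis by (simp add: boundary_def)
qed

lemma differential_free_part: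
  assumes "y \<in> free_part V taylor (Suc i)"
  shows "differential taylor i y \<in> free_part V taylor i"
proof -
  have "differential taylor i y l \<in> carrier (poly_ring V)" if l: "l < card (faces i)" for l
  proof -
    have "differential taylor i y (index i (face i l)) \<in> carrier (poly_ring V)"
      unfolding differential_taylor[OF face_in[OF l]]
    proof (intro poly_ring_sum poly_ring_mult)
      fix e assume e: "e \<in> {..<N} - face i l"
      then have "index (Suc i) (insert e (face i l)) < card (faces (Suc i))"
        using insert_face[OF face_in[OF l]] by simp
      then show "y (index (Suc i) (insert e (face i l))) \<in> carrier (poly_ring V)"
        using assms by (simp add: free_part_def)
      have "insert e (face i l) \<subseteq> {..<N}" using e face_in[OF l] by (auto simp: faces_def)
      then have "finite (supp (insert e (face i l)))" "supp (insert e (face i l)) \<subseteq> V"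
        by (rule finite_supp, rule supp_V)
      then show "Poly_Mapping.single (sqfree (supp (insert e (face i l)) - supp (face i l))) (pos_sign e (face i l)) \<in> carrier (poly_ring V)"
        by (auto simp: in_poly_ring_iff)
    qed
    then show ?thesis using l by simp
  qed
  then show ?thesis by (simp add: free_part_def) (simp add: differential_def)
qed

text \<open>In multidegree m the vector lives on the full simplex over the generators dividing m,
  which is contractible once there is such a generator. The preimages in the separate multidegrees
  are assembled into one vector of polynomials.\<close>

lemma differential_taylor_surj:
  fixes c :: "nat \<Rightarrow> ('v, 'k::field) mpoly"
  assumes c: "c \<in> free_part V taylor i"
    and div: "\<And>m \<sigma>. part_chain i c m \<sigma> \<noteq> 0 \<Longrightarrow> dividing m \<noteq> {}"
    and cyc: "\<And>m. strand_diff (dividing m) no_gens {} (part_chain i c m) = (\<lambda>_. 0)"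
  shows "\<exists>y \<in> free_part V taylor (Suc i). differential taylor i y = c"
proof -
  \<comment> \<open>Only finitely many multidegrees occur in c; this makes the sum in
    \<open>q\<close> below a polynomial.\<close>
  define A where "A = {m. part_chain i c m \<noteq> (\<lambda>_. 0)}"
  have A: "\<exists>\<sigma>. part_chain i c m \<sigma> \<noteq> 0" if "m \<in> A" for m using that by (auto simp: A_def)
  have "A \<subseteq> (\<Union>\<sigma>\<in>faces i. Poly_Mapping.keys (c (index i \<sigma>) * Poly_Mapping.single (sqfree (supp \<sigma>)) 1))"
  proof
    fix m assume "m \<in> A"
    then obtain \<sigma> where \<sigma>: "part_chain i c m \<sigma> \<noteq> 0" using A by auto
    show "m \<in> (\<Union>\<sigma>\<in>faces i. Poly_Mapping.keys (c (index i \<sigma>) * Poly_Mapping.single (sqfree (supp \<sigma>)) 1))"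
      using part_chain_nonzero(3,4)[OF \<sigma>] by (rule UN_I)
  qed
  then have "finite A" by (rule finite_subset) (simp add: finite_faces)
  have A_V: "Poly_Mapping.keys m \<subseteq> V" if "m \<in> A" for m
  proof -
    obtain \<sigma> where \<sigma>: "part_chain i c m \<sigma> \<noteq> 0" using A[OF \<open>m \<in> A\<close>] by blast
    note nz = part_chain_nonzero[OF \<sigma>]
    have "c (index i \<sigma>) \<in> carrier (poly_ring V)" using c nz(3) by (simp add: free_part_def)
    moreover have "\<sigma> \<subseteq> {..<N}" using nz(3) by (simp add: faces_def)
    then have "Poly_Mapping.single (sqfree (supp \<sigma>)) 1 \<in> carrier (poly_ring V :: ('v, 'k) mpoly ring)"
      using finite_supp supp_V by (simp add: in_poly_ring_iff)
    ultimately show ?thesis using nz(4) poly_ring_mult in_poly_ring_iff by blast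
  qed
  have "\<exists>b. b \<in> chains (dividing m) no_gens {} (Suc i) \<and>
      strand_diff (dividing m) no_gens {} b = part_chain i c m \<and> (m \<notin> A \<longrightarrow> b = (\<lambda>_. 0))" for m
  proof (cases "m \<in> A")
    case True
    then obtain e where "e \<in> dividing m" using A div by blast
    then have "strand_exact TYPE('k) (dividing m) no_gens {} i"
      using finite_dividing by (intro strand_exact_empty_generator) auto
    then obtain b where "b \<in> chains (dividing m) no_gens {} (Suc i)"
      "strand_diff (dividing m) no_gens {} b = part_chain i c m"
      using strand_exactE[OF _ part_chain_chains cyc] by blast
    then show ?thesis using True by auto
  next
    case False
    then have "part_chain i c m = (\<lambda>_. 0)" by (simp add: A_def)
    then show ?thesis
      by (intro exI[of _ "\<lambda>_. 0"]) (auto simp: chains_def strand_diff_def boundary_def)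
  qed
  then obtain b where b: "\<And>m. b m \<in> chains (dividing m) no_gens {} (Suc i)"
    "\<And>m. strand_diff (dividing m) no_gens {} (b m) = part_chain i c m" "\<And>m. m \<notin> A \<Longrightarrow> b m = (\<lambda>_. 0)"
    by metis
  have b_supp: "supp \<sigma> \<subseteq> Poly_Mapping.keys m" "\<sigma> \<in> faces (Suc i)" if "b m \<sigma> \<noteq> 0" for m \<sigma>
  proof -
    have "\<sigma> \<subseteq> dividing m" "card \<sigma> = Suc i" using b(1)[of m] that by (auto simp: chains_def)
    then show "supp \<sigma> \<subseteq> Poly_Mapping.keys m" "\<sigma> \<in> faces (Suc i)" by (auto simp: dividing_def faces_def)
  qed
  \<comment> \<open>Undoes the multiplication by the support monomial in \<open>part_chain\<close>.
    The truncated subtraction of exponents is exact wherever \<open>b m \<sigma>\<close> is nonzero,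
    since the support of \<sigma> then lies in that of m.\<close>
  define q where "q \<sigma> = (\<Sum>m\<in>A. Poly_Mapping.single (m - sqfree (supp \<sigma>)) (b m \<sigma>))" for \<sigma>
  define y where "y l = (if l < card (faces (Suc i)) then q (face (Suc i) l) else 0)" for l
  have q: "q \<sigma> \<in> carrier (poly_ring V)" for \<sigma>
    unfolding q_def
  proof (intro poly_ring_sum)
    fix m assume "m \<in> A"
    then have "Poly_Mapping.keys (m - sqfree (supp \<sigma>)) \<subseteq> V" using A_V keys_diff_subset[of m] by (meson order_trans)
    then show "Poly_Mapping.single (m - sqfree (supp \<sigma>)) (b m \<sigma>) \<in> carrier (poly_ring V)"
      by (simp add: in_poly_ring_iff)
  qed
  then have y: "y \<in> free_part V taylor (Suc i)" by (simp add: y_def free_part_def)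
  have part_y: "part_chain (Suc i) y m = b m" for m
  proof
    fix \<sigma>
    show "part_chain (Suc i) y m \<sigma> = b m \<sigma>"
    proof (cases "\<sigma> \<in> faces (Suc i)")
      case True
      have "q \<sigma> * Poly_Mapping.single (sqfree (supp \<sigma>)) 1 = (\<Sum>m\<in>A. Poly_Mapping.single m (b m \<sigma>))"
        unfolding q_def sum_distrib_right
      proof (rule sum.cong)
        fix m
        have fin: "finite (supp \<sigma>)" using True by (intro finite_supp) (simp add: faces_def)
        show "Poly_Mapping.single (m - sqfree (supp \<sigma>)) (b m \<sigma>) * Poly_Mapping.single (sqfree (supp \<sigma>)) 1 =
            Poly_Mapping.single m (b m \<sigma>)"
          using diff_sqfree_add[OF fin b_supp(1)] by (cases "b m \<sigma> = 0") (auto simp: mult_single)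
      qed simp
      then show ?thesis using True \<open>finite A\<close> b(3)[of m]
        by (auto simp: part_chain_def y_def lookup_sum lookup_single when_def sum.delta)
    next
      case False
      then show ?thesis using b_supp(2) by (auto simp: part_chain_def)
    qed
  qed
  have "differential taylor i y = c"
  proof (rule part_chain_eqI[OF differential_free_part[OF y] c])
    fix m \<tau> assume \<tau>: "\<tau> \<in> faces i"
    have "part_chain i (differential taylor i y) m \<tau> = boundary {..<N} (b m) \<tau>"
      by (simp add: part_chain_differential[OF \<tau>] part_y)
    also have "\<dots> = part_chain i c m \<tau>"
    proof (cases "\<tau> \<subseteq> dividing m")
      case True
      then show ?thesis
        using fun_cong[OF b(2), of m \<tau>] boundary_dividing[OF b(1)] by (simp add: strand_diff_def)
    next
      case False
      then show ?thesis
        using boundary_outside_dividing[OF b(1) False] part_chain_nonzero(1) by metis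
    qed
    finally show "part_chain i (differential taylor i y) m \<tau> = part_chain i c m \<tau>" .
  qed
  then show ?thesis using y by blast
qed

section \<open>Exactness of the Taylor complex\<close>

lemma faces_0: "faces 0 = {{}}"
  by (auto simp: faces_def finite_subset card_eq_0_iff)

lemma face_0 [simp]: "face 0 0 = {}"
  using face_in[of 0 0] by (simp add: faces_0)

lemma index_0 [simp]: "index 0 {} = 0"
  using index_less[of "{}" 0] by (simp add: faces_0)

lemma cover_taylor: "cover taylor (\<lambda>_. 1) c = c 0"
  by (simp add: cover_def faces_0)

lemma part_chain_0: "part_chain 0 c m \<sigma> = (if \<sigma> = {} then Poly_Mapping.lookup (c 0) m else 0)"
  by (simp add: part_chain_def faces_0)

lemma monomial_ideal_iff_dividing:
  "p \<in> monomial_ideal V (s ` {..<N}) \<longleftrightarrow>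
     p \<in> carrier (poly_ring V) \<and> (\<forall>m. Poly_Mapping.lookup p m \<noteq> 0 \<longrightarrow> dividing m \<noteq> {})"
  unfolding monomial_ideal_def dividing_def by (fastforce simp flip: lookup_not_eq_zero_eq_in_keys)

text \<open>A polynomial lies in the monomial ideal exactly when every monomial occurring in it is
  divisible by a generator, which is the condition for lifting it.\<close>

lemma taylor_exact_0:
  "{c \<in> free_part V taylor 0. cover taylor (\<lambda>_. 1) c \<in> (monomial_ideal V (s ` {..<N}) :: ('v, 'k::field) mpoly set)} =
     differential taylor 0 ` free_part V taylor 1"
proof (intro equalityI subsetI)
  fix c :: "nat \<Rightarrow> ('v, 'k) mpoly"
  assume "c \<in> {c \<in> free_part V taylor 0. cover taylor (\<lambda>_. 1) c \<in> monomial_ideal V (s ` {..<N})}"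
  then have c: "c \<in> free_part V taylor 0" "c 0 \<in> monomial_ideal V (s ` {..<N})" by (auto simp: cover_taylor)
  have "\<exists>y \<in> free_part V taylor (Suc 0). differential taylor 0 y = c"
  proof (rule differential_taylor_surj[OF c(1)])
    fix m \<sigma> assume "part_chain 0 c m \<sigma> \<noteq> 0"
    then show "dividing m \<noteq> {}"
      using c(2) by (auto simp: part_chain_0 monomial_ideal_iff_dividing split: if_splits)
  next
    fix m
    show "strand_diff (dividing m) no_gens {} (part_chain 0 c m) = (\<lambda>_. 0)"
      by (auto simp: strand_diff_def boundary_def part_chain_0)
  qed
  then show "c \<in> differential taylor 0 ` free_part V taylor 1" by auto
next
  fix c :: "nat \<Rightarrow> ('v, 'k) mpoly"
  assume "c \<in> differential taylor 0 ` free_part V taylor 1"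
  then obtain y where y: "y \<in> free_part V taylor (Suc 0)" "c = differential taylor 0 y" by auto
  have c: "c \<in> free_part V taylor 0" using differential_free_part[OF y(1)] y(2) by simp
  have "dividing m \<noteq> {}" if "Poly_Mapping.lookup (c 0) m \<noteq> 0" for m
  proof
    assume "dividing m = {}"
    have "part_chain (Suc 0) y m (insert e {}) = 0" for e
      using part_chain_nonzero(1)[of "Suc 0" y m "{e}"] \<open>dividing m = {}\<close> by auto
    then have "boundary {..<N} (part_chain (Suc 0) y m) {} = 0" by (simp add: boundary_def)
    then have "part_chain 0 c m {} = 0"
      using part_chain_differential[of "{}" 0 y m] y(2) by (simp add: faces_0)
    then show False using that by (simp add: part_chain_0)
  qed
  moreover have "c 0 \<in> carrier (poly_ring V)" using c by (simp add: free_part_def faces_0)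
  ultimately show "c \<in> {c \<in> free_part V taylor 0. cover taylor (\<lambda>_. 1) c \<in> monomial_ideal V (s ` {..<N})}"
    using c by (simp add: cover_taylor monomial_ideal_iff_dividing)
qed

lemma taylor_exact_Suc:
  "{c \<in> free_part V taylor (Suc i). differential taylor i c = (\<lambda>_. 0 :: ('v, 'k::field) mpoly)} =
     differential taylor (Suc i) ` free_part V taylor (Suc (Suc i))"
proof (intro equalityI subsetI)
  fix c :: "nat \<Rightarrow> ('v, 'k) mpoly"
  assume "c \<in> {c \<in> free_part V taylor (Suc i). differential taylor i c = (\<lambda>_. 0)}"
  then have c: "c \<in> free_part V taylor (Suc i)" "differential taylor i c = (\<lambda>_. 0)" by auto
  have "\<exists>y \<in> free_part V taylor (Suc (Suc i)). differential taylor (Suc i) y = c"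
  proof (rule differential_taylor_surj[OF c(1)])
    \<comment> \<open>A face with \<open>Suc i\<close> elements is nonempty and consists of
      generators dividing m.\<close>
    fix m \<sigma> assume "part_chain (Suc i) c m \<sigma> \<noteq> 0"
    from part_chain_nonzero(1,2)[OF this] show "dividing m \<noteq> {}" by auto
  next
    fix m
    show "strand_diff (dividing m) no_gens {} (part_chain (Suc i) c m) = (\<lambda>_. 0)"
    proof
      fix \<tau>
      show "strand_diff (dividing m) no_gens {} (part_chain (Suc i) c m) \<tau> = 0"
      proof (cases "\<tau> \<subseteq> dividing m \<and> card \<tau> = i")
        case True
        then have \<tau>: "\<tau> \<in> faces i" by (auto simp: faces_def dividing_def)
        have "boundary (dividing m) (part_chain (Suc i) c m) \<tau> = part_chain i (differential taylor i c) m \<tau>"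
          unfolding part_chain_differential[OF \<tau>] boundary_dividing[OF part_chain_chains] ..
        then show ?thesis by (simp add: strand_diff_def c(2) part_chain_def)
      next
        case False
        have "boundary (dividing m) (part_chain (Suc i) c m) \<tau> = 0" if "\<tau> \<subseteq> dividing m"
        proof -
          have "part_chain (Suc i) c m (insert e \<tau>) = 0" if "e \<notin> \<tau>" for e
            using part_chain_nonzero(2)[of "Suc i" c m "insert e \<tau>"] that False
              finite_subset[OF \<open>\<tau> \<subseteq> dividing m\<close> finite_dividing] \<open>\<tau> \<subseteq> dividing m\<close> by auto
          then show ?thesis by (simp add: boundary_def)
        qed
        then show ?thesis by (simp add: strand_diff_def)
      qed
    qed
  qed
  then show "c \<in> differential taylor (Suc i) ` free_part V taylor (Suc (Suc i))" by auto
next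
  fix c :: "nat \<Rightarrow> ('v, 'k) mpoly"
  assume "c \<in> differential taylor (Suc i) ` free_part V taylor (Suc (Suc i))"
  then obtain y where y: "y \<in> free_part V taylor (Suc (Suc i))" "c = differential taylor (Suc i) y" by auto
  have c: "c \<in> free_part V taylor (Suc i)" using differential_free_part[OF y(1)] y(2) by simp
  have "differential taylor i c = (\<lambda>_. 0)"
  proof (rule part_chain_eqI[OF differential_free_part[OF c]])
    show "(\<lambda>_. 0) \<in> free_part V taylor i" by (simp add: free_part_def)
    fix m \<tau> assume \<tau>: "\<tau> \<in> faces i"
    have "part_chain i (differential taylor i c) m \<tau> = boundary {..<N} (part_chain (Suc i) c m) \<tau>"
      by (rule part_chain_differential[OF \<tau>])
    also have "\<dots> = boundary {..<N} (boundary {..<N} (part_chain (Suc (Suc i)) y m)) \<tau>"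
      unfolding y(2) using insert_face[OF \<tau>] by (intro boundary_cong part_chain_differential) auto
    also have "\<dots> = 0" using faces_finite[OF \<tau>] by (intro boundary_boundary) auto
    finally show "part_chain i (differential taylor i c) m \<tau> = part_chain i (\<lambda>_. 0) m \<tau>"
      by (simp add: part_chain_def)
  qed
  then show "c \<in> {c \<in> free_part V taylor (Suc i). differential taylor i c = (\<lambda>_. 0)}" using c by simp
qed

theorem resolves_taylor:
  "resolves V (monomial_ideal V (s ` {..<N}) :: ('v, 'k::field) mpoly set) taylor (\<lambda>_. 1)"
  unfolding resolves_def
proof (intro conjI allI impI ballI)
  fix l assume "l < rank (taylor :: ('v, 'k, ('v, 'k) mpoly set) free_complex) 0"
  then have "l = 0" by (simp add: faces_0)
  then show "(1 :: ('v, 'k) mpoly) \<in> homogeneous V (shift (taylor :: ('v, 'k, ('v, 'k) mpoly set) free_complex) 0 l)" by (simp add: taylor_def)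
next
  fix i l' l
  assume "l' < rank (taylor :: ('v, 'k, ('v, 'k) mpoly set) free_complex) (Suc i)"
    and "l < rank (taylor :: ('v, 'k, ('v, 'k) mpoly set) free_complex) i"
  then have l: "face (Suc i) l' \<in> faces (Suc i)" by simp
  then have fin: "finite (supp (face (Suc i) l'))" and sub: "supp (face (Suc i) l') \<subseteq> V"
    using finite_supp supp_V by (auto simp: faces_def)
  let ?D = "supp (face (Suc i) l') - supp (face i l)"
  show "diff_coeff taylor i l' l \<in> (homogeneous V (shift (taylor :: ('v, 'k, ('v, 'k) mpoly set) free_complex) (Suc i) l' - shift (taylor :: ('v, 'k, ('v, 'k) mpoly set) free_complex) i l) :: ('v, 'k) mpoly set)"
  proof (cases "face i l \<subset> face (Suc i) l'")
    case True
    then have "supp (face i l) \<subseteq> supp (face (Suc i) l')" by blast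
    then have "int (card ?D) = int (card (supp (face (Suc i) l'))) - int (card (supp (face i l)))"
      using fin by (simp add: card_Diff_subset finite_subset card_mono of_nat_diff)
    then have "Poly_Mapping.single (sqfree ?D) a \<in> homogeneous V (int (card (supp (face (Suc i) l'))) - int (card (supp (face i l))))" for a :: 'k
      using fin sub by (auto simp: homogeneous_def in_poly_ring_iff mon_degree_sqfree)
    then show ?thesis using True by (simp add: taylor_def)
  qed (simp add: taylor_def)
next
  fix p :: "('v, 'k) mpoly" assume "p \<in> carrier (poly_ring V)"
  then have "(\<lambda>l. if l = 0 then p else 0) \<in> free_part V taylor 0" by (simp add: free_part_def faces_0)
  then show "\<exists>c\<in>free_part V taylor 0. cover taylor (\<lambda>_. 1) c - p \<in> monomial_ideal V (s ` {..<N})"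
    by (rule bexI[rotated]) (simp add: cover_taylor monomial_ideal_def)
qed (rule taylor_exact_0, rule taylor_exact_Suc)

section \<open>Squarefree strands of the tensored Taylor complex\<close>

definition strand_of :: "nat \<Rightarrow> 'v set \<Rightarrow> (nat \<Rightarrow> 'k::field) \<Rightarrow> nat set \<Rightarrow> 'k" where
  "strand_of i U x \<sigma> = (if \<sigma> \<in> faces i \<and> supp \<sigma> = U then x (index i \<sigma>) else 0)"

lemma strand_of_chains: "strand_of i U x \<in> chains {..<N} s U i"
  by (auto simp: chains_def strand_of_def faces_def)

text \<open>After tensoring, entries between faces with different unions vanish, so the complex
  splits into strands, one for each union U.\<close>

lemma strand_of_tensor_differential:
  "strand_of i U (tensor_differential taylor i x) = strand_diff {..<N} s U (strand_of (Suc i) U x)"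
proof
  fix \<tau>
  show "strand_of i U (tensor_differential taylor i x) \<tau> = strand_diff {..<N} s U (strand_of (Suc i) U x) \<tau>"
  proof (cases "\<tau> \<in> faces i \<and> supp \<tau> = U")
    case True
    then have \<tau>: "\<tau> \<in> faces i" "\<tau> \<subseteq> {..<N}" "supp \<tau> = U" by (auto simp: faces_def)
    have "tensor_differential taylor i x (index i \<tau>) = boundary {..<N} (strand_of (Suc i) U x) \<tau>"
      unfolding tensor_differential_taylor[OF \<tau>(1)] boundary_def
      using insert_face[OF \<tau>(1)] \<tau>(3) by (intro sum.cong) (auto simp: strand_of_def)
    then show ?thesis using \<tau> by (simp add: strand_of_def strand_diff_def)
  next
    case False
    show ?thesis
    proof (cases "\<tau> \<subseteq> {..<N} \<and> supp \<tau> = U")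
      case True
      then have "finite \<tau>" "card \<tau> \<noteq> i" using False finite_subset by (auto simp: faces_def)
      then have "boundary {..<N} (strand_of (Suc i) U x) \<tau> = 0"
        by (auto simp: boundary_def strand_of_def faces_def intro!: sum.neutral)
      then show ?thesis using False by (auto simp: strand_of_def strand_diff_def)
    next
      case F2: False
      then show ?thesis using False by (auto simp: strand_of_def strand_diff_def)
    qed
  qed
qed

lemma tensor_part_taylor:
  "x \<in> tensor_part (taylor :: ('v, 'k::field, ('v, 'k) mpoly set) free_complex) i j \<longleftrightarrow>
     (\<forall>l. x l \<noteq> 0 \<longrightarrow> l < card (faces i) \<and> int (card (supp (face i l))) = j)"
  by (simp add: tensor_part_def) (simp add: taylor_def)

lemma strand_of_zero:
  "(\<And>U. strand_of i U x = (\<lambda>_. 0)) \<Longrightarrow> l < card (faces i) \<Longrightarrow> x l = 0"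
proof -
  assume *: "\<And>U. strand_of i U x = (\<lambda>_. 0)" and l: "l < card (faces i)"
  have "strand_of i (supp (face i l)) x (face i l) = 0" using * by simp
  then show "x l = 0" using l by (simp add: strand_of_def)
qed

text \<open>A cycle of degree j splits into strands with \<open>card U = j\<close>. Their bounding
  chains are glued into one vector, each face taking its value from the strand of its own
  union.\<close>

lemma tensor_boundaries_taylorI:
  fixes x :: "nat \<Rightarrow> 'k::field"
  assumes x: "x \<in> tensor_cycles (taylor :: ('v, 'k, ('v, 'k) mpoly set) free_complex) i j"
    and exact: "\<And>U. int (card U) = j \<Longrightarrow> strand_exact TYPE('k) {..<N} s U i"
  shows "x \<in> tensor_boundaries (taylor :: ('v, 'k, ('v, 'k) mpoly set) free_complex) i j"
proof -
  let ?T = "taylor :: ('v, 'k, ('v, 'k) mpoly set) free_complex"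
  have part: "x \<in> tensor_part ?T i j" using x by (simp add: tensor_cycles_def)
  have cyc: "strand_diff {..<N} s U (strand_of i U x) = (\<lambda>_. 0)" for U
  proof (cases i)
    case 0
    have "boundary {..<N} (strand_of 0 U x) \<tau> = 0" for \<tau>
      by (auto simp: boundary_def strand_of_def faces_0 intro!: sum.neutral)
    then show ?thesis using 0 by (auto simp: strand_diff_def)
  next
    case (Suc i')
    then have "tensor_differential ?T i' x = (\<lambda>_. 0)" using x by (simp add: tensor_cycles_def)
    then have "strand_diff {..<N} s U (strand_of (Suc i') U x) = strand_of i' U (\<lambda>_. 0)"
      by (simp flip: strand_of_tensor_differential)
    then show ?thesis using Suc by (auto simp: strand_of_def)
  qed
  have "\<exists>b. b \<in> chains {..<N} s U (Suc i) \<and> strand_diff {..<N} s U b = strand_of i U x \<and>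
      (int (card U) \<noteq> j \<longrightarrow> b = (\<lambda>_. 0))" for U
  proof (cases "int (card U) = j")
    case True
    obtain b where "b \<in> chains {..<N} s U (Suc i)" "strand_diff {..<N} s U b = strand_of i U x"
      using strand_exactE[OF exact[OF True] strand_of_chains cyc] by blast
    then show ?thesis using True by auto
  next
    case False
    have "x (index i \<sigma>) = 0" if "\<sigma> \<in> faces i" "supp \<sigma> = U" for \<sigma>
      using part[unfolded tensor_part_taylor, rule_format, of "index i \<sigma>"] that False by auto
    then have "strand_of i U x = (\<lambda>_. 0)" by (auto simp: strand_of_def)
    then show ?thesis
      by (intro exI[of _ "\<lambda>_. 0"]) (auto simp: chains_def strand_diff_def boundary_def)
  qed
  then obtain b where b: "\<And>U. b U \<in> chains {..<N} s U (Suc i)"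
    "\<And>U. strand_diff {..<N} s U (b U) = strand_of i U x" "\<And>U. int (card U) \<noteq> j \<Longrightarrow> b U = (\<lambda>_. 0)"
    by metis
  define z where "z l = (if l < card (faces (Suc i)) then b (supp (face (Suc i) l)) (face (Suc i) l) else 0)" for l
  have z: "z \<in> tensor_part ?T (Suc i) j"
    unfolding tensor_part_taylor using b(3) by (auto simp: z_def split: if_splits) metis
  have strand_z: "strand_of (Suc i) U z = b U" for U
  proof
    fix \<sigma>
    show "strand_of (Suc i) U z \<sigma> = b U \<sigma>"
    proof (cases "\<sigma> \<in> faces (Suc i) \<and> supp \<sigma> = U")
      case True
      then show ?thesis by (auto simp: strand_of_def z_def)
    next
      case False
      then have "b U \<sigma> = 0" by (intro chains_zeroI[OF b(1)]) (auto simp: faces_def)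
      then show ?thesis using False by (auto simp: strand_of_def)
    qed
  qed
  have "tensor_differential ?T i z = x"
  proof
    fix l
    show "tensor_differential ?T i z l = x l"
    proof (cases "l < card (faces i)")
      case True
      have "strand_of i (supp (face i l)) (tensor_differential ?T i z) (face i l) = strand_of i (supp (face i l)) x (face i l)"
        by (simp add: strand_of_tensor_differential strand_z b(2))
      then show ?thesis using True by (simp add: strand_of_def)
    next
      case False
      then have "x l = 0" using part[unfolded tensor_part_taylor] by blast
      then show ?thesis using False by (simp add: tensor_differential_def)
    qed
  qed
  then show ?thesis unfolding tensor_boundaries_def using z by blast
qed

text \<open>A cycle of one strand, extended by zero, is a cycle of the whole complex; a vector
  bounding it would restrict to a chain bounding it within the strand.\<close>

lemma tensor_cycles_neq_boundaries_taylorI: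
  fixes c :: "nat set \<Rightarrow> 'k::field"
  assumes c: "c \<in> chains {..<N} s U i" "strand_diff {..<N} s U c = (\<lambda>_. 0)"
    and not_bd: "c \<notin> strand_diff {..<N} s U ` chains {..<N} s U (Suc i)"
  shows "tensor_cycles (taylor :: ('v, 'k, ('v, 'k) mpoly set) free_complex) i (int (card U)) \<noteq>
    tensor_boundaries (taylor :: ('v, 'k, ('v, 'k) mpoly set) free_complex) i (int (card U))"
proof
  let ?T = "taylor :: ('v, 'k, ('v, 'k) mpoly set) free_complex"
  assume eq: "tensor_cycles ?T i (int (card U)) = tensor_boundaries ?T i (int (card U))"
  define x where "x l = (if l < card (faces i) then c (face i l) else 0)" for l
  have x_nz: "l < card (faces i) \<and> supp (face i l) = U" if "x l \<noteq> 0" for l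
    using that c(1) by (auto simp: x_def chains_def split: if_splits)
  have strand_x: "strand_of i U' x = (if U' = U then c else (\<lambda>_. 0))" for U'
  proof
    fix \<sigma>
    show "strand_of i U' x \<sigma> = (if U' = U then c else (\<lambda>_. 0)) \<sigma>"
    proof (cases "c \<sigma> = 0")
      case True
      then show ?thesis by (auto simp: strand_of_def x_def)
    next
      case False
      then have "\<sigma> \<in> faces i" "supp \<sigma> = U" using c(1) by (auto simp: chains_def faces_def)
      then show ?thesis by (auto simp: strand_of_def x_def)
    qed
  qed
  have "x \<in> tensor_part ?T i (int (card U))"
    unfolding tensor_part_taylor using x_nz by auto
  moreover have "tensor_differential ?T i' x = (\<lambda>_. 0)" if i': "i = Suc i'" for i'
  proof
    fix l
    have "strand_of i' U' (tensor_differential ?T i' x) = (\<lambda>_. 0)" for U'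
    proof (cases "U' = U")
      case True
      then show ?thesis using strand_x[of U] c(2) i' by (simp add: strand_of_tensor_differential)
    next
      case False
      then have "strand_of (Suc i') U' x = (\<lambda>_. 0)" using strand_x i' by simp
      then show ?thesis by (auto simp: strand_of_tensor_differential strand_diff_def boundary_def)
    qed
    then show "tensor_differential ?T i' x l = 0"
      using strand_of_zero[of i' "tensor_differential ?T i' x" l]
      by (cases "l < card (faces i')") (auto simp: tensor_differential_def)
  qed
  ultimately have "x \<in> tensor_boundaries ?T i (int (card U))" using eq by (auto simp: tensor_cycles_def)
  then obtain z where "x = tensor_differential ?T i z" by (auto simp: tensor_boundaries_def)
  then have "c = strand_diff {..<N} s U (strand_of (Suc i) U z)"
    using strand_x[of U] by (simp flip: strand_of_tensor_differential)
  then show False using not_bd strand_of_chains by blast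
qed

end

section \<open>Regularity of edge ideals of chordal graphs\<close>

lemma disjoint_induced_matching:
  "induced_matching H M \<Longrightarrow> f \<in> M \<Longrightarrow> g \<in> M \<Longrightarrow> f \<noteq> g \<Longrightarrow> f \<inter> g = {}"
  unfolding induced_matching_def by blast

theorem regularity_edge_ideal_chordal:
  fixes V :: "'v set" and I :: "('v, 'k::field) mpoly set"
  assumes "finite V" and H: "\<And>f. f \<in> H \<Longrightarrow> f \<subseteq> V \<and> card f = 2" and rk: "elimination_rank H rk"
    and le: "\<And>M. induced_matching H M \<Longrightarrow> card M \<le> m"
    and M: "induced_matching H M" "card M = m"
    and I: "I = edge_ideal (V, H)"
  shows "regularity V (quotient_module (poly_ring V) I) (quotient_grading V I) = int m"
proof -
  have "finite H" by (rule finite_subset[of _ "Pow V"]) (use H \<open>finite V\<close> in auto)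
  then obtain s where s: "bij_betw s {..<card H} H"
    using ex_bij_betw_nat_finite[of H] by (auto simp: lessThan_atLeast0)
  define N where "N = card H"
  have sH: "s ` {..<N} = H" and inj: "inj_on s {..<N}" using s by (auto simp: bij_betw_def N_def)
  have s_in: "s e \<in> H" if "e < N" for e using sH that by auto
  have finV: "finite f" if "f \<in> H" for f using H[OF that] \<open>finite V\<close> finite_subset by blast
  interpret T: taylor V N s
    by unfold_locales (use s_in finV H in auto)
  have I': "I = monomial_ideal V (s ` {..<N})"
    unfolding I sH by (rule edge_ideal_eq_monomial_ideal) (rule H)
  interpret homogeneous_ideal V I unfolding I' by (rule homogeneous_ideal_monomial_ideal)
  let ?T = "T.taylor :: ('v, 'k, ('v, 'k) mpoly set) free_complex"
  have res: "resolves V I ?T (\<lambda>_. 1)" unfolding I' by (rule T.resolves_taylor)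
  have Tor: "Tor_nonzero V quot (quotient_grading V I) i j \<longleftrightarrow> tensor_cycles ?T i j \<noteq> tensor_boundaries ?T i j" for i j
    by (rule Tor_nonzero_iff[OF res]) (simp add: T.taylor_def I')
  have proper: "proper_edges {..<N} s = H"
  proof -
    have "loops {..<N} s = {}"
    proof (rule equals0I)
      fix x assume "x \<in> loops {..<N} s"
      then obtain e where "e < N" "s e = {x}" by (auto simp: loops_def)
      then show False using H[OF s_in, of e] by simp
    qed
    then show ?thesis unfolding proper_edges_def sH using H by auto
  qed
  let ?D = "{j - int i | i j. Tor_nonzero V quot (quotient_grading V I) i j}"

  have upper: "j - int i \<le> int m" if tor: "Tor_nonzero V quot (quotient_grading V I) i j" for i j
  proof (rule ccontr)
    assume big: "\<not> j - int i \<le> int m"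
    have "strand_exact TYPE('k) {..<N} s U i" if U: "int (card U) = j" for U
    proof (rule strand_exact_chordal)
      show "elimination_rank (proper_edges {..<N} s) rk" using rk by (simp add: proper)
      show "card e \<le> m" if "induced_matching (proper_edges {..<N} s) e" for e using le that by (simp add: proper)
      show "card (s e) \<in> {1, 2}" if "e \<in> {..<N}" for e using H[OF s_in, of e] that by simp
    qed (use big U in auto)
    then have "tensor_cycles ?T i j \<subseteq> tensor_boundaries ?T i j"
      using T.tensor_boundaries_taylorI by blast
    then show False using tor tensor_boundaries_subset_cycles[OF res] unfolding Tor by blast
  qed

  \<comment> \<open>\<open>Max\<close> is meaningful only for finite sets. In the Taylor resolution
    i is at most the number of generators and j at most the number of vertices.\<close>
  have "finite ?D"
  proof (rule finite_subset)
    show "?D \<subseteq> (\<lambda>(i, j). j - int i) ` ({..N} \<times> {0..int (card V)})"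
    proof
      fix d assume "d \<in> ?D"
      then obtain i j where d: "d = j - int i" and neq: "tensor_cycles ?T i j \<noteq> tensor_boundaries ?T i j"
        unfolding Tor by blast
      have "\<exists>l. l < card (T.faces i) \<and> int (card (T.supp (T.face i l))) = j"
      proof (rule ccontr)
        assume "\<not> ?thesis"
        then have part: "x = (\<lambda>_. 0)" if "x \<in> tensor_part ?T i j" for x
          using that unfolding T.tensor_part_taylor by fastforce
        have "tensor_cycles ?T i j \<subseteq> {\<lambda>_. 0}" using part by (auto simp: tensor_cycles_def)
        moreover have "(\<lambda>_. 0) \<in> tensor_boundaries ?T i j"
          unfolding tensor_boundaries_def
          by (rule image_eqI[of _ _ "\<lambda>_. 0"]) (auto simp: tensor_differential_def tensor_part_def)
        ultimately show False using neq tensor_boundaries_subset_cycles[OF res] by blast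
      qed
      then obtain l where l: "l < card (T.faces i)" "int (card (T.supp (T.face i l))) = j" by blast
      then have "T.face i l \<subseteq> {..<N}" "card (T.face i l) = i"
        using T.face_in[OF l(1)] by (auto simp: T.faces_def)
      then have "i \<le> N" "card (T.supp (T.face i l)) \<le> card V"
        using card_mono[of "{..<N}" "T.face i l"] card_mono[OF \<open>finite V\<close> T.supp_V] by auto
      then show "d \<in> (\<lambda>(i, j). j - int i) ` ({..N} \<times> {0..int (card V)})"
        using d l(2) by (intro image_eqI[of _ _ "(i, j)"]) auto
    qed
  qed simp

  moreover have "int m \<in> ?D"
  proof -
    \<comment> \<open>The face of all edges of M; its indicator represents the surviving class in
      homological degree m and degree 2m.\<close>
    define \<sigma>0 where "\<sigma>0 = {e. e < N \<and> s e \<in> M}"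
    define U where "U = \<Union>M"
    define c :: "nat set \<Rightarrow> 'k" where "c \<sigma> = (if \<sigma> = \<sigma>0 then 1 else 0)" for \<sigma>
    have MH: "M \<subseteq> H" using M(1) by (simp add: induced_matching_def)
    have s\<sigma>0: "s ` \<sigma>0 = M" using MH sH by (auto simp: \<sigma>0_def)
    have fin\<sigma>0: "finite \<sigma>0" and \<sigma>0N: "\<sigma>0 \<subseteq> {..<N}" by (auto simp: \<sigma>0_def)
    have card\<sigma>0: "card \<sigma>0 = m"
      using card_image[OF inj_on_subset[OF inj \<sigma>0N]] s\<sigma>0 M(2) by simp
    have two: "card f = 2" "finite f" if "f \<in> M" for f using that MH H finV by auto
    have "card U = sum card M"
      unfolding U_def using disjoint_induced_matching[OF M(1)] two
      by (intro card_Union_disjoint) (auto simp: pairwise_def disjnt_def)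
    then have cardU: "card U = 2 * m" using two(1) M(2) by simp
    have c: "c \<in> chains {..<N} s U m"
      using \<sigma>0N card\<sigma>0 s\<sigma>0 by (auto simp: chains_def c_def U_def)
    have "strand_diff {..<N} s U c = (\<lambda>_. 0)"
    proof
      fix \<tau>
      \<comment> \<open>The edges of M are disjoint, so leaving one out uncovers its vertices and no
        facet of \<sigma>0 has union U.\<close>
      have "c (insert e \<tau>) = 0" if \<tau>: "\<tau> \<subseteq> {..<N}" "\<Union> (s ` \<tau>) = U" "e \<in> {..<N} - \<tau>" for e
      proof (rule ccontr)
        assume "c (insert e \<tau>) \<noteq> 0"
        then have ins: "insert e \<tau> = \<sigma>0" by (auto simp: c_def split: if_splits)
        then have e: "s e \<in> M" by (auto simp: \<sigma>0_def)
        then obtain x where x: "x \<in> s e" using two(1)[of "s e"] by fastforce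
        then have "x \<in> U" using e by (auto simp: U_def)
        then obtain e' where e': "e' \<in> \<tau>" "x \<in> s e'" using \<tau>(2) by blast
        then have "s e' \<in> M" "e \<noteq> e'" using ins \<tau>(3) by (auto simp: \<sigma>0_def)
        moreover have "s e \<noteq> s e'" using inj \<tau> e' \<open>e \<noteq> e'\<close> by (auto dest: inj_onD)
        ultimately show False using disjoint_induced_matching[OF M(1) e] x e' by blast
      qed
      then show "strand_diff {..<N} s U c \<tau> = 0" by (simp add: strand_diff_def boundary_def)
    qed
    moreover have "c \<notin> strand_diff {..<N} s U ` chains {..<N} s U (Suc m)"
    proof
      assume "c \<in> strand_diff {..<N} s U ` chains {..<N} s U (Suc m)"
      then obtain b where b: "b \<in> chains {..<N} s U (Suc m)" "c = strand_diff {..<N} s U b" by auto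
      \<comment> \<open>Since M is induced, every edge inside U belongs to M. So \<sigma>0 is the
        largest face with union U, and degree \<open>Suc m\<close> carries no nonzero
        chains.\<close>
      have "b \<sigma> = 0" for \<sigma>
      proof (rule ccontr)
        assume "b \<sigma> \<noteq> 0"
        then have \<sigma>: "\<sigma> \<subseteq> {..<N}" "card \<sigma> = Suc m" "\<Union> (s ` \<sigma>) = U" using b(1) by (auto simp: chains_def)
        have "\<sigma> \<subseteq> \<sigma>0"
        proof
          fix e assume e: "e \<in> \<sigma>"
          then have eN: "e < N" using \<sigma>(1) by auto
          obtain x y where xy: "s e = {x, y}" "x \<noteq> y" using H[OF s_in[OF eN]] card_2_iff by metis
          have "s e \<subseteq> U" using e \<sigma>(3) by blast
          then obtain f g where fg: "f \<in> M" "x \<in> f" "g \<in> M" "y \<in> g" using xy by (auto simp: U_def)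
          have "f = g"
          proof (rule ccontr)
            assume "f \<noteq> g"
            then have "s e \<inter> f = {} \<or> s e \<inter> g = {}"
              using M(1) fg s_in[OF eN] unfolding induced_matching_def by blast
            then show False using xy fg by auto
          qed
          then have "s e \<subseteq> f" "card (s e) = card f" using xy fg two(1) by auto
          then have "s e = f" using two(2)[OF fg(1)] by (intro card_subset_eq)
          then show "e \<in> \<sigma>0" using eN fg by (simp add: \<sigma>0_def)
        qed
        then have "card \<sigma> \<le> card \<sigma>0" by (rule card_mono[OF fin\<sigma>0])
        then show False using \<sigma>(2) card\<sigma>0 by simp
      qed
      then have "c \<sigma>0 = 0" unfolding b(2) by (simp add: strand_diff_def boundary_def)
      then show False by (simp add: c_def)
    qed
    ultimately have "tensor_cycles ?T m (int (card U)) \<noteq> tensor_boundaries ?T m (int (card U))"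
      by (intro T.tensor_cycles_neq_boundaries_taylorI[OF c])
    then have "Tor_nonzero V quot (quotient_grading V I) m (2 * int m)"
      unfolding Tor cardU by simp
    then show ?thesis by force
  qed
  ultimately have "Max ?D = int m" using upper by (intro Max_eqI) auto
  then show ?thesis by (simp add: regularity_def)
qed

section \<open>Induced matchings of fan graphs\<close>

lemma in_complete_edges_iff: "f \<in> complete_edges X \<longleftrightarrow> f \<subseteq> X \<and> card f = 2"
  unfolding complete_edges_def by (auto simp: card_2_iff)

text \<open>Vertices of two different edges of M in a common clique would be distinct and joined by
  an edge, which an induced matching excludes.\<close>

lemma induced_matching_clique:
  assumes "induced_matching H M" "complete_edges K \<subseteq> H" "f \<in> M" "g \<in> M" "x \<in> f \<inter> K" "y \<in> g \<inter> K"
  shows "f = g"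
proof (rule ccontr)
  assume "f \<noteq> g"
  then have disj: "h \<inter> f = {} \<or> h \<inter> g = {}" if "h \<in> H" for h
    using assms(1,3,4) that unfolding induced_matching_def by blast
  have "f \<in> H" using assms(1,3) unfolding induced_matching_def by blast
  then have "x \<noteq> y" using disj assms(5,6) by blast
  then have "{x, y} \<in> H" using assms by (auto simp: in_complete_edges_iff subset_iff)
  then show False using disj assms(5,6) by blast
qed

locale fan_graph =
  fixes C W :: "'v set" and k :: nat and P :: "nat \<Rightarrow> 'v set" and r :: "nat \<Rightarrow> nat"
    and w :: "nat \<Rightarrow> nat \<Rightarrow> 'v" and a :: "nat \<Rightarrow> nat \<Rightarrow> nat" and B :: "nat \<Rightarrow> nat \<Rightarrow> 'v set"
    and G :: "'v graph"
  assumes finite_C: "finite C" and fan: "is_k_fan_graph C W k P r w a B G"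
begin

definition pairs :: "(nat \<times> nat) set" where
  "pairs = (SIGMA i:{1..k}. {1..r i})"

abbreviation clique :: "nat \<times> nat \<Rightarrow> 'v set" where
  "clique q \<equiv> B (fst q) (snd q)"

text \<open>The cliques counted by p: those with at least two new vertices, hence with an edge away
  from the core C.\<close>

definition big :: "(nat \<times> nat) set" where
  "big = {q \<in> pairs. a (fst q) (snd q) - snd q \<ge> 2}"

lemma W_C: "W \<subseteq> C" and W_P: "W = (\<Union>i\<in>{1..k}. P i)"
  and P_disjoint: "i \<in> {1..k} \<Longrightarrow> i' \<in> {1..k} \<Longrightarrow> i \<noteq> i' \<Longrightarrow> P i \<inter> P i' = {}"
  and P_nonempty: "i \<in> {1..k} \<Longrightarrow> P i \<noteq> {}"
  using fan by (auto simp: is_k_fan_graph_def disjoint_family_on_def)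

lemma w_bij: "i \<in> {1..k} \<Longrightarrow> bij_betw (w i) {1..r i} (P i)"
  using fan by (auto simp: is_k_fan_graph_def is_fan_on_def)

lemma clique_props:
  assumes "(i, j) \<in> pairs"
  shows "finite (B i j)" "card (B i j) = a i j" "a i j > j" "C \<inter> B i j = w i ` {1..j}"
  using fan assms by (auto simp: is_k_fan_graph_def is_fan_on_def pairs_def)

lemma finite_pairs: "finite pairs"
  by (simp add: pairs_def)

lemma r_pos: "i \<in> {1..k} \<Longrightarrow> (i, r i) \<in> pairs"
  using w_bij[of i] P_nonempty[of i] by (cases "r i = 0") (auto simp: pairs_def bij_betw_def)

lemma w_inj: "i \<in> {1..k} \<Longrightarrow> inj_on (w i) {1..r i}" and w_P: "i \<in> {1..k} \<Longrightarrow> w i ` {1..r i} = P i"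
  using w_bij by (auto simp: bij_betw_def)

lemma C_clique_W: "q \<in> pairs \<Longrightarrow> C \<inter> clique q \<subseteq> P (fst q)"
proof -
  assume q: "q \<in> pairs"
  then have "fst q \<in> {1..k}" "snd q \<in> {1..r (fst q)}" by (auto simp: pairs_def)
  then have "w (fst q) ` {1..snd q} \<subseteq> P (fst q)" using w_P[of "fst q"] by fastforce
  then show ?thesis using clique_props(4)[of "fst q" "snd q"] q by simp
qed

lemma P_W: "i \<in> {1..k} \<Longrightarrow> P i \<subseteq> W"
  using W_P by auto

text \<open>Clique number j meets the core in exactly j vertices, because \<open>w i\<close> is
  injective. So the numbers \<open>h\<close> of the final theorem count new vertices.\<close>

lemma card_new:
  assumes "(i, j) \<in> pairs"
  shows "card (B i j - C) = a i j - j"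
proof -
  have "i \<in> {1..k}" "{1..j} \<subseteq> {1..r i}" using assms by (auto simp: pairs_def)
  then have "inj_on (w i) {1..j}" using inj_on_subset[OF w_inj] by simp
  then have "card (C \<inter> B i j) = j" by (simp add: clique_props(4)[OF assms] card_image)
  then show ?thesis using clique_props[OF assms] by (simp add: card_Diff_subset_Int Int_commute finite_C)
qed

lemma new_unique:
  assumes "q \<in> pairs" "q' \<in> pairs" "x \<in> clique q" "x \<in> clique q'" "x \<notin> C"
  shows "q = q'"
proof (rule ccontr)
  assume "q \<noteq> q'"
  have "disjoint_family_on (\<lambda>(i, j). B i j - C) pairs"
    using fan by (simp add: is_k_fan_graph_def pairs_def)
  then have "(clique q - C) \<inter> (clique q' - C) = {}"
    using assms(1,2) \<open>q \<noteq> q'\<close> by (fastforce simp: disjoint_family_on_def case_prod_beta)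
  then show False using assms(3-5) by blast
qed

lemma edge_iff: "f \<in> snd G \<longleftrightarrow> f \<in> complete_edges C \<or> (\<exists>q\<in>pairs. f \<in> complete_edges (clique q))"
  using fan by (auto simp: is_k_fan_graph_def pairs_def)

lemma vertices: "fst G = C \<union> (\<Union>q\<in>pairs. clique q)"
  using fan by (auto simp: is_k_fan_graph_def pairs_def)

lemma finite_vertices: "finite (fst G)"
  unfolding vertices using finite_C finite_pairs clique_props(1) by auto

lemma edge_props: "f \<in> snd G \<Longrightarrow> f \<subseteq> fst G \<and> card f = 2"
  unfolding edge_iff vertices in_complete_edges_iff by blast

lemma clique_edges: "q \<in> pairs \<Longrightarrow> complete_edges (clique q) \<subseteq> snd G" and core_edges: "complete_edges C \<subseteq> snd G"
  using edge_iff by auto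

text \<open>A new vertex lies in a single attached clique, so all edges at it stay in that
  clique.\<close>

lemma edge_at_new:
  assumes "f \<in> snd G" "x \<in> f" "x \<notin> C" "q \<in> pairs" "x \<in> clique q"
  shows "f \<subseteq> clique q"
proof -
  obtain q' where "q' \<in> pairs" "f \<subseteq> clique q'"
    using assms(1-3) by (auto simp: edge_iff in_complete_edges_iff)
  then show ?thesis using new_unique[OF assms(4), of q' x] assms by auto
qed

text \<open>New vertices are ranked before the core. The neighbours of a new vertex lie in its
  clique, and the later neighbours of a core vertex lie in the core; both sets are pairwise
  adjacent.\<close>

lemma elimination_rank_exists: "\<exists>rk. elimination_rank (snd G) rk"
proof -
  let ?V = "fst G"
  have "finite (?V - C)" using finite_vertices by simp
  then obtain f where f: "bij_betw f (?V - C) {0..<card (?V - C)}" using ex_bij_betw_finite_nat by blast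
  obtain g where g: "bij_betw g C {0..<card C}" using ex_bij_betw_finite_nat[OF finite_C] by blast
  define rk where "rk x = (if x \<in> C then card (?V - C) + g x else f x)" for x
  have f_less: "f x < card (?V - C)" if "x \<in> ?V" "x \<notin> C" for x
    using f that by (auto simp: bij_betw_def)
  have sub: "\<Union>(snd G) \<subseteq> ?V" using edge_props by blast
  have inj: "inj_on rk (\<Union>(snd G))"
  proof (rule inj_onI)
    fix x y assume xy: "x \<in> \<Union>(snd G)" "y \<in> \<Union>(snd G)" "rk x = rk y"
    then have V: "x \<in> ?V" "y \<in> ?V" using sub by auto
    show "x = y"
    proof (cases "x \<in> C"; cases "y \<in> C")
      assume "x \<in> C" "y \<in> C"
      then show ?thesis using xy(3) g by (auto simp: rk_def bij_betw_def dest: inj_onD)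
    next
      assume "x \<notin> C" "y \<notin> C"
      then show ?thesis using xy(3) f V by (auto simp: rk_def bij_betw_def dest: inj_onD)
    next
      assume "x \<in> C" "y \<notin> C"
      then show ?thesis using xy(3) f_less[OF V(2)] by (simp add: rk_def)
    next
      assume "x \<notin> C" "y \<in> C"
      then show ?thesis using xy(3) f_less[OF V(1)] by (simp add: rk_def)
    qed
  qed
  have "{v, v'} \<in> snd G"
    if uv: "{u, v} \<in> snd G" "{u, v'} \<in> snd G" "v \<noteq> v'" "rk u < rk v" "rk u < rk v'" for u v v'
  proof (cases "u \<in> C")
    case True
    have "v \<in> ?V" "v' \<in> ?V" using uv(1,2) edge_props by blast+
    then have "v \<in> C" "v' \<in> C" using uv(4,5) True f_less by (fastforce simp: rk_def split: if_splits)+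
    then show ?thesis using uv(3) core_edges by (auto simp: in_complete_edges_iff)
  next
    case False
    then obtain q where q: "q \<in> pairs" "u \<in> clique q"
      using uv(1) by (auto simp: edge_iff in_complete_edges_iff)
    then have "v \<in> clique q" "v' \<in> clique q"
      using edge_at_new[OF uv(1) _ False q] edge_at_new[OF uv(2) _ False q] by auto
    then have "{v, v'} \<in> complete_edges (clique q)" using uv(3) by (simp add: in_complete_edges_iff)
    then show ?thesis using clique_edges[OF q(1)] by blast
  qed
  then show ?thesis using inj unfolding elimination_rank_def by blast
qed

lemma finite_big: "finite big"
  using finite_pairs by (simp add: big_def)

text \<open>An edge disjoint from C lies in an attached clique, which thus has two new vertices.
  Distinct edges of M get distinct cliques, as a clique meets at most one edge of M.\<close>

lemma matching_new_edges:
  assumes M: "induced_matching (snd G) M"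
  obtains \<kappa> where "inj_on \<kappa> {f \<in> M. f \<inter> C = {}}" "\<And>f. f \<in> M \<Longrightarrow> f \<inter> C = {} \<Longrightarrow> \<kappa> f \<in> big \<and> f \<subseteq> clique (\<kappa> f)"
proof -
  have "\<exists>q. f \<in> M \<and> f \<inter> C = {} \<longrightarrow> q \<in> big \<and> f \<subseteq> clique q" for f
  proof (cases "f \<in> M \<and> f \<inter> C = {}")
    case True
    then have "f \<in> snd G" using M by (auto simp: induced_matching_def)
    then have f2: "card f = 2" using edge_props by blast
    then have "f \<notin> complete_edges C" using True by (auto simp: in_complete_edges_iff Int_absorb2)
    then obtain q where q: "q \<in> pairs" "f \<subseteq> clique q"
      using \<open>f \<in> snd G\<close> by (auto simp: edge_iff in_complete_edges_iff)
    have "card f \<le> card (clique q - C)"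
      using q True clique_props(1)[of "fst q" "snd q"] by (intro card_mono) auto
    then have "q \<in> big" using q f2 card_new[of "fst q" "snd q"] by (simp add: big_def)
    then show ?thesis using q by blast
  qed blast
  then obtain \<kappa> where \<kappa>: "\<And>f. f \<in> M \<Longrightarrow> f \<inter> C = {} \<Longrightarrow> \<kappa> f \<in> big \<and> f \<subseteq> clique (\<kappa> f)" by metis
  have "inj_on \<kappa> {f \<in> M. f \<inter> C = {}}"
  proof (rule inj_onI)
    fix f g assume fg: "f \<in> {f \<in> M. f \<inter> C = {}}" "g \<in> {f \<in> M. f \<inter> C = {}}" "\<kappa> f = \<kappa> g"
    then have "f \<subseteq> clique (\<kappa> f)" "g \<subseteq> clique (\<kappa> f)" "\<kappa> f \<in> pairs" using \<kappa>[of f] \<kappa>[of g] by (auto simp: big_def)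
    moreover have "card f = 2" "card g = 2" using fg M edge_props by (auto simp: induced_matching_def)
    then obtain x y where "x \<in> f" "y \<in> g" by fastforce
    ultimately show "f = g"
      using induced_matching_clique[OF M clique_edges[of "\<kappa> f"], of f g x y] fg by auto
  qed
  then show thesis using that \<kappa> by blast
qed

lemma finite_induced_matching: "induced_matching (snd G) M \<Longrightarrow> finite M"
  using edge_props finite_vertices unfolding induced_matching_def
  by (meson Pow_iff finite_Pow_iff finite_subset subset_iff)

lemma card_matching_core:
  assumes M: "induced_matching (snd G) M"
  shows "card {f \<in> M. f \<inter> C \<noteq> {}} \<le> 1"
proof -
  have "f = g" if "f \<in> M" "g \<in> M" "f \<inter> C \<noteq> {}" "g \<inter> C \<noteq> {}" for f g
    using induced_matching_clique[OF M core_edges that(1,2)] that(3,4) by blast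
  then show ?thesis
    using card_le_Suc0_iff_eq[of "{f \<in> M. f \<inter> C \<noteq> {}}"] finite_induced_matching[OF M] by simp
qed

lemma card_matching_split:
  assumes M: "induced_matching (snd G) M"
  shows "card M = card {f \<in> M. f \<inter> C = {}} + card {f \<in> M. f \<inter> C \<noteq> {}}"
proof -
  have "M = {f \<in> M. f \<inter> C = {}} \<union> {f \<in> M. f \<inter> C \<noteq> {}}" by blast
  then show ?thesis
    using finite_induced_matching[OF M] card_Un_disjoint[of "{f \<in> M. f \<inter> C = {}}" "{f \<in> M. f \<inter> C \<noteq> {}}"] by fastforce
qed

lemma card_induced_matching_le:
  assumes M: "induced_matching (snd G) M"
  shows "card M \<le> card big + 1"
proof -
  obtain \<kappa> where \<kappa>: "inj_on \<kappa> {f \<in> M. f \<inter> C = {}}" "\<And>f. f \<in> M \<Longrightarrow> f \<inter> C = {} \<Longrightarrow> \<kappa> f \<in> big \<and> f \<subseteq> clique (\<kappa> f)"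
    using matching_new_edges[OF M] by blast
  have "card {f \<in> M. f \<inter> C = {}} \<le> card big"
    using \<kappa> finite_big by (intro card_inj_on_le[of \<kappa>]) auto
  then show ?thesis using card_matching_core[OF M] card_matching_split[OF M] by linarith
qed

text \<open>An edge f of M that meets the core meets some \<open>P i\<close>, and the last clique of
  that fan contains all of \<open>P i\<close>. That clique is big, but f bars every other edge of M
  from it; the extra edge is paid for by a lost one.\<close>

lemma card_induced_matching_le_covered:
  assumes M: "induced_matching (snd G) M"
    and W: "card W \<ge> card C - 1" and last: "\<And>i. i \<in> {1..k} \<Longrightarrow> a i (r i) - r i \<ge> 2"
  shows "card M \<le> card big"
proof -
  obtain \<kappa> where \<kappa>: "inj_on \<kappa> {f \<in> M. f \<inter> C = {}}" "\<And>f. f \<in> M \<Longrightarrow> f \<inter> C = {} \<Longrightarrow> \<kappa> f \<in> big \<and> f \<subseteq> clique (\<kappa> f)"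
    using matching_new_edges[OF M] by blast
  show ?thesis
  proof (cases "{f \<in> M. f \<inter> C \<noteq> {}} = {}")
    case True
    have "card {f \<in> M. f \<inter> C = {}} \<le> card big"
      using \<kappa> finite_big by (intro card_inj_on_le[of \<kappa>]) auto
    then show ?thesis using card_matching_split[OF M] unfolding True by simp
  next
    case False
    then obtain f where f: "f \<in> M" "f \<inter> C \<noteq> {}" by blast
    then have "f \<in> snd G" using M by (auto simp: induced_matching_def)
    \<comment> \<open>At most one core vertex lies outside W, so an edge inside the core meets W; an
      attached clique meets the core only in W.\<close>
    have "\<exists>x. x \<in> f \<inter> W"
    proof (cases "f \<in> complete_edges C")
      case True
      show ?thesis
      proof (rule ccontr)
        assume "\<not> ?thesis"
        then have "f \<subseteq> C - W" "card f = 2" using True by (auto simp: in_complete_edges_iff)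
        then have "2 \<le> card (C - W)" using card_mono[of "C - W" f] finite_C by simp
        moreover have "card (C - W) = card C - card W"
          using W_C finite_C by (meson card_Diff_subset finite_subset)
        ultimately show False using W by linarith
      qed
    next
      case False
      then obtain q where q: "q \<in> pairs" "f \<subseteq> clique q"
        using \<open>f \<in> snd G\<close> by (auto simp: edge_iff in_complete_edges_iff)
      then have "fst q \<in> {1..k}" by (auto simp: pairs_def)
      then show ?thesis using f(2) q C_clique_W[OF q(1)] P_W by blast
    qed
    then obtain x i where x: "x \<in> f" "i \<in> {1..k}" "x \<in> P i" using W_P by blast
    let ?q = "(i, r i)"
    have q: "?q \<in> pairs" "?q \<in> big" using r_pos[OF x(2)] last[OF x(2)] by (auto simp: big_def)
    have xq: "x \<in> clique ?q" using clique_props(4)[OF q(1)] w_P[OF x(2)] x(3) by auto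
    have "\<kappa> g \<noteq> ?q" if g: "g \<in> M" "g \<inter> C = {}" for g
    proof
      assume "\<kappa> g = ?q"
      then have "g \<subseteq> clique ?q" using \<kappa>(2)[OF g] by simp
      moreover have "card g = 2" using g M edge_props by (auto simp: induced_matching_def)
      then obtain y where "y \<in> g" by fastforce
      ultimately have "f = g"
        using induced_matching_clique[OF M clique_edges[OF q(1)] f(1) g(1), of x y] x(1) xq by auto
      then show False using f g by blast
    qed
    with \<kappa>(2) have "\<kappa> ` {f \<in> M. f \<inter> C = {}} \<subseteq> big - {?q}" by (intro image_subsetI) simp
    then have "card {f \<in> M. f \<inter> C = {}} \<le> card (big - {?q})"
      using \<kappa>(1) finite_big by (intro card_inj_on_le[of \<kappa>]) auto
    also have "\<dots> = card big - 1" using q(2) by simp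
    finally show ?thesis
      using card_matching_core[OF M] card_matching_split[OF M] q(2) finite_big
        card_gt_0_iff[of big] by fastforce
  qed
qed

text \<open>One edge is taken among the new vertices of each big clique. Edges at new vertices stay
  in their clique, so none joins two of the chosen edges.\<close>

lemma big_matching_exists:
  obtains M where "induced_matching (snd G) M" "card M = card big" "\<And>f. f \<in> M \<Longrightarrow> \<exists>q\<in>big. f \<subseteq> clique q - C"
proof -
  have "\<exists>f. q \<in> big \<longrightarrow> f \<subseteq> clique q - C \<and> card f = 2" for q
    using card_new[of "fst q" "snd q"] obtain_subset_with_card_n[of 2 "clique q - C"]
    by (cases "q \<in> big") (auto simp: big_def)
  then obtain e where e: "\<And>q. q \<in> big \<Longrightarrow> e q \<subseteq> clique q - C" "\<And>q. q \<in> big \<Longrightarrow> card (e q) = 2" by metis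
  have big_pairs: "q \<in> big \<Longrightarrow> q \<in> pairs" for q by (simp add: big_def)
  have edge: "e q \<in> snd G" if "q \<in> big" for q
  proof -
    have "e q \<in> complete_edges (clique q)"
      using e(1)[OF that] e(2)[OF that] by (auto simp: in_complete_edges_iff)
    then show ?thesis using clique_edges[OF big_pairs[OF that]] by blast
  qed
  have sep: "q = q'" if q: "q \<in> big" "q' \<in> big" "h \<in> snd G" "h \<inter> e q \<noteq> {}" "h \<inter> e q' \<noteq> {}" for q q' h
  proof -
    obtain x y where xy: "x \<in> h" "x \<in> e q" "y \<in> h" "y \<in> e q'" using q(4,5) by blast
    have "h \<subseteq> clique q" using edge_at_new[OF q(3) xy(1) _ big_pairs[OF q(1)]] e(1)[OF q(1)] xy(2) by blast
    then have "y \<in> clique q" using xy(3) by blast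
    moreover have "y \<in> clique q'" "y \<notin> C" using e(1)[OF q(2)] xy(4) by auto
    ultimately show ?thesis using new_unique big_pairs q(1,2) by blast
  qed
  have nonempty: "e q \<noteq> {}" if "q \<in> big" for q using e(2)[OF that] by auto
  have "inj_on e big"
  proof (rule inj_onI)
    fix q q' assume q: "q \<in> big" "q' \<in> big" "e q = e q'"
    then show "q = q'" using sep[OF q(1,2) edge[OF q(1)]] nonempty[OF q(1)] by simp
  qed
  then have "card (e ` big) = card big" by (rule card_image)
  moreover have "induced_matching (snd G) (e ` big)"
    unfolding induced_matching_def using edge sep by blast
  ultimately show thesis using that[of "e ` big"] e(1) by blast
qed

text \<open>The big cliques supply edges made of new vertices. Any edge meeting one of these lies
  inside its big clique, from which e is disjoint.\<close>

lemma matching_with_core_edge: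
  assumes e: "e \<in> snd G" "\<And>q. q \<in> big \<Longrightarrow> e \<inter> clique q = {}"
  shows "\<exists>M. induced_matching (snd G) M \<and> card M = card big + 1"
proof -
  obtain M where M: "induced_matching (snd G) M" "card M = card big" "\<And>f. f \<in> M \<Longrightarrow> \<exists>q\<in>big. f \<subseteq> clique q - C"
    by (rule big_matching_exists) blast
  have far: "h \<inter> e = {} \<or> h \<inter> f = {}" if hf: "h \<in> snd G" "f \<in> M" for h f
  proof (rule ccontr)
    assume "\<not> ?thesis"
    then obtain x where x: "x \<in> h" "x \<in> f" "h \<inter> e \<noteq> {}" by blast
    obtain q where q: "q \<in> big" "f \<subseteq> clique q - C" using M(3)[OF hf(2)] by blast
    then have "h \<subseteq> clique q" using edge_at_new[OF hf(1) x(1), of q] x(2) by (auto simp: big_def)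
    then show False using e(2)[OF q(1)] x(3) by blast
  qed
  have "e \<notin> M"
  proof
    assume "e \<in> M"
    then have "e = {}" using far[OF e(1)] by blast
    then show False using edge_props[OF e(1)] by simp
  qed
  moreover have "induced_matching (snd G) (insert e M)"
    unfolding induced_matching_def
  proof (intro conjI ballI impI)
    show "insert e M \<subseteq> snd G" using e(1) M(1) by (simp add: induced_matching_def)
    fix f g h assume fgh: "f \<in> insert e M" "g \<in> insert e M" "f \<noteq> g" "h \<in> snd G"
    show "h \<inter> f = {} \<or> h \<inter> g = {}"
      using fgh far[OF fgh(4)] M(1) unfolding induced_matching_def by blast
  qed
  ultimately show ?thesis
    using M(2) finite_induced_matching[OF M(1)] by (intro exI[of _ "insert e M"]) simp
qed

text \<open>Two core vertices outside W lie in no attached clique, so the edge between them can be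
  added.\<close>

lemma matching_uncovered:
  assumes "card W < card C - 1"
  shows "\<exists>M. induced_matching (snd G) M \<and> card M = card big + 1"
proof -
  have "card (C - W) = card C - card W"
    using W_C finite_C by (meson card_Diff_subset finite_subset)
  then have "2 \<le> card (C - W)" using assms by linarith
  then obtain e where e: "e \<subseteq> C - W" "card e = 2" using obtain_subset_with_card_n by metis
  then have "e \<in> complete_edges C" by (auto simp: in_complete_edges_iff)
  then have "e \<in> snd G" using core_edges by blast
  moreover have "e \<inter> clique q = {}" if q: "q \<in> big" for q
  proof -
    have "q \<in> pairs" "fst q \<in> {1..k}" using q by (auto simp: big_def pairs_def)
    then have "C \<inter> clique q \<subseteq> W" using C_clique_W[of q] P_W by blast
    then show ?thesis using e by blast
  qed
  ultimately show ?thesis by (rule matching_with_core_edge)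
qed

text \<open>The vertex \<open>w i (r i)\<close> belongs to the last clique of its fan and to no
  other attached clique. Joined to a new vertex of that clique, which is not big, it gives an edge
  disjoint from all big cliques.\<close>

lemma matching_small_last:
  assumes i: "i \<in> {1..k}" "\<not> a i (r i) - r i \<ge> 2"
  shows "\<exists>M. induced_matching (snd G) M \<and> card M = card big + 1"
proof -
  note q = r_pos[OF i(1)]
  have "card (B i (r i) - C) > 0" using card_new[OF q] clique_props(3)[OF q] by simp
  then obtain y where y: "y \<in> B i (r i)" "y \<notin> C" by (auto simp: card_gt_0_iff)
  let ?x = "w i (r i)"
  have x: "?x \<in> B i (r i)" "?x \<in> C" using clique_props(4)[OF q] q by (auto simp: pairs_def)
  have "?x \<noteq> y" using x y by auto
  have notbig: "(i, r i) \<notin> big" using i by (simp add: big_def)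
  have "{?x, y} \<in> complete_edges (clique (i, r i))"
    using x y \<open>?x \<noteq> y\<close> by (simp add: in_complete_edges_iff)
  then have "{?x, y} \<in> snd G" using clique_edges[OF q] by blast
  moreover have "{?x, y} \<inter> clique q' = {}" if q': "q' \<in> big" for q'
  proof -
    have p: "q' \<in> pairs" "fst q' \<in> {1..k}" "snd q' \<in> {1..r (fst q')}" using q' by (auto simp: big_def pairs_def)
    have "y \<notin> clique q'" using new_unique[OF q p(1)] y notbig q' by auto
    moreover have "?x \<notin> clique q'"
    proof
      assume "?x \<in> clique q'"
      then have x': "?x \<in> w (fst q') ` {1..snd q'}" using x(2) clique_props(4)[of "fst q'" "snd q'"] p(1) by auto
      have "?x \<in> P i" using w_P[OF i(1)] q by (auto simp: pairs_def)
      moreover have "?x \<in> P (fst q')" using C_clique_W[OF p(1)] x(2) \<open>?x \<in> clique q'\<close> by blast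
      ultimately have fst: "fst q' = i" using P_disjoint[OF i(1) p(2)] by blast
      then obtain l where l: "l \<in> {1..snd q'}" "?x = w i l" using x' by auto
      then have "l = r i" using inj_onD[OF w_inj[OF i(1)], of "r i" l] p(3) q fst by (auto simp: pairs_def)
      then have "q' = (i, r i)" using l(1) p(3) fst by (cases q') auto
      then show False using notbig q' by simp
    qed
    ultimately show ?thesis by blast
  qed
  ultimately show ?thesis by (rule matching_with_core_edge)
qed

end

theorem theorem2p8:
  fixes n k p :: nat
    and C W :: "'v set"
    and P :: "nat \<Rightarrow> 'v set"
    and r :: "nat \<Rightarrow> nat"
    and w :: "nat \<Rightarrow> nat \<Rightarrow> 'v"
    and a h :: "nat \<Rightarrow> nat \<Rightarrow> nat"
    and B :: "nat \<Rightarrow> nat \<Rightarrow> 'v set"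
    and G :: "'v graph"
    and I :: "('v, 'k::field) mpoly set"
  assumes "n \<ge> 2"
    and "finite C" and "card C = n"
    and "is_k_fan_graph C W k P r w a B G"
    and "\<And>i j. h i j = a i j - j"
    and "p = card {(i, j). i \<in> {1..k} \<and> j \<in> {1..r i} \<and> h i j \<ge> 2}"
    and "I = edge_ideal G"
  shows "regularity (fst G) (quotient_module (poly_ring (fst G)) I) (quotient_grading (fst G) I) =
    (if card W \<ge> n - 1 \<and> (\<forall>i \<in> {1..k}. h i (r i) \<ge> 2) then int p else int p + 1)"
proof -
  interpret fan_graph C W k P r w a B G using assms(2,4) by unfold_locales
  have "big = {(i, j). i \<in> {1..k} \<and> j \<in> {1..r i} \<and> h i j \<ge> 2}"
    by (auto simp: big_def pairs_def assms(5))
  then have p: "card big = p" using assms(6) by simp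
  obtain rk where rk: "elimination_rank (snd G) rk" using elimination_rank_exists by blast
  have I: "I = edge_ideal (fst G, snd G)" using assms(7) by simp
  \<comment> \<open>Each case now reduces to an upper bound on induced matchings together with one
    matching attaining it.\<close>
  have reg: "regularity (fst G) (quotient_module (poly_ring (fst G)) I) (quotient_grading (fst G) I) = int m"
    if "\<And>M'. induced_matching (snd G) M' \<Longrightarrow> card M' \<le> m" "induced_matching (snd G) M" "card M = m" for m M
    by (rule regularity_edge_ideal_chordal[OF finite_vertices _ rk that I]) (rule edge_props)
  show ?thesis
  proof (cases "card W \<ge> n - 1 \<and> (\<forall>i \<in> {1..k}. h i (r i) \<ge> 2)")
    case True
    obtain M where M: "induced_matching (snd G) M" "card M = card big" by (rule big_matching_exists) blast
    have le: "card M' \<le> p" if "induced_matching (snd G) M'" for M'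
      using card_induced_matching_le_covered[OF that] True p by (simp add: assms(3,5))
    show ?thesis using reg[OF le M(1)] M(2) p True by simp
  next
    case False
    then have "card W < card C - 1 \<or> (\<exists>i \<in> {1..k}. \<not> a i (r i) - r i \<ge> 2)"
      by (auto simp: assms(3,5))
    then obtain M where M: "induced_matching (snd G) M" "card M = card big + 1"
      using matching_uncovered matching_small_last by blast
    have le: "card M' \<le> p + 1" if "induced_matching (snd G) M'" for M'
      using card_induced_matching_le[OF that] p by simp
    have "regularity (fst G) (quotient_module (poly_ring (fst G)) I) (quotient_grading (fst G) I) = int (p + 1)"
      using reg[OF le M(1)] M(2) p by simp
    then show ?thesis using False by simp
  qed
qed

end
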